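(* Let $a(s)=a_3s^3+a_2s^2+a_1s+a_0$ and $b(s)=b_3s^3+b_2s^2+b_1s+b_0$ be coprime real polynomials, with $a_3,b_3$ not both zero and $b_i>0$ for at least one $i\in\{0,1,2,3\}$, and let $Z=a/b$. Let the polynomials $\alpha,\beta,\kappa,c_0,c_1,c_2,d_0,d_1,d_2,\gamma_1,\gamma_2,\gamma_3,\lambda_1,\lambda_2,\lambda_3,\lambda_4\in\mathbb{R}[u]$, the number $F_0(a,b)$, the conditions (C1)--(C4), (E1)--(E4) on a real number $\tilde x$, and the network classes be as defined in the context. If $Z$ is the impedance of a network from one of the classes $\mathcal{N}_{10},\mathcal{N}_{11},\mathcal{N}_{12},\mathcal{N}_{13}$, then there exists $\tilde x\ge0$ such that one of the following pairs of conditions holds: (a) (C1) and (E1); (b) (C2) and (E2); (c) (C3) and (E3); or (d) (C4) and (E4). In each case an explicit realization for $Z$ is obtained as follows (all polynomials are evaluated at $\tilde x$, and $F_0=F_0(a,b)$): 1. If $\tilde x\ge0$ is such that (C1) holds, then $\beta,d_0,d_2\ne0$, $\kappa,\gamma_1>0$, and $Z$ is the impedance of $N_{10}$ with $R_1=\frac{\kappa c_0}{d_0}$, $R_2=\frac{\kappa\gamma_2}{d_0d_2}$, $G_3=\frac{d_2\lambda_1}{\beta^4\kappa^2F_0}$, $R_4=\frac{\alpha}{\beta}$, $R_5=\frac{\kappa\tilde x}{\beta^2}$, $C_1=\frac{d_2^2\gamma_1}{\beta^4\kappa^2F_0}$, $L_1=\frac{\kappa\gamma_1}{d_0^2}$,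 $L_2=\frac{\kappa}{\beta^2}$. In particular, if (E1)(i) (resp. (E1)(ii), (E1)(iii)) holds, then $R_5=0$ (resp. $G_3=0$, $R_1=0$), so this network is from class $\mathcal{N}_{18}$ (resp. $\mathcal{N}_{17}$, $\mathcal{N}_{16}$). 2. If $\tilde x\ge0$ is such that (C2) holds, then $\beta,d_0,d_2\ne0$, $\kappa,-\gamma_3>0$, and $Z$ is the impedance of $N_{11}$ with $R_1=\frac{\kappa c_2}{d_2}$, $R_2=\frac{-\kappa\gamma_2}{d_0d_2}$, $G_3=\frac{d_0\lambda_3}{\beta^4\kappa^2F_0}$, $R_4=\frac{\alpha}{\beta}$, $R_5=\frac{\kappa\tilde x}{\beta^2}$, $C_1=\frac{-d_2^2}{\kappa\gamma_3}$, $L_1=\frac{-\beta^4\kappa^2F_0}{d_0^2\gamma_3}$, $L_2=\frac{\kappa}{\beta^2}$. In particular, if (E2)(i) (resp. (E2)(ii), (E2)(iii)) holds, then $R_5=0$ (resp. $G_3=0$, $R_1=0$), so this network is from class $\mathcal{N}_{21}$ (resp. $\mathcal{N}_{20}$, $\mathcal{N}_{19}$). 3. If $\tilde x\ge0$ is such that (C3) holds, then $\beta,c_0,c_2\ne0$, $\kappa,-\gamma_1>0$, and $Z$ is the impedance of $N_{12}$ with $G_1=\frac{d_0}{\kappa c_0}$, $G_2=\frac{-\gamma_2}{\kappa c_0c_2}$, $R_3=\frac{c_2\lambda_4}{\beta^4F_0}$, $R_4=\frac{\alpha}{\beta}$, $R_5=\frac{\kappa\tilde x}{\beta^2}$, $C_1=\frac{-\gamma_1}{\kappa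 c_0^2}$, $L_1=\frac{-c_2^2\gamma_1}{\beta^4F_0}$, $L_2=\frac{\kappa}{\beta^2}$. In particular, if (E3)(i) (resp. (E3)(ii), (E3)(iii)) holds, then $R_5=0$ (resp. $R_3=0$, $G_1=0$), so this network is from class $\mathcal{N}_{24}$ (resp. $\mathcal{N}_{23}$, $\mathcal{N}_{22}$). 4. If $\tilde x\ge0$ is such that (C4) holds, then $\beta,c_0,c_2\ne0$, $\kappa,\gamma_3>0$, and $Z$ is the impedance of $N_{13}$ with $G_1=\frac{d_2}{\kappa c_2}$, $G_2=\frac{\gamma_2}{\kappa c_0c_2}$, $R_3=\frac{c_0\lambda_2}{\beta^4F_0}$, $R_4=\frac{\alpha}{\beta}$, $R_5=\frac{\kappa\tilde x}{\beta^2}$, $C_1=\frac{\beta^4F_0}{c_0^2\gamma_3}$, $L_1=\frac{\kappa c_2^2}{\gamma_3}$, $L_2=\frac{\kappa}{\beta^2}$. In particular, if (E4)(i) (resp. (E4)(ii), (E4)(iii)) holds, then $R_5=0$ (resp. $R_3=0$, $G_1=0$), so this network is from class $\mathcal{N}_{27}$ (resp. $\mathcal{N}_{26}$, $\mathcal{N}_{25}$).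
   Context: **Networks.** Networks are built from resistors (impedance $R$), inductors (impedance $Ls$) and capacitors (impedance $1/(Cs)$) by series connection (impedances add, written $+$) and parallel connection ($1/(Z_1\parallel Z_2)=1/Z_1+1/Z_2$). A resistor of resistance $R=0$ is a short circuit; a resistor of conductance $G=0$, written $1/G$, is an open circuit. The class $\mathcal{N}_k$ ($k=10,\ldots,13$) is the set of all networks of the form $N_k$ with all $R_j\ge0$, $G_j\ge0$ and $C_1,L_1,L_2>0$, where - $N_{10}$: $R_4+\left[(R_5+L_2s)\parallel\left(R_1+\left(L_1s\parallel\left(R_2+\left(\frac1{G_3}\parallel\frac1{C_1s}\right)\right)\right)\right)\right]$; - $N_{11}$: $R_4+\left[(R_5+L_2s)\parallel\left(R_1+\left(\frac1{C_1s}\parallel\left(R_2+\left(\frac1{G_3}\parallel L_1s\right)\right)\right)\right)\right]$; - $N_{12}$: $R_4+\left[(R_5+L_2s)\parallel\frac1{G_1}\parallel\left(\frac1{C_1s}+\left(\frac1{G_2}\parallel(R_3+L_1s)\right)\right)\right]$; - $N_{13}$: $R_4+\left[(R_5+L_2s)\parallel\frac1{G_1}\parallel\left(L_1s+\left(\frac1{G_2}\parallel\left(R_3+\frac1{C_1s}\right)\right)\right)\right]$. Subclasses obtained by removing one element: $\mathcal{N}_{16},\mathcal{N}_{17},\mathcal{N}_{18}$ are $\mathcal{N}_{10}$ with $R_1=0$, $G_3=0$, $R_5=0$ respectively; $\mathcal{N}_{19},\mathcal{N}_{20},\mathcal{N}_{21}$ are $\mathcal{N}_{11}$ with $R_1=0$,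 $G_3=0$, $R_5=0$; $\mathcal{N}_{22},\mathcal{N}_{23},\mathcal{N}_{24}$ are $\mathcal{N}_{12}$ with $G_1=0$, $R_3=0$, $R_5=0$; $\mathcal{N}_{25},\mathcal{N}_{26},\mathcal{N}_{27}$ are $\mathcal{N}_{13}$ with $G_1=0$, $R_3=0$, $R_5=0$. **Algebra.** $F_0(a,b)$ is the determinant of the $6\times6$ matrix with rows $(b_3,b_2,b_1,b_0,0,0)$, $(a_3,a_2,a_1,a_0,0,0)$, $(0,b_3,b_2,b_1,b_0,0)$, $(0,a_3,a_2,a_1,a_0,0)$, $(0,0,b_3,b_2,b_1,b_0)$, $(0,0,a_3,a_2,a_1,a_0)$. For polynomials $p,q$ in $s$ of degree at most $3$ (coefficients possibly polynomials in $u$), $\mathcal{B}(q,p)$ is the $3\times3$ matrix with $\frac{q(z)p(w)-p(z)q(w)}{z-w}=\sum_{i,j=1}^3\mathcal{B}_{ij}z^{i-1}w^{j-1}$. Define $[c_0\ c_1\ c_2](u)=[1\ -u\ u^2]\,\mathcal{B}(a,b)$, $\alpha(u)=-a_3u^3+a_2u^2-a_1u+a_0$, $\beta(u)=-b_3u^3+b_2u^2-b_1u+b_0$, $\kappa(u)=c_2(u)u^2-c_1(u)u+c_0(u)$, $[d_0\ d_1\ d_2](u)=\beta(u)\,[1\ -u\ u^2]\,\mathcal{B}(b,c)(u)$, where $c(s)=c_2s^2+c_1s+c_0$ is viewed as a polynomial in $s$ with coefficients in $\mathbb{R}[u]$; and $\gamma_1=c_1d_0-c_0d_1$, $\gamma_2=c_2d_0-c_0d_2$,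 $\gamma_3=c_2d_1-c_1d_2$, $\lambda_1=d_1\gamma_1-d_0\gamma_2$, $\lambda_2=c_1\gamma_3-c_2\gamma_2$, $\lambda_3=d_2\gamma_2-d_1\gamma_3$, $\lambda_4=c_0\gamma_2-c_1\gamma_1$. A set of real numbers "have the same sign" if all are non-negative or all are non-positive. **Conditions.** (C1) $a_i,b_i\ge0$ for $i=0,1,2,3$; $\alpha(\tilde x),\beta(\tilde x),c_0(\tilde x),c_1(\tilde x),c_2(\tilde x),d_0(\tilde x),d_1(\tilde x),d_2(\tilde x)$ and $\lambda_1(\tilde x)$ have the same sign; $\kappa(\tilde x),\gamma_2(\tilde x)\ge0$; $F_0(a,b)>0$. (C2) As (C1) but with $\lambda_3(\tilde x)$ in place of $\lambda_1(\tilde x)$ and $\kappa(\tilde x),-\gamma_2(\tilde x)\ge0$ in place of $\kappa(\tilde x),\gamma_2(\tilde x)\ge0$. (C3) As (C1) but with $\lambda_4(\tilde x)$ in place of $\lambda_1(\tilde x)$ and $\kappa(\tilde x),-\gamma_2(\tilde x)\ge0$. (C4) As (C1) but with $\lambda_2(\tilde x)$ in place of $\lambda_1(\tilde x)$ (and $\kappa(\tilde x),\gamma_2(\tilde x)\ge0$). (E1) (i) $\tilde x=0$; or (ii) $\lambda_1(\tilde x)=0$; or (iii) $c_0(\tilde x)=0$. (E2) (i) $\tilde x=0$; or (ii) $\lambda_3(\tilde x)=0$; or (iii) $c_2(\tilde x)=0$. (E3) (i) $\tilde x=0$; or (ii) $\lambda_4(\tilde x)=0$; or (iii) $d_0(\tilde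 x)=0$. (E4) (i) $\tilde x=0$; or (ii) $\lambda_2(\tilde x)=0$; or (iii) $d_2(\tilde x)=0$. *)

theory Defs
  imports
    "HOL-Computational_Algebra.Fraction_Field"
    "HOL-Computational_Algebra.Polynomial"
    "Jordan_Normal_Form.Determinant"
begin

section \<open>Networks and impedances\<close>

text \<open>
  \<open>Resistor R\<close> is given by its resistance (\<open>R = 0\<close>: short circuit) and \<open>Conductor G\<close> is a
  resistor given by its conductance, i.e. of impedance \<open>1/G\<close> (\<open>G = 0\<close>: open circuit).
\<close>

datatype network =
    Resistor real
  | Conductor real
  | Inductor real
  | Capacitor real
  | Series network network (infixr "\<oplus>\<^sub>s" 65)
  | Parallel network network (infixr "\<parallel>\<^sub>p" 70)

text \<open>
  Impedances are real rational functions in the indeterminate \<open>s\<close>, extended by \<open>None\<close>, the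
  infinite impedance of an open circuit, with the conventions \<open>1/0 = \<infinity>\<close>, \<open>1/\<infinity> = 0\<close> and
  \<open>\<infinity> + Z = \<infinity>\<close>.
\<close>

type_synonym impedance = "real poly fract option"

definition imp_poly :: "real poly \<Rightarrow> impedance" where
  "imp_poly p = Some (Fract p 1)"

fun imp_inverse :: "impedance \<Rightarrow> impedance" where
  "imp_inverse None = Some 0"
| "imp_inverse (Some z) = (if z = 0 then None else Some (inverse z))"

fun imp_add :: "impedance \<Rightarrow> impedance \<Rightarrow> impedance" where
  "imp_add (Some z) (Some w) = Some (z + w)"
| "imp_add _ _ = None"

primrec impedance :: "network \<Rightarrow> impedance" where
  "impedance (Resistor R) = imp_poly [:R:]"
| "impedance (Conductor G) = imp_inverse (imp_poly [:G:])"
| "impedance (Inductor L) = imp_poly [:0, L:]"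
| "impedance (Capacitor C) = imp_inverse (imp_poly [:0, C:])"
| "impedance (M \<oplus>\<^sub>s N) = imp_add (impedance M) (impedance N)"
| "impedance (M \<parallel>\<^sub>p N) =
    imp_inverse (imp_add (imp_inverse (impedance M)) (imp_inverse (impedance N)))"

definition net10 :: "real \<Rightarrow> real \<Rightarrow> real \<Rightarrow> real \<Rightarrow> real \<Rightarrow> real \<Rightarrow> real \<Rightarrow> real \<Rightarrow> network" where
  "net10 R1 R2 G3 R4 R5 C1 L1 L2 =
    Resistor R4 \<oplus>\<^sub>s
      ((Resistor R5 \<oplus>\<^sub>s Inductor L2) \<parallel>\<^sub>p
       (Resistor R1 \<oplus>\<^sub>s (Inductor L1 \<parallel>\<^sub>p (Resistor R2 \<oplus>\<^sub>s (Conductor G3 \<parallel>\<^sub>p Capacitor C1)))))"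

definition net11 :: "real \<Rightarrow> real \<Rightarrow> real \<Rightarrow> real \<Rightarrow> real \<Rightarrow> real \<Rightarrow> real \<Rightarrow> real \<Rightarrow> network" where
  "net11 R1 R2 G3 R4 R5 C1 L1 L2 =
    Resistor R4 \<oplus>\<^sub>s
      ((Resistor R5 \<oplus>\<^sub>s Inductor L2) \<parallel>\<^sub>p
       (Resistor R1 \<oplus>\<^sub>s (Capacitor C1 \<parallel>\<^sub>p (Resistor R2 \<oplus>\<^sub>s (Conductor G3 \<parallel>\<^sub>p Inductor L1)))))"

definition net12 :: "real \<Rightarrow> real \<Rightarrow> real \<Rightarrow> real \<Rightarrow> real \<Rightarrow> real \<Rightarrow> real \<Rightarrow> real \<Rightarrow> network" where
  "net12 G1 G2 R3 R4 R5 C1 L1 L2 =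
    Resistor R4 \<oplus>\<^sub>s
      ((Resistor R5 \<oplus>\<^sub>s Inductor L2) \<parallel>\<^sub>p Conductor G1 \<parallel>\<^sub>p
       (Capacitor C1 \<oplus>\<^sub>s (Conductor G2 \<parallel>\<^sub>p (Resistor R3 \<oplus>\<^sub>s Inductor L1))))"

definition net13 :: "real \<Rightarrow> real \<Rightarrow> real \<Rightarrow> real \<Rightarrow> real \<Rightarrow> real \<Rightarrow> real \<Rightarrow> real \<Rightarrow> network" where
  "net13 G1 G2 R3 R4 R5 C1 L1 L2 =
    Resistor R4 \<oplus>\<^sub>s
      ((Resistor R5 \<oplus>\<^sub>s Inductor L2) \<parallel>\<^sub>p Conductor G1 \<parallel>\<^sub>p
       (Inductor L1 \<oplus>\<^sub>s (Conductor G2 \<parallel>\<^sub>p (Resistor R3 \<oplus>\<^sub>s Capacitor C1))))"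

definition class10 :: "network set" where
  "class10 = {net10 R1 R2 G3 R4 R5 C1 L1 L2 | R1 R2 G3 R4 R5 C1 L1 L2.
     R1 \<ge> 0 \<and> R2 \<ge> 0 \<and> G3 \<ge> 0 \<and> R4 \<ge> 0 \<and> R5 \<ge> 0 \<and> C1 > 0 \<and> L1 > 0 \<and> L2 > 0}"

definition class11 :: "network set" where
  "class11 = {net11 R1 R2 G3 R4 R5 C1 L1 L2 | R1 R2 G3 R4 R5 C1 L1 L2.
     R1 \<ge> 0 \<and> R2 \<ge> 0 \<and> G3 \<ge> 0 \<and> R4 \<ge> 0 \<and> R5 \<ge> 0 \<and> C1 > 0 \<and> L1 > 0 \<and> L2 > 0}"

definition class12 :: "network set" where
  "class12 = {net12 G1 G2 R3 R4 R5 C1 L1 L2 | G1 G2 R3 R4 R5 C1 L1 L2.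
     G1 \<ge> 0 \<and> G2 \<ge> 0 \<and> R3 \<ge> 0 \<and> R4 \<ge> 0 \<and> R5 \<ge> 0 \<and> C1 > 0 \<and> L1 > 0 \<and> L2 > 0}"

definition class13 :: "network set" where
  "class13 = {net13 G1 G2 R3 R4 R5 C1 L1 L2 | G1 G2 R3 R4 R5 C1 L1 L2.
     G1 \<ge> 0 \<and> G2 \<ge> 0 \<and> R3 \<ge> 0 \<and> R4 \<ge> 0 \<and> R5 \<ge> 0 \<and> C1 > 0 \<and> L1 > 0 \<and> L2 > 0}"

definition class16 :: "network set" where
  "class16 = {net10 0 R2 G3 R4 R5 C1 L1 L2 | R2 G3 R4 R5 C1 L1 L2. True} \<inter> class10"

definition class17 :: "network set" where
  "class17 = {net10 R1 R2 0 R4 R5 C1 L1 L2 | R1 R2 R4 R5 C1 L1 L2. True} \<inter> class10"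

definition class18 :: "network set" where
  "class18 = {net10 R1 R2 G3 R4 0 C1 L1 L2 | R1 R2 G3 R4 C1 L1 L2. True} \<inter> class10"

definition class19 :: "network set" where
  "class19 = {net11 0 R2 G3 R4 R5 C1 L1 L2 | R2 G3 R4 R5 C1 L1 L2. True} \<inter> class11"

definition class20 :: "network set" where
  "class20 = {net11 R1 R2 0 R4 R5 C1 L1 L2 | R1 R2 R4 R5 C1 L1 L2. True} \<inter> class11"

definition class21 :: "network set" where
  "class21 = {net11 R1 R2 G3 R4 0 C1 L1 L2 | R1 R2 G3 R4 C1 L1 L2. True} \<inter> class11"

definition class22 :: "network set" where
  "class22 = {net12 0 G2 R3 R4 R5 C1 L1 L2 | G2 R3 R4 R5 C1 L1 L2. True} \<inter> class12"

definition class23 :: "network set" where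
  "class23 = {net12 G1 G2 0 R4 R5 C1 L1 L2 | G1 G2 R4 R5 C1 L1 L2. True} \<inter> class12"

definition class24 :: "network set" where
  "class24 = {net12 G1 G2 R3 R4 0 C1 L1 L2 | G1 G2 R3 R4 C1 L1 L2. True} \<inter> class12"

definition class25 :: "network set" where
  "class25 = {net13 0 G2 R3 R4 R5 C1 L1 L2 | G2 R3 R4 R5 C1 L1 L2. True} \<inter> class13"

definition class26 :: "network set" where
  "class26 = {net13 G1 G2 0 R4 R5 C1 L1 L2 | G1 G2 R4 R5 C1 L1 L2. True} \<inter> class13"

definition class27 :: "network set" where
  "class27 = {net13 G1 G2 R3 R4 0 C1 L1 L2 | G1 G2 R3 R4 C1 L1 L2. True} \<inter> class13"


section \<open>Sylvester determinant and Bezoutian\<close>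

definition F0 :: "real poly \<Rightarrow> real poly \<Rightarrow> real" where
  "F0 a b = (let a0 = coeff a 0; a1 = coeff a 1; a2 = coeff a 2; a3 = coeff a 3;
                 b0 = coeff b 0; b1 = coeff b 1; b2 = coeff b 2; b3 = coeff b 3
    in det (mat_of_rows_list 6
      [[b3, b2, b1, b0,  0,  0],
       [a3, a2, a1, a0,  0,  0],
       [ 0, b3, b2, b1, b0,  0],
       [ 0, a3, a2, a1, a0,  0],
       [ 0,  0, b3, b2, b1, b0],
       [ 0,  0, a3, a2, a1, a0]]))"

text \<open>
  Polynomials in two indeterminates \<open>z\<close>, \<open>w\<close> are elements of \<open>'a poly poly\<close>, with \<open>z\<close> the outer
  and \<open>w\<close> the inner indeterminate.  Matrix indices start at 0, so entry \<open>(i, j)\<close> is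
  the coefficient of \<open>z^i * w^j\<close>.
\<close>

definition in_z :: "'a::idom poly \<Rightarrow> 'a poly poly" where
  "in_z p = map_poly (\<lambda>x. [:x:]) p"

definition in_w :: "'a::idom poly \<Rightarrow> 'a poly poly" where
  "in_w p = [:p:]"

definition is_bezoutian :: "'a::idom poly \<Rightarrow> 'a poly \<Rightarrow> 'a mat \<Rightarrow> bool" where
  "is_bezoutian q p B \<longleftrightarrow> B \<in> carrier_mat 3 3 \<and>
     in_z q * in_w p - in_z p * in_w q =
     (in_z [:0, 1:] - in_w [:0, 1:]) * (\<Sum>i<3. \<Sum>j<3. monom (monom (B $$ (i, j)) j) i)"

definition bezoutian :: "'a::idom poly \<Rightarrow> 'a poly \<Rightarrow> 'a mat" where
  "bezoutian q p = (THE B. is_bezoutian q p B)"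

lemma is_bezoutian_unique:
  assumes "is_bezoutian q p A" "is_bezoutian q p B"
  shows "A = B"
proof -
  let ?S = "\<lambda>M. \<Sum>i<3. \<Sum>j<3. monom (monom (M $$ (i, j)) j) i"
  have nz: "in_z [:0, 1:] - in_w [:0, 1:] \<noteq> (0 :: 'a poly poly)"
    by (simp add: in_z_def in_w_def map_poly_pCons)
  have "(in_z [:0, 1:] - in_w [:0, 1:]) * ?S A = (in_z [:0, 1:] - in_w [:0, 1:]) * ?S B"
    using assms unfolding is_bezoutian_def by argo
  then have eq: "?S A = ?S B"
    by (rule mult_left_cancel[OF nz, THEN iffD1])
  have coeff: "coeff (coeff (?S M) i) j = M $$ (i, j)" if "i < 3" "j < 3" for M :: "'a mat" and i j
  proof -
    have "coeff (?S M) i = (\<Sum>i'<3. if i' = i then \<Sum>j<3. monom (M $$ (i', j)) j else 0)"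
      unfolding coeff_sum by (intro sum.cong refl) simp
    also have "\<dots> = (\<Sum>j<3. monom (M $$ (i, j)) j)"
      using that by (subst sum.delta) auto
    finally have "coeff (coeff (?S M) i) j = (\<Sum>j'<3. if j' = j then M $$ (i, j') else 0)"
      by (simp add: coeff_sum)
    also have "\<dots> = M $$ (i, j)"
      using that by (subst sum.delta) auto
    finally show ?thesis .
  qed
  have "A $$ (i, j) = B $$ (i, j)" if "i < 3" "j < 3" for i j
    using coeff[OF that, of A] coeff[OF that, of B] eq by simp
  then show ?thesis
    using assms unfolding is_bezoutian_def by (intro eq_matI) auto
qed

lemma poly_deg3:
  fixes p :: "'a::idom poly"
  assumes "degree p \<le> 3"
  shows "p = [:coeff p 0, coeff p 1, coeff p 2, coeff p 3:]"
proof (rule poly_eqI)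
  fix n
  show "coeff p n = coeff [:coeff p 0, coeff p 1, coeff p 2, coeff p 3:] n"
  proof (cases "n \<le> 3")
    case True
    then have "n \<in> {0,1,2,3}" by auto
    then show ?thesis by (auto simp: numeral_2_eq_2 numeral_3_eq_3)
  next
    case False
    then have "coeff p n = 0" using assms by (intro coeff_eq_0) auto
    moreover have "n = Suc (Suc (Suc (Suc (n - 4))))"
      using False by simp
    ultimately show ?thesis by (metis coeff_pCons_Suc coeff_0)
  qed
qed

lemma bezout_identity:
  fixes z w :: "'a::comm_ring_1"
  shows "(q0 + q1 * z + q2 * z^2 + q3 * z^3) * (p0 + p1 * w + p2 * w^2 + p3 * w^3)
       - (p0 + p1 * z + p2 * z^2 + p3 * z^3) * (q0 + q1 * w + q2 * w^2 + q3 * w^3) =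
    (z - w) *
      ((q1 * p0 - p1 * q0) + (q2 * p0 - p2 * q0) * w + (q3 * p0 - p3 * q0) * w^2
     + ((q2 * p0 - p2 * q0) + ((q3 * p0 - p3 * q0) + (q2 * p1 - p2 * q1)) * w
        + (q3 * p1 - p3 * q1) * w^2) * z
     + ((q3 * p0 - p3 * q0) + (q3 * p1 - p3 * q1) * w + (q3 * p2 - p3 * q2) * w^2) * z^2)"
  by (simp add: algebra_simps power2_eq_square power3_eq_cube)

text \<open>The Bezoutian of polynomials of degree at most 3 is well defined; its explicit form:\<close>

lemma bezoutian_eq:
  fixes q p :: "'a::idom poly"
  assumes "degree q \<le> 3" "degree p \<le> 3"
  defines "D \<equiv> \<lambda>m n. coeff q m * coeff p n - coeff p m * coeff q n"
  defines "B \<equiv> mat_of_rows_list 3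
     [[D 1 0, D 2 0, D 3 0],
      [D 2 0, D 3 0 + D 2 1, D 3 1],
      [D 3 0, D 3 1, D 3 2]]"
  shows "is_bezoutian q p (bezoutian q p)" and "bezoutian q p = B"
proof -
  define k :: "'a \<Rightarrow> 'a poly poly" where "k = (\<lambda>x. [:[:x:]:])"
  define z w :: "'a poly poly" where "z = [:0, 1:]" and "w = [:[:0, 1:]:]"
  have k: "k (x + y) = k x + k y" "k (x - y) = k x - k y" "k (x * y) = k x * k y" for x y
    by (simp_all add: k_def)
  have in_z: "in_z r = k (coeff r 0) + k (coeff r 1) * z + k (coeff r 2) * z^2 + k (coeff r 3) * z^3"
    if deg: "degree r \<le> 3" for r
  proof -
    obtain r0 r1 r2 r3 where r: "r = [:r0, r1, r2, r3:]"
      using poly_deg3[OF deg] by blast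
    show ?thesis
      unfolding r in_z_def
      by (simp add: map_poly_pCons k_def z_def numeral_2_eq_2 numeral_3_eq_3)
  qed
  have in_w: "in_w r = k (coeff r 0) + k (coeff r 1) * w + k (coeff r 2) * w^2 + k (coeff r 3) * w^3"
    if deg: "degree r \<le> 3" for r
  proof -
    obtain r0 r1 r2 r3 where r: "r = [:r0, r1, r2, r3:]"
      using poly_deg3[OF deg] by blast
    show ?thesis
      unfolding r in_w_def
      by (simp add: k_def w_def numeral_2_eq_2 numeral_3_eq_3)
  qed
  have mm: "monom (monom x j) i = k x * w^j * z^i" for x i j
  proof -
    have "w^j = [:monom 1 j:]"
      by (simp add: w_def poly_const_pow monom_altdef)
    moreover have "z^i = monom 1 i"
      by (simp add: z_def monom_altdef)
    ultimately show ?thesis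
      by (simp add: k_def smult_monom)
  qed
  have c: "B \<in> carrier_mat 3 3"
    unfolding B_def mat_of_rows_list_def by (intro carrier_matI) simp_all
  have ent: "B $$ (0,0) = D 1 0" "B $$ (0,1) = D 2 0" "B $$ (0,2) = D 3 0"
    "B $$ (1,0) = D 2 0" "B $$ (1,1) = D 3 0 + D 2 1" "B $$ (1,2) = D 3 1"
    "B $$ (2,0) = D 3 0" "B $$ (2,1) = D 3 1" "B $$ (2,2) = D 3 2"
    unfolding B_def mat_of_rows_list_def by simp_all
  have lt3: "{..<3} = {0, 1, 2::nat}"
    by auto
  have sum: "(\<Sum>i<3. \<Sum>j<3. monom (monom (B $$ (i, j)) j) i) =
      (k (D 1 0) + k (D 2 0) * w + k (D 3 0) * w^2)
    + (k (D 2 0) + k (D 3 0 + D 2 1) * w + k (D 3 1) * w^2) * z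
    + (k (D 3 0) + k (D 3 1) * w + k (D 3 2) * w^2) * z^2"
    unfolding lt3 mm
    by (simp add: ent[unfolded One_nat_def] distrib_right)
  have zw: "in_z [:0, 1:] = z" "in_w [:0, 1:] = w"
    by (simp_all add: in_z_def in_w_def map_poly_pCons z_def w_def)
  have "is_bezoutian q p B"
    unfolding is_bezoutian_def sum zw in_z[OF assms(1)] in_z[OF assms(2)]
      in_w[OF assms(1)] in_w[OF assms(2)] bezout_identity
    using c by (simp only: D_def k)
  moreover from this show "bezoutian q p = B"
    unfolding bezoutian_def by (intro the_equality is_bezoutian_unique)
  ultimately show "is_bezoutian q p (bezoutian q p)"
    by simp
qed


section \<open>Polynomials in \<open>u\<close>\<close>

definition const_coeffs :: "real poly \<Rightarrow> real poly poly" where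
  "const_coeffs p = map_poly (\<lambda>x. [:x:]) p"

definition u_row :: "real poly mat" where
  "u_row = mat_of_rows_list 3 [[1, [:0, -1:], [:0, 0, 1:]]]"

definition alpha :: "real poly \<Rightarrow> real poly" where
  "alpha a = [:coeff a 0, - coeff a 1, coeff a 2, - coeff a 3:]"

definition beta :: "real poly \<Rightarrow> real poly" where
  "beta b = [:coeff b 0, - coeff b 1, coeff b 2, - coeff b 3:]"

definition c_poly :: "real poly \<Rightarrow> real poly \<Rightarrow> nat \<Rightarrow> real poly" where
  "c_poly a b j = (u_row * bezoutian (const_coeffs a) (const_coeffs b)) $$ (0, j)"

definition kappa :: "real poly \<Rightarrow> real poly \<Rightarrow> real poly" where
  "kappa a b = c_poly a b 2 * [:0, 1:]^2 - c_poly a b 1 * [:0, 1:] + c_poly a b 0"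

definition d_poly :: "real poly \<Rightarrow> real poly \<Rightarrow> nat \<Rightarrow> real poly" where
  "d_poly a b j =
    beta b * (u_row * bezoutian (const_coeffs b) [:c_poly a b 0, c_poly a b 1, c_poly a b 2:])
      $$ (0, j)"

definition gamma1 :: "real poly \<Rightarrow> real poly \<Rightarrow> real poly" where
  "gamma1 a b = c_poly a b 1 * d_poly a b 0 - c_poly a b 0 * d_poly a b 1"

definition gamma2 :: "real poly \<Rightarrow> real poly \<Rightarrow> real poly" where
  "gamma2 a b = c_poly a b 2 * d_poly a b 0 - c_poly a b 0 * d_poly a b 2"

definition gamma3 :: "real poly \<Rightarrow> real poly \<Rightarrow> real poly" where
  "gamma3 a b = c_poly a b 2 * d_poly a b 1 - c_poly a b 1 * d_poly a b 2"

definition lambda1 :: "real poly \<Rightarrow> real poly \<Rightarrow> real poly" where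
  "lambda1 a b = d_poly a b 1 * gamma1 a b - d_poly a b 0 * gamma2 a b"

definition lambda2 :: "real poly \<Rightarrow> real poly \<Rightarrow> real poly" where
  "lambda2 a b = c_poly a b 1 * gamma3 a b - c_poly a b 2 * gamma2 a b"

definition lambda3 :: "real poly \<Rightarrow> real poly \<Rightarrow> real poly" where
  "lambda3 a b = d_poly a b 2 * gamma2 a b - d_poly a b 1 * gamma3 a b"

definition lambda4 :: "real poly \<Rightarrow> real poly \<Rightarrow> real poly" where
  "lambda4 a b = c_poly a b 0 * gamma2 a b - c_poly a b 1 * gamma1 a b"


section \<open>Conditions\<close>

definition same_sign :: "real set \<Rightarrow> bool" where
  "same_sign S \<longleftrightarrow> (\<forall>x\<in>S. x \<ge> 0) \<or> (\<forall>x\<in>S. x \<le> 0)"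

text \<open>The part shared by all four conditions; \<open>l\<close> is the respective \<open>lambda\<close> polynomial.\<close>

definition cond_common :: "real poly \<Rightarrow> real poly \<Rightarrow> real poly \<Rightarrow> real \<Rightarrow> bool" where
  "cond_common a b l x \<longleftrightarrow>
    (\<forall>i\<in>{0..3}. coeff a i \<ge> 0 \<and> coeff b i \<ge> 0) \<and>
    same_sign {poly (alpha a) x, poly (beta b) x,
      poly (c_poly a b 0) x, poly (c_poly a b 1) x, poly (c_poly a b 2) x,
      poly (d_poly a b 0) x, poly (d_poly a b 1) x, poly (d_poly a b 2) x, poly l x} \<and>
    poly (kappa a b) x \<ge> 0 \<and> F0 a b > 0"

definition cond_C1 :: "real poly \<Rightarrow> real poly \<Rightarrow> real \<Rightarrow> bool" where
  "cond_C1 a b x \<longleftrightarrow> cond_common a b (lambda1 a b) x \<and> poly (gamma2 a b) x \<ge> 0"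

definition cond_C2 :: "real poly \<Rightarrow> real poly \<Rightarrow> real \<Rightarrow> bool" where
  "cond_C2 a b x \<longleftrightarrow> cond_common a b (lambda3 a b) x \<and> - poly (gamma2 a b) x \<ge> 0"

definition cond_C3 :: "real poly \<Rightarrow> real poly \<Rightarrow> real \<Rightarrow> bool" where
  "cond_C3 a b x \<longleftrightarrow> cond_common a b (lambda4 a b) x \<and> - poly (gamma2 a b) x \<ge> 0"

definition cond_C4 :: "real poly \<Rightarrow> real poly \<Rightarrow> real \<Rightarrow> bool" where
  "cond_C4 a b x \<longleftrightarrow> cond_common a b (lambda2 a b) x \<and> poly (gamma2 a b) x \<ge> 0"

definition cond_E1 :: "real poly \<Rightarrow> real poly \<Rightarrow> real \<Rightarrow> bool" where
  "cond_E1 a b x \<longleftrightarrow> x = 0 \<or> poly (lambda1 a b) x = 0 \<or> poly (c_poly a b 0) x = 0"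

definition cond_E2 :: "real poly \<Rightarrow> real poly \<Rightarrow> real \<Rightarrow> bool" where
  "cond_E2 a b x \<longleftrightarrow> x = 0 \<or> poly (lambda3 a b) x = 0 \<or> poly (c_poly a b 2) x = 0"

definition cond_E3 :: "real poly \<Rightarrow> real poly \<Rightarrow> real \<Rightarrow> bool" where
  "cond_E3 a b x \<longleftrightarrow> x = 0 \<or> poly (lambda4 a b) x = 0 \<or> poly (d_poly a b 0) x = 0"

definition cond_E4 :: "real poly \<Rightarrow> real poly \<Rightarrow> real \<Rightarrow> bool" where
  "cond_E4 a b x \<longleftrightarrow> x = 0 \<or> poly (lambda2 a b) x = 0 \<or> poly (d_poly a b 2) x = 0"

end

theory Submission
  imports
    Defs
    "HOL-Analysis.Elementary_Metric_Spaces"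
    "HOL-Computational_Algebra.Polynomial_Factorial"
    "HOL-Computational_Algebra.Field_as_Ring"
begin

text \<open>
  Put \<open>x = R\<^sub>5/L\<^sub>2\<close>.  Subtracting \<open>R\<^sub>4 = Z(-x)\<close> from \<open>Z\<close> and then the residue at \<open>s = -x\<close> from the
  inverse leaves the biquadratic impedance \<open>\<kappa> c(s)/d(s)\<close>, because
  \<open>\<beta> a - \<alpha> b = (s + x) c\<close> and \<open>\<beta> (\<kappa> b - \<beta> c) = (s + x) d\<close>.  This biquadratic is expanded into a ladder.
  The four conditions are one and the same condition up to swapping \<open>c\<close> with \<open>d\<close> (duality) and
  reversing coefficients (\<open>s \<mapsto> 1/s\<close>).  The resultant of \<open>c\<close> and \<open>d\<close> is \<open>\<beta>^4 \<kappa> F\<^sub>0\<close>, so \<open>F\<^sub>0 > 0\<close>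
  excludes the degenerate cases.

  For the conditions (E1)--(E4), take the least \<open>x \<ge> 0\<close> at which (C1) or (C2) holds (respectively (C3) or (C4)).
  If \<open>x > 0\<close> and (E1) fails, all inequalities of (C1) are strict except possibly those on \<open>\<alpha>\<close>
  and \<open>\<gamma>\<^sub>2\<close>.  Now \<open>\<alpha>/\<beta>\<close> has derivative \<open>-\<kappa>/\<beta>^2 < 0\<close>, and where \<open>\<gamma>\<^sub>2\<close> changes sign (C2)
  takes over from (C1), so \<open>x\<close> could be decreased.
\<close>

section \<open>Resultants\<close>

text \<open>The row (1, -u, u^2) sets z = -u in the Bezoutian, so \<open>c\<close> and
  \<open>d\<close> arise as exact quotients by s + x without any division, and \<open>kappa\<close>,
  the Bezoutian at z = w = -x, is the Wronskian a'b - ab' at -x; this is where the derivative of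
  \<alpha>/\<beta> comes from. Leading and constant coefficients may vanish, so resultants are
  handled as fixed forms in the coefficients, by polynomial identities, and never through degrees or
  roots. Two identities carry the sign arguments. The first, d0 Res(c,d) = d2 gamma1^2 - gamma2
  lambda1, turns the weak inequalities of (C1) into the strict ones needed for positive elements,
  and it also simplifies the last remainder of the ladder expansion. The second, c0 lambda3 = d1 c2
  gamma1 where gamma2 = 0, shows that lambda3 already has the required sign when gamma2 is about to
  change sign. As a decrease of x may lead from one condition to the other, the minimum is taken
  over both jointly.\<close>

text \<open>Laplace expansion along the first column: on row lists, a minor arises by dropping one
  row and taking tails of the others. Sizes are in successor form so that the expansion can be
  iterated by rewriting.\<close>

lemma det_mat_of_rows_list_Suc:
  fixes rows :: "'a::comm_ring_1 list list"
  assumes "length rows = Suc n" "\<forall>r\<in>set rows. length r = Suc n"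
  shows "det (mat_of_rows_list (Suc n) rows) = (\<Sum>i<Suc n. (-1)^i * hd (rows ! i) *
    det (mat_of_rows_list n (map tl (take i rows @ drop (Suc i) rows))))"
proof -
  let ?A = "mat_of_rows_list (Suc n) rows"
  have A: "?A \<in> carrier_mat (Suc n) (Suc n)"
    using assms by (simp add: mat_of_rows_list_def)
  have len: "length (rows ! i) = Suc n" if "i < Suc n" for i
    using assms that by auto
  have "?A $$ (i, 0) * cofactor ?A i 0 = (-1)^i * hd (rows ! i) *
      det (mat_of_rows_list n (map tl (take i rows @ drop (Suc i) rows)))" if i: "i < Suc n" for i
  proof -
    have "mat_delete ?A i 0 = mat_of_rows_list n (map tl (take i rows @ drop (Suc i) rows))"
      using assms i len
      by (intro eq_matI) (auto simp: mat_of_rows_list_def mat_delete_def nth_append nth_tl min_def)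
    moreover have "?A $$ (i, 0) = hd (rows ! i)"
      using assms i len[OF i] by (simp add: mat_of_rows_list_def hd_conv_nth flip: length_greater_0_conv)
    ultimately show ?thesis
      by (simp add: cofactor_def)
  qed
  then show ?thesis
    by (simp add: laplace_expansion_column[OF A, of 0])
qed

lemma det_mat_of_rows_list_0: "det (mat_of_rows_list 0 []) = 1"
  by (simp add: mat_of_rows_list_def det_def)

section \<open>Cofactor expansions in sizes 1 to 5\<close>

lemma det_rows_list_1:
  fixes a0 :: "'a::comm_ring_1"
  shows "det (mat_of_rows_list (Suc 0) [[a0]]) = a0"
  by (subst det_mat_of_rows_list_Suc) (simp_all add: det_mat_of_rows_list_0)

lemma det_rows_list_2:
  fixes a0 :: "'a::comm_ring_1"
  shows "det (mat_of_rows_list (Suc (Suc 0)) [[a0, a1], [b0, b1]]) =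
      a0 * det (mat_of_rows_list (Suc 0) [[b1]])
      - b0 * det (mat_of_rows_list (Suc 0) [[a1]])"
  by (subst det_mat_of_rows_list_Suc) simp_all

lemma det_rows_list_3:
  fixes a0 :: "'a::comm_ring_1"
  shows "det (mat_of_rows_list (Suc (Suc (Suc 0))) [[a0, a1, a2], [b0, b1, b2], [c0, c1, c2]]) =
      a0 * det (mat_of_rows_list (Suc (Suc 0)) [[b1, b2], [c1, c2]])
      - b0 * det (mat_of_rows_list (Suc (Suc 0)) [[a1, a2], [c1, c2]])
      + c0 * det (mat_of_rows_list (Suc (Suc 0)) [[a1, a2], [b1, b2]])"
  by (subst det_mat_of_rows_list_Suc) simp_all

lemma det_rows_list_4:
  fixes a0 :: "'a::comm_ring_1"
  shows "det (mat_of_rows_list (Suc (Suc (Suc (Suc 0)))) [[a0, a1, a2, a3], [b0, b1, b2, b3], [c0, c1, c2, c3], [d0, d1, d2, d3]]) =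
      a0 * det (mat_of_rows_list (Suc (Suc (Suc 0))) [[b1, b2, b3], [c1, c2, c3], [d1, d2, d3]])
      - b0 * det (mat_of_rows_list (Suc (Suc (Suc 0))) [[a1, a2, a3], [c1, c2, c3], [d1, d2, d3]])
      + c0 * det (mat_of_rows_list (Suc (Suc (Suc 0))) [[a1, a2, a3], [b1, b2, b3], [d1, d2, d3]])
      - d0 * det (mat_of_rows_list (Suc (Suc (Suc 0))) [[a1, a2, a3], [b1, b2, b3], [c1, c2, c3]])"
  by (subst det_mat_of_rows_list_Suc) simp_all

text \<open>The two zeros in the first column are those of the minors of the Sylvester matrix;
  building them in leaves three terms instead of five.\<close>

lemma det_rows_list_5:
  fixes a0 :: "'a::comm_ring_1"
  shows "det (mat_of_rows_list (Suc (Suc (Suc (Suc (Suc 0))))) [[a0, a1, a2, a3, a4], [b0, b1, b2, b3, b4], [c0, c1, c2, c3, c4], [0, d1, d2, d3, d4], [0, e1, e2, e3, e4]]) =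
      a0 * det (mat_of_rows_list (Suc (Suc (Suc (Suc 0)))) [[b1, b2, b3, b4], [c1, c2, c3, c4], [d1, d2, d3, d4], [e1, e2, e3, e4]])
      - b0 * det (mat_of_rows_list (Suc (Suc (Suc (Suc 0)))) [[a1, a2, a3, a4], [c1, c2, c3, c4], [d1, d2, d3, d4], [e1, e2, e3, e4]])
      + c0 * det (mat_of_rows_list (Suc (Suc (Suc (Suc 0)))) [[a1, a2, a3, a4], [b1, b2, b3, b4], [d1, d2, d3, d4], [e1, e2, e3, e4]])"
  by (subst det_mat_of_rows_list_Suc) simp_all

text \<open>The determinant of the 3x3 Bezoutian of two cubics, which is the Sylvester determinant
  up to sign. It depends only on the minors \<open>D\<close> of coefficient pairs; these are
  unchanged when a multiple of b is added to a and scale linearly with a, so the resultant rules are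
  easy to check in this form.\<close>

definition bez_det :: "real \<Rightarrow> real \<Rightarrow> real \<Rightarrow> real \<Rightarrow> real \<Rightarrow> real \<Rightarrow> real \<Rightarrow> real \<Rightarrow> real" where
  "bez_det a0 a1 a2 a3 b0 b1 b2 b3 =
    (let D10 = a1*b0-b1*a0; D20 = a2*b0-b2*a0; D30=a3*b0-b3*a0; D21=a2*b1-b2*a1; D31=a3*b1-b3*a1; D32=a3*b2-b3*a2 in
      D10 * ((D30+D21)*D32 - D31^2) - D20 * (D20*D32 - D31*D30) + D30 * (D20*D31 - (D30+D21)*D30))"

text \<open>
  The resultant of a cubic \<open>b\<close> and a quadratic \<open>c\<close> in hybrid Bezout form: the determinant with rows the
  coefficients of \<open>c\<close>, of \<open>c\<^sub>2 b - b\<^sub>3 s c\<close> and of \<open>(c\<^sub>2 s + c\<^sub>1) b - (b\<^sub>3 s + b\<^sub>2) s c\<close>.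
\<close>

definition res32 :: "real \<Rightarrow> real \<Rightarrow> real \<Rightarrow> real \<Rightarrow> real \<Rightarrow> real \<Rightarrow> real \<Rightarrow> real" where
  "res32 b0 b1 b2 b3 c0 c1 c2 =
    c0 * ((c2*b1-b3*c0)^2 - (c2*b2-b3*c1) * (c2*b0+c1*b1-b2*c0))
  - c1 * (c2*b0*(c2*b1-b3*c0) - (c2*b2-b3*c1)*(c1*b0))
  + c2 * (c2*b0*(c2*b0+c1*b1-b2*c0) - (c2*b1-b3*c0)*(c1*b0))"

lemma det_sylvester:
  fixes a0 :: real
  shows "det (mat_of_rows_list 6
      [[b3, b2, b1, b0,  0,  0],
       [a3, a2, a1, a0,  0,  0],
       [ 0, b3, b2, b1, b0,  0],
       [ 0, a3, a2, a1, a0,  0],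
       [ 0,  0, b3, b2, b1, b0],
       [ 0,  0, a3, a2, a1, a0]]) = - bez_det a0 a1 a2 a3 b0 b1 b2 b3" (is "det (mat_of_rows_list 6 ?rows) = _")
proof -
  have "det (mat_of_rows_list 6 ?rows) =
    b3 * det (mat_of_rows_list (Suc (Suc (Suc (Suc (Suc 0)))))
      [[a2, a1, a0,  0,  0],
       [b3, b2, b1, b0,  0],
       [a3, a2, a1, a0,  0],
       [0, b3, b2, b1, b0],
       [0, a3, a2, a1, a0]]) -
    a3 * det (mat_of_rows_list (Suc (Suc (Suc (Suc (Suc 0)))))
      [[b2, b1, b0,  0,  0],
       [b3, b2, b1, b0,  0],
       [a3, a2, a1, a0,  0],
       [0, b3, b2, b1, b0],
       [0, a3, a2, a1, a0]])"
    using det_mat_of_rows_list_Suc[of ?rows "Suc (Suc (Suc (Suc (Suc 0))))"]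
    by (simp add: eval_nat_numeral)
  also have "\<dots> = - bez_det a0 a1 a2 a3 b0 b1 b2 b3"
    unfolding det_rows_list_5 det_rows_list_4 det_rows_list_3 det_rows_list_2 det_rows_list_1
    unfolding bez_det_def Let_def by (simp add: algebra_simps power2_eq_square)
  finally show ?thesis .
qed

lemma bez_det_mult: "bez_det (k * a0) (k * a1) (k * a2) (k * a3) b0 b1 b2 b3 = k^3 * bez_det a0 a1 a2 a3 b0 b1 b2 b3"
proof -
  have *: "k * u * v - v' * (k * u') = k * (u * v - v' * u')" for u v u' v' by (simp add: algebra_simps)
  show ?thesis
    unfolding bez_det_def Let_def * by (simp add: algebra_simps power2_eq_square power3_eq_cube)
qed

lemma bez_det_add: "bez_det (k * b0+a0) (k * b1+a1) (k * b2+a2) (k * b3+a3) b0 b1 b2 b3 = bez_det a0 a1 a2 a3 b0 b1 b2 b3"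
proof -
  have *: "(k * u + u') * v - u'' * (k * v + v') = u' * v - u'' * v' + k * (u * v - u'' * v)" for u v u' v' u'' by (simp add: algebra_simps)
  show ?thesis
    unfolding bez_det_def Let_def * by (simp add: mult.commute)
qed

text \<open>Multiplicativity of the resultant: the first four arguments are the coefficients of (s +
  x) c, and the linear factor contributes the value b(-x). As an identity of forms it also covers
  vanishing leading coefficients.\<close>

lemma bez_det_lin:
  "bez_det (x*c0) (c0 + x * c1) (c1+x*c2) c2 b0 b1 b2 b3 = - (b0 - b1 * x + b2 * x^2 - b3 * x^3) *
    res32 b0 b1 b2 b3 c0 c1 c2"
    unfolding bez_det_def Let_def res32_def by (simp add: algebra_simps power2_eq_square power3_eq_cube)

text \<open>The same rule one degree lower: for the cubic (s + x) d against the quadratic c, the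
  linear factor contributes c(-x), and the resultant of two quadratics remains.\<close>

lemma res32_lin:
  "res32 (x*d0) (d0 + x * d1) (d1+x*d2) d2 c0 c1 c2 = (c0 - c1*x + c2*x^2) *
     ((c2*d0-c0*d2)^2 - (c1*d0-c0*d1)*(c2*d1-c1*d2))"
    unfolding res32_def by (simp add: algebra_simps power2_eq_square power3_eq_cube)

lemma res32_mult: "res32 (k * b0) (k * b1) (k * b2) (k * b3) c0 c1 c2 = k^2 * res32 b0 b1 b2 b3 c0 c1 c2"
    unfolding res32_def by (simp add: algebra_simps power2_eq_square power3_eq_cube)

lemma res32_add: "res32 (k * c0 + b0) (k * c1 + b1) (k * c2 + b2) b3 c0 c1 c2 = res32 b0 b1 b2 b3 c0 c1 c2"
    unfolding res32_def by (simp add: algebra_simps power2_eq_square power3_eq_cube)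

text \<open>The resultant of two quadratics, which in terms of the gammas is gamma2^2 - gamma1
  gamma3.\<close>

definition res22 :: "real \<Rightarrow> real \<Rightarrow> real \<Rightarrow> real \<Rightarrow> real \<Rightarrow> real \<Rightarrow> real" where
  "res22 c0 c1 c2 d0 d1 d2 = (c2*d0-c0*d2)^2 - (c1*d0-c0*d1)*(c2*d1-c1*d2)"

text \<open>The hypotheses are the reduction identities, coefficient by coefficient. Scaling a by
  \<beta> costs \<beta>^3 and the factor s + x returns one \<beta>; scaling b by \<beta>\<kappa>
  against the quadratic c costs (\<beta>\<kappa>)^2 and s + x returns one \<kappa>. Together this
  gives the factor \<beta>^4 \<kappa>.\<close>

lemma resultant_chain:
  assumes "\<beta> \<noteq> 0"
    and a: "\<beta> * a0 = \<alpha> * b0 + x * c0" "\<beta> * a1 = \<alpha> * b1 + (c0 + x * c1)"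
    "\<beta> * a2 = \<alpha> * b2 + (c1 + x * c2)" "\<beta> * a3 = \<alpha> * b3 + c2"
    and \<beta>: "\<beta> = b0 - b1 * x + b2 * x^2 - b3 * x^3"
    and \<kappa>: "\<kappa> = c0 - c1 * x + c2 * x^2"
    and b: "\<beta> * \<kappa> * b0 = \<beta>^2 * c0 + x * d0" "\<beta> * \<kappa> * b1 = \<beta>^2 * c1 + (d0 + x * d1)"
    "\<beta> * \<kappa> * b2 = \<beta>^2 * c2 + (d1 + x * d2)" "\<beta> * \<kappa> * b3 = d2"
  shows "\<beta>^2 * bez_det a0 a1 a2 a3 b0 b1 b2 b3 = - res32 b0 b1 b2 b3 c0 c1 c2"
    and "\<kappa> \<noteq> 0 \<Longrightarrow> \<beta>^4 * \<kappa> * (- bez_det a0 a1 a2 a3 b0 b1 b2 b3) = res22 c0 c1 c2 d0 d1 d2"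
proof -
  have "\<beta>^3 * bez_det a0 a1 a2 a3 b0 b1 b2 b3 = - \<beta> * res32 b0 b1 b2 b3 c0 c1 c2"
    unfolding bez_det_mult[symmetric] a bez_det_add bez_det_lin by (simp add: \<beta>)
  then have "\<beta> * (\<beta>^2 * bez_det a0 a1 a2 a3 b0 b1 b2 b3) = \<beta> * - res32 b0 b1 b2 b3 c0 c1 c2"
    by (simp add: power2_eq_square power3_eq_cube)
  then show 1: "\<beta>^2 * bez_det a0 a1 a2 a3 b0 b1 b2 b3 = - res32 b0 b1 b2 b3 c0 c1 c2"
    using \<open>\<beta> \<noteq> 0\<close> mult_left_cancel by blast
  have "(\<beta> * \<kappa>)^2 * res32 b0 b1 b2 b3 c0 c1 c2 = \<kappa> * res22 c0 c1 c2 d0 d1 d2"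
    unfolding res32_mult[symmetric] b res32_add res32_lin res22_def by (simp add: \<kappa>)
  moreover assume "\<kappa> \<noteq> 0"
  ultimately have "\<beta>^2 * \<kappa> * res32 b0 b1 b2 b3 c0 c1 c2 = res22 c0 c1 c2 d0 d1 d2"
    by (simp add: power_mult_distrib power2_eq_square)
  moreover have "\<beta>^4 * \<kappa> * (- bez_det a0 a1 a2 a3 b0 b1 b2 b3) =
      \<beta>^2 * \<kappa> * (- (\<beta>^2 * bez_det a0 a1 a2 a3 b0 b1 b2 b3))"
    by (simp add: power2_eq_square power4_eq_xxxx)
  ultimately show "\<beta>^4 * \<kappa> * (- bez_det a0 a1 a2 a3 b0 b1 b2 b3) = res22 c0 c1 c2 d0 d1 d2"
    using 1 by simp
qed

section \<open>The sign conditions\<close>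

definition lam :: "real \<Rightarrow> real \<Rightarrow> real \<Rightarrow> real \<Rightarrow> real \<Rightarrow> real \<Rightarrow> real" where
  "lam c0 c1 c2 d0 d1 d2 = d1 * (c1 * d0 - c0 * d1) - d0 * (c2 * d0 - c0 * d2)"

text \<open>\<alpha>, \<beta> and \<kappa> are independent arguments because exchanging c with d or
  reversing coefficients leaves them alone. In this way one predicate expresses all four
  conditions.\<close>

definition pencil_cond ::
  "real \<Rightarrow> real \<Rightarrow> real \<Rightarrow> real \<Rightarrow> real \<Rightarrow> real \<Rightarrow> real \<Rightarrow> real \<Rightarrow> real \<Rightarrow> bool" where
  "pencil_cond \<alpha> \<beta> \<kappa> c0 c1 c2 d0 d1 d2 \<longleftrightarrow> same_sign {\<alpha>, \<beta>, c0, c1, c2, d0, d1, d2, lam c0 c1 c2 d0 d1 d2} \<and>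
    \<kappa> \<ge> 0 \<and> c2 * d0 - c0 * d2 \<ge> 0"

section \<open>Symmetries of the resultant and strictness of the inequalities\<close>

lemma res22_rev: "res22 c2 c1 c0 d2 d1 d0 = res22 c0 c1 c2 d0 d1 d2"
  unfolding res22_def by (simp add: algebra_simps power2_eq_square)

lemma res22_swap: "res22 d0 d1 d2 c0 c1 c2 = res22 c0 c1 c2 d0 d1 d2"
  unfolding res22_def by (simp add: algebra_simps power2_eq_square)

text \<open>Multiply gamma2^2 - gamma1 gamma3 by d0 and eliminate gamma3 with the Pluecker relation
  d0 gamma3 = d1 gamma2 - d2 gamma1.\<close>

lemma lam_res22: "d0 * res22 c0 c1 c2 d0 d1 d2 =
    d2 * (c1*d0-c0*d1)^2 - (c2*d0-c0*d2) * lam c0 c1 c2 d0 d1 d2"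
  unfolding res22_def lam_def by (simp add: algebra_simps power2_eq_square)

lemma lam_minus: "lam (- c0) (- c1) (- c2) (- d0) (- d1) (- d2) = - lam c0 c1 c2 d0 d1 d2"
  unfolding lam_def by (simp add: algebra_simps)

lemma same_sign_subset: "same_sign S \<Longrightarrow> T \<subseteq> S \<Longrightarrow> same_sign T"
  unfolding same_sign_def by blast

text \<open>A positive resultant excludes the boundary cases. If d0 = 0, the signs of gamma2 and
  lambda1 force c0 d2 = c0 d1 = 0; if gamma1 were not positive, lambda1 would force gamma1 = gamma2
  = 0. In both cases the resultant vanishes. Then d2 cannot be zero by
  \<open>lam_res22\<close>.\<close>

lemma pencil_cond_strict:
  assumes "same_sign {c0, c1, c2, d0, d1, d2, lam c0 c1 c2 d0 d1 d2}"
    and "c2 * d0 - c0 * d2 \<ge> 0" "res22 c0 c1 c2 d0 d1 d2 > 0"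
  shows "d0 \<noteq> 0 \<and> d2 \<noteq> 0 \<and> c1 * d0 - c0 * d1 > 0"
proof -
  \<comment> \<open>It suffices to treat non-negative values: negating c and d negates
    \<open>lam\<close> but preserves the resultant and the gammas.\<close>
  have *: "d0 \<noteq> 0 \<and> d2 \<noteq> 0 \<and> c1 * d0 - c0 * d1 > 0"
    if nn: "c0 \<ge> 0" "c1 \<ge> 0" "c2 \<ge> 0" "d0 \<ge> 0" "d1 \<ge> 0" "d2 \<ge> 0"
      and lam: "lam c0 c1 c2 d0 d1 d2 \<ge> 0"
      and g2: "c2 * d0 - c0 * d2 \<ge> 0" and res: "res22 c0 c1 c2 d0 d1 d2 > 0"
    for c0 c1 c2 d0 d1 d2
  proof -
    define g1 g2 where "g1 = c1 * d0 - c0 * d1" and "g2 = c2 * d0 - c0 * d2"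
    have lam': "d1 * g1 \<ge> d0 * g2" "g2 \<ge> 0"
      using lam g2 unfolding lam_def g1_def g2_def by simp_all
    have d0: "d0 > 0"
    proof (rule ccontr)
      assume "\<not> d0 > 0"
      then have d0: "d0 = 0" using nn by simp
      have "c0 * d2 = 0"
      proof (rule antisym)
        show "c0 * d2 \<le> 0" using g2 d0 by simp
        show "0 \<le> c0 * d2" using nn by simp
      qed
      moreover have "c0 * d1 = 0"
      proof -
        have "d1 * (c0 * d1) \<le> 0" using lam' by (simp add: d0 g1_def)
        then show ?thesis using nn by (auto simp: mult_le_0_iff)
      qed
      ultimately show False
        using res unfolding res22_def d0 by auto
    qed
    have g1: "g1 > 0"
    proof (rule ccontr)
      assume "\<not> g1 > 0"
      then have "d1 * g1 \<le> 0" using nn by (simp add: mult_nonneg_nonpos)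
      then have "g2 = 0"
        using lam' d0 by (smt (verit) mult_pos_pos)
      with lam' \<open>d1 * g1 \<le> 0\<close> have "d1 * g1 = 0" by simp
      have "g1 = 0"
      proof (rule ccontr)
        assume "g1 \<noteq> 0"
        with \<open>d1 * g1 = 0\<close> have "d1 = 0" by simp
        then show False using \<open>\<not> g1 > 0\<close> \<open>g1 \<noteq> 0\<close> nn by (simp add: g1_def)
      qed
      with \<open>g2 = 0\<close> show False
        using res unfolding res22_def g1_def g2_def by simp
    qed
    have "d2 * g1^2 > 0"
    proof -
      have "d0 * res22 c0 c1 c2 d0 d1 d2 > 0" using d0 res by simp
      moreover have "g2 * lam c0 c1 c2 d0 d1 d2 \<ge> 0" using lam lam' by simp
      ultimately show ?thesis
        unfolding lam_res22 g1_def g2_def by linarith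
    qed
    then have "d2 \<noteq> 0" by auto
    with d0 g1 show ?thesis unfolding g1_def by simp
  qed
  show ?thesis
  proof (cases "\<forall>v\<in>{c0, c1, c2, d0, d1, d2, lam c0 c1 c2 d0 d1 d2}. v \<ge> 0")
    case True
    then show ?thesis using *[of c0 c1 c2 d0 d1 d2] assms by simp
  next
    case False
    then have "\<forall>v\<in>{c0, c1, c2, d0, d1, d2, lam c0 c1 c2 d0 d1 d2}. v \<le> 0"
      using assms(1) unfolding same_sign_def by blast
    moreover have "res22 (- c0) (- c1) (- c2) (- d0) (- d1) (- d2) = res22 c0 c1 c2 d0 d1 d2"
      unfolding res22_def by simp
    ultimately show ?thesis
      using *[of "-c0" "-c1" "-c2" "-d0" "-d1" "-d2"] assms by (simp add: lam_minus)
  qed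
qed

text \<open>With \<beta> as reference sign, the two alternatives of \<open>same_sign\<close> become
  inequalities between products. These are continuous in x and can be made strict one by one, which
  the descent needs.\<close>

lemma same_sign_iff:
  assumes "\<beta> \<in> S" "\<beta> \<noteq> 0"
  shows "same_sign S \<longleftrightarrow> (\<forall>v\<in>S. \<beta> * v \<ge> 0)"
proof (cases "\<beta> > 0")
  case True
  then have "\<beta> * v \<ge> 0 \<longleftrightarrow> v \<ge> 0" for v by (simp add: zero_le_mult_iff)
  then show ?thesis using assms True unfolding same_sign_def by auto
next
  case False
  then have "\<beta> < 0" using assms by simp
  then have "\<beta> * v \<ge> 0 \<longleftrightarrow> v \<le> 0" for v by (auto simp: zero_le_mult_iff)
  then show ?thesis using assms \<open>\<beta> < 0\<close> unfolding same_sign_def by auto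
qed

text \<open>The sign conditions for the numerator p and denominator q of an inner network, before
  rescaling to c and d. All coefficients are non-negative here, so no reference sign is
  needed.\<close>

definition ladder_cond :: "real \<Rightarrow> real \<Rightarrow> real \<Rightarrow> real \<Rightarrow> real \<Rightarrow> real \<Rightarrow> bool" where
  "ladder_cond p0 p1 p2 q0 q1 q2 \<longleftrightarrow> p0 \<ge> 0 \<and> p1 \<ge> 0 \<and> p2 \<ge> 0 \<and> q0 \<ge> 0 \<and> q1 \<ge> 0 \<and> q2 \<ge> 0 \<and>
    lam p0 p1 p2 q0 q1 q2 \<ge> 0 \<and> p2 * q0 - p0 * q2 \<ge> 0 \<and> res22 p0 p1 p2 q0 q1 q2 > 0"

lemma pencil_cond_scale:
  assumes "\<beta> \<noteq> 0" "\<beta> * \<alpha> \<ge> 0" "\<beta> * s > 0" "\<beta> * t > 0" "\<kappa> \<ge> 0"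
    and "ladder_cond p0 p1 p2 q0 q1 q2"
  shows "pencil_cond \<alpha> \<beta> \<kappa> (s * p0) (s * p1) (s * p2) (t * q0) (t * q1) (t * q2)"
proof -
  have lam: "lam (s * p0) (s * p1) (s * p2) (t * q0) (t * q1) (t * q2) = s * t^2 * lam p0 p1 p2 q0 q1 q2"
    unfolding lam_def by (simp add: algebra_simps power2_eq_square)
  have g2: "s * p2 * (t * q0) - s * p0 * (t * q2) = (\<beta> * s) * (\<beta> * t) * (p2 * q0 - p0 * q2) / \<beta>^2"
    using assms(1) by (simp add: field_simps power2_eq_square)
  have "same_sign {\<alpha>, \<beta>, s * p0, s * p1, s * p2, t * q0, t * q1, t * q2, s * t^2 * lam p0 p1 p2 q0 q1 q2}"
    using assms unfolding ladder_cond_def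
    by (subst same_sign_iff[of \<beta>]) (auto simp flip: mult.assoc)
  moreover have "s * p2 * (t * q0) - s * p0 * (t * q2) \<ge> 0"
    unfolding g2 using assms unfolding ladder_cond_def by simp
  ultimately show ?thesis
    using assms unfolding pencil_cond_def lam by simp
qed

text \<open>Explicit values: \<open>lam\<close> is L1^2 G3 q0^2, gamma2 is L1 R2 C1 q0 and the
  resultant is L1^3 C1 q0^2. So lambda1 and gamma2 record the signs of G3 and R2, and the reactive
  elements make the resultant positive.\<close>

lemma ladder_cond_ladder:
  assumes "R1 \<ge> 0" "R2 \<ge> 0" "G3 \<ge> 0" "C1 > 0" "L1 > 0"
  defines "q0 \<equiv> R2 * G3 + 1" and "q1 \<equiv> R2 * C1 + L1 * G3" and "q2 \<equiv> L1 * C1"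
  shows "ladder_cond (R1 * q0) (R1 * q1 + L1 * q0) (R1 * q2 + L1 * R2 * C1) q0 q1 q2"
proof -
  have "lam (R1 * q0) (R1 * q1 + L1 * q0) (R1 * q2 + L1 * R2 * C1) q0 q1 q2 = L1^2 * G3 * q0^2"
    unfolding lam_def q0_def q1_def q2_def by (simp add: algebra_simps power2_eq_square)
  moreover have "res22 (R1 * q0) (R1 * q1 + L1 * q0) (R1 * q2 + L1 * R2 * C1) q0 q1 q2 = L1^3 * C1 * q0^2"
    unfolding res22_def q0_def q1_def q2_def by (simp add: algebra_simps power2_eq_square power3_eq_cube)
  moreover have "(R1 * q2 + L1 * R2 * C1) * q0 - R1 * q0 * q2 = L1 * R2 * C1 * q0"
    by (simp add: algebra_simps)
  moreover have "q0 > 0" "q1 \<ge> 0" "q2 > 0"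
    using assms by (simp_all add: add_nonneg_pos)
  ultimately show ?thesis
    using assms(1-5) unfolding ladder_cond_def by simp
qed

text \<open>The element values come from expanding Z = \<kappa>c/d. R1 is Z(0); 1/L1 is the residue
  at s = 0 of the inverse of Z - R1; inverting what is left gives \<kappa> g1 (g1 + g2 s) / (d0
  (\<open>lam\<close> + d2 g1 s)), whose value at infinity is R2. By \<open>lam_res22\<close> the
  rest is \<kappa> r / (d2 (\<open>lam\<close> + d2 g1 s)), from which G3 and C1 are read off. The
  factor \<open>m\<close> is fixed by L1 C1 = m d2.\<close>

lemma ladder_realization:
  fixes c0 c1 c2 d0 d1 d2 \<kappa> :: real
  assumes "d0 \<noteq> 0" "d2 \<noteq> 0" "\<kappa> \<noteq> 0"
  defines "g1 \<equiv> c1 * d0 - c0 * d1" and "g2 \<equiv> c2 * d0 - c0 * d2"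
  defines "r \<equiv> res22 c0 c1 c2 d0 d1 d2"
  assumes "g1 \<noteq> 0" "r \<noteq> 0"
  defines "R1 \<equiv> \<kappa> * c0 / d0" and "R2 \<equiv> \<kappa> * g2 / (d0 * d2)"
    and "G3 \<equiv> d2 * lam c0 c1 c2 d0 d1 d2 / (\<kappa> * r)"
    and "C1 \<equiv> d2^2 * g1 / (\<kappa> * r)" and "L1 \<equiv> \<kappa> * g1 / d0^2"
  defines "m \<equiv> g1^2 * d2 / (d0^2 * r)"
  shows "m \<noteq> 0"
    "R2 * G3 + 1 = m * d0" "R2 * C1 + L1 * G3 = m * d1" "L1 * C1 = m * d2"
    "R1 * (m * d0) = m * (\<kappa> * c0)" "R1 * (m * d1) + L1 * (m * d0) = m * (\<kappa> * c1)"
    "R1 * (m * d2) + L1 * R2 * C1 = m * (\<kappa> * c2)"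
proof -
  have r: "d2 * g1^2 = d0 * r + g2 * lam c0 c1 c2 d0 d1 d2"
    using lam_res22[of d0 c0 c1 c2 d1 d2] unfolding g1_def g2_def r_def by simp
  show "m \<noteq> 0" using assms(1-8) \<open>g1 \<noteq> 0\<close> \<open>r \<noteq> 0\<close> by (simp add: m_def)
  note nz = \<open>d0 \<noteq> 0\<close> \<open>d2 \<noteq> 0\<close> \<open>\<kappa> \<noteq> 0\<close> \<open>g1 \<noteq> 0\<close> \<open>r \<noteq> 0\<close>
  have "R2 * G3 + 1 = (d0 * r + g2 * lam c0 c1 c2 d0 d1 d2) / (d0 * r)"
    using nz by (simp add: R2_def G3_def field_simps)
  also have "\<dots> = m * d0"
    using nz by (simp add: m_def field_simps power2_eq_square flip: r)
  finally show "R2 * G3 + 1 = m * d0" .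
  have "R2 * C1 + L1 * G3 = g1 * d2 * (g2 * d0 + lam c0 c1 c2 d0 d1 d2) / (d0^2 * r)"
    using nz by (simp add: R2_def G3_def C1_def L1_def field_simps power2_eq_square)
  also have "g2 * d0 + lam c0 c1 c2 d0 d1 d2 = d1 * g1"
    by (simp add: lam_def g1_def g2_def)
  finally show "R2 * C1 + L1 * G3 = m * d1"
    by (simp add: m_def power2_eq_square)
  show "L1 * C1 = m * d2"
    using nz by (simp add: m_def C1_def L1_def field_simps power2_eq_square)
  show "R1 * (m * d0) = m * (\<kappa> * c0)"
    using nz by (simp add: R1_def)
  have "R1 * (m * d1) + L1 * (m * d0) = m * (\<kappa> * (c0 * d1 + g1) / d0)"
    using nz by (simp add: R1_def L1_def field_simps power2_eq_square)
  also have "c0 * d1 + g1 = c1 * d0"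
    by (simp add: g1_def)
  finally show "R1 * (m * d1) + L1 * (m * d0) = m * (\<kappa> * c1)"
    using nz by simp
  have "R1 * (m * d2) + L1 * R2 * C1 = m * (\<kappa> * (c0 * d2 + g2) / d0)"
    using nz by (simp add: R1_def R2_def L1_def C1_def m_def field_simps power2_eq_square)
  also have "c0 * d2 + g2 = c2 * d0"
    by (simp add: g2_def)
  finally show "R1 * (m * d2) + L1 * R2 * C1 = m * (\<kappa> * c2)"
    using nz by simp
qed

section \<open>Reduction of a bicubic to a biquadratic\<close>

lemma coeff_const_coeffs: "coeff (const_coeffs p) n = [:coeff p n:]"
  by (simp add: const_coeffs_def coeff_map_poly)

lemma degree_const_coeffs: "degree (const_coeffs p) \<le> degree p"
  by (rule degree_le) (simp add: coeff_const_coeffs coeff_eq_0)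

lemma u_row_times:
  assumes "B \<in> carrier_mat 3 3" "j < 3"
  shows "(u_row * B) $$ (0, j) = B $$ (0, j) - [:0, 1:] * B $$ (1, j) + [:0, 0, 1:] * B $$ (2, j)"
proof -
  have "{0..<3} = {0, 1, 2::nat}" by auto
  then show ?thesis
    using assms by (simp add: u_row_def mat_of_rows_list_def scalar_prod_def)
qed

lemma u_row_bezoutian:
  fixes q p :: "real poly poly"
  assumes "degree q \<le> 3" "degree p \<le> 3"
  defines "D \<equiv> \<lambda>m n. coeff q m * coeff p n - coeff p m * coeff q n"
  shows "(u_row * bezoutian q p) $$ (0, 0) = D 1 0 - [:0, 1:] * D 2 0 + [:0, 0, 1:] * D 3 0"
    "(u_row * bezoutian q p) $$ (0, 1) = D 2 0 - [:0, 1:] * (D 3 0 + D 2 1) + [:0, 0, 1:] * D 3 1"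
    "(u_row * bezoutian q p) $$ (0, 2) = D 3 0 - [:0, 1:] * D 3 1 + [:0, 0, 1:] * D 3 2"
proof -
  have B: "bezoutian q p = mat_of_rows_list 3
     [[D 1 0, D 2 0, D 3 0],
      [D 2 0, D 3 0 + D 2 1, D 3 1],
      [D 3 0, D 3 1, D 3 2]]" (is "_ = ?B")
    unfolding D_def using assms(1,2) by (rule bezoutian_eq(2))
  have C: "?B \<in> carrier_mat 3 3"
    by (intro carrier_matI) (simp_all add: mat_of_rows_list_def)
  show "(u_row * bezoutian q p) $$ (0, 0) = D 1 0 - [:0, 1:] * D 2 0 + [:0, 0, 1:] * D 3 0"
    "(u_row * bezoutian q p) $$ (0, 1) = D 2 0 - [:0, 1:] * (D 3 0 + D 2 1) + [:0, 0, 1:] * D 3 1"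
    "(u_row * bezoutian q p) $$ (0, 2) = D 3 0 - [:0, 1:] * D 3 1 + [:0, 0, 1:] * D 3 2"
    unfolding B by (subst u_row_times[OF C]; simp add: mat_of_rows_list_def)+
qed

lemma poly_c_poly:
  assumes "degree a \<le> 3" "degree b \<le> 3"
  defines "D \<equiv> \<lambda>m n. coeff a m * coeff b n - coeff b m * coeff a n"
  shows "poly (c_poly a b 0) x = D 1 0 - x * D 2 0 + x^2 * D 3 0"
    "poly (c_poly a b 1) x = D 2 0 - x * (D 3 0 + D 2 1) + x^2 * D 3 1"
    "poly (c_poly a b 2) x = D 3 0 - x * D 3 1 + x^2 * D 3 2"
proof -
  have deg: "degree (const_coeffs a) \<le> 3" "degree (const_coeffs b) \<le> 3"
    using assms(1,2) degree_const_coeffs order_trans by blast+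
  show "poly (c_poly a b 0) x = D 1 0 - x * D 2 0 + x^2 * D 3 0"
    "poly (c_poly a b 1) x = D 2 0 - x * (D 3 0 + D 2 1) + x^2 * D 3 1"
    "poly (c_poly a b 2) x = D 3 0 - x * D 3 1 + x^2 * D 3 2"
    unfolding c_poly_def u_row_bezoutian[OF deg] coeff_const_coeffs D_def
    by (simp_all add: algebra_simps power2_eq_square)
qed

lemma poly_d_poly:
  assumes "degree a \<le> 3" "degree b \<le> 3"
  defines "c \<equiv> \<lambda>j x. poly (c_poly a b j) x"
  defines "D \<equiv> \<lambda>m n x. coeff b m * c n x - c m x * coeff b n"
  shows "poly (d_poly a b 0) x = poly (beta b) x * (D 1 0 x - x * D 2 0 x + x^2 * (coeff b 3 * c 0 x))"
    "poly (d_poly a b 1) x = poly (beta b) x * (D 2 0 x - x * (coeff b 3 * c 0 x + D 2 1 x) + x^2 * (coeff b 3 * c 1 x))"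
    "poly (d_poly a b 2) x = poly (beta b) x * (coeff b 3 * c 0 x - x * (coeff b 3 * c 1 x) + x^2 * (coeff b 3 * c 2 x))"
proof -
  let ?c = "[:c_poly a b 0, c_poly a b 1, c_poly a b 2:]"
  have deg: "degree (const_coeffs b) \<le> 3" "degree ?c \<le> 3"
    using assms(2) degree_const_coeffs order_trans by (blast, simp)
  have "coeff ?c 0 = c_poly a b 0" "coeff ?c 1 = c_poly a b 1" "coeff ?c 2 = c_poly a b 2" "coeff ?c 3 = 0"
    by (simp_all add: eval_nat_numeral)
  note coeffs = this
  show "poly (d_poly a b 0) x = poly (beta b) x * (D 1 0 x - x * D 2 0 x + x^2 * (coeff b 3 * c 0 x))"
    "poly (d_poly a b 1) x = poly (beta b) x * (D 2 0 x - x * (coeff b 3 * c 0 x + D 2 1 x) + x^2 * (coeff b 3 * c 1 x))"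
    "poly (d_poly a b 2) x = poly (beta b) x * (coeff b 3 * c 0 x - x * (coeff b 3 * c 1 x) + x^2 * (coeff b 3 * c 2 x))"
    unfolding d_poly_def u_row_bezoutian[OF deg] coeff_const_coeffs coeffs D_def c_def
    by (simp_all add: algebra_simps power2_eq_square)
qed

text \<open>\<alpha>, \<beta>, \<kappa> are forced to be values at s = -x, where the terms with the
  factor s + x vanish. The identities are free of denominators, so they make sense before \<beta>
  and \<kappa> are known to be nonzero.\<close>

definition reduction ::
  "real poly \<Rightarrow> real poly \<Rightarrow> real \<Rightarrow> real \<Rightarrow> real \<Rightarrow> real \<Rightarrow> real poly \<Rightarrow> real poly \<Rightarrow> bool" where
  "reduction a b x \<alpha> \<beta> \<kappa> c d \<longleftrightarrow>
    \<alpha> = poly a (- x) \<and> \<beta> = poly b (- x) \<and> \<kappa> = poly c (- x) \<and>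
    smult \<beta> a = smult \<alpha> b + [:x, 1:] * c \<and> smult (\<beta> * \<kappa>) b = smult (\<beta>^2) c + [:x, 1:] * d"

text \<open>The Bezoutian of a and b at z = -x, w = s is (\<alpha> b - \<beta> a)/(-x - s), which
  gives the first identity; that of b and c, multiplied by \<beta>, gives the second in the same
  way.\<close>

lemma reduction_poly:
  assumes "degree a \<le> 3" "degree b \<le> 3"
  shows "reduction a b x (poly (alpha a) x) (poly (beta b) x) (poly (kappa a b) x)
    [:poly (c_poly a b 0) x, poly (c_poly a b 1) x, poly (c_poly a b 2) x:]
    [:poly (d_poly a b 0) x, poly (d_poly a b 1) x, poly (d_poly a b 2) x:]"
proof -
  obtain a0 a1 a2 a3 where a: "a = [:a0, a1, a2, a3:]" using poly_deg3[OF assms(1)] by blast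
  obtain b0 b1 b2 b3 where b: "b = [:b0, b1, b2, b3:]" using poly_deg3[OF assms(2)] by blast
  define c0 c1 c2 where c: "c0 = poly (c_poly a b 0) x" "c1 = poly (c_poly a b 1) x" "c2 = poly (c_poly a b 2) x"
  define \<beta> where "\<beta> = poly (beta b) x"
  have ab: "coeff a 0 = a0" "coeff a 1 = a1" "coeff a 2 = a2" "coeff a 3 = a3"
    "coeff b 0 = b0" "coeff b 1 = b1" "coeff b 2 = b2" "coeff b 3 = b3"
    by (simp_all add: a b eval_nat_numeral)
  have \<alpha>: "poly (alpha a) x = a0 - a1 * x + a2 * x^2 - a3 * x^3"
    unfolding alpha_def ab by (simp add: algebra_simps power2_eq_square power3_eq_cube)
  have \<beta>: "\<beta> = b0 - b1 * x + b2 * x^2 - b3 * x^3"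
    unfolding beta_def ab \<beta>_def by (simp add: algebra_simps power2_eq_square power3_eq_cube)
  have \<kappa>: "poly (kappa a b) x = c0 - c1 * x + c2 * x^2"
    unfolding kappa_def c by (simp add: algebra_simps power2_eq_square)
  note c' = poly_c_poly[OF assms, of x, folded c, unfolded ab]
  note d' = poly_d_poly[OF assms, of x, folded c \<beta>_def, unfolded ab]
  have 1: "smult \<beta> a = smult (poly (alpha a) x) b + [:x, 1:] * [:c0, c1, c2:]"
    unfolding \<alpha> unfolding \<beta> c' unfolding a b
    by (simp add: algebra_simps power2_eq_square power3_eq_cube)
  have 2: "smult (\<beta> * poly (kappa a b) x) b = smult (\<beta>^2) [:c0, c1, c2:] +
     [:x, 1:] * [:poly (d_poly a b 0) x, poly (d_poly a b 1) x, poly (d_poly a b 2) x:]"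
  proof -
    let ?e = "[:b1 * c0 - c1 * b0 - x * (b2 * c0 - c2 * b0) + x\<^sup>2 * (b3 * c0),
       b2 * c0 - c2 * b0 - x * (b3 * c0 + (b2 * c1 - c2 * b1)) + x\<^sup>2 * (b3 * c1),
       b3 * c0 - x * (b3 * c1) + x\<^sup>2 * (b3 * c2):]"
    have e: "smult (poly (kappa a b) x) b = smult \<beta> [:c0, c1, c2:] + [:x, 1:] * ?e"
      unfolding \<kappa> unfolding \<beta> b
      by (simp add: algebra_simps power2_eq_square power3_eq_cube)
    have d: "[:poly (d_poly a b 0) x, poly (d_poly a b 1) x, poly (d_poly a b 2) x:] = smult \<beta> ?e"
      unfolding d' by simp
    have "smult (\<beta> * poly (kappa a b) x) b = smult \<beta> (smult (poly (kappa a b) x) b)"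
      by simp
    then show ?thesis
      unfolding e d by (simp only: smult_add_right smult_smult power2_eq_square mult_smult_right)
  qed
  have "poly a (- x) = a0 - a1 * x + a2 * x^2 - a3 * x^3" "poly b (- x) = b0 - b1 * x + b2 * x^2 - b3 * x^3"
    "poly [:c0, c1, c2:] (- x) = c0 - c1 * x + c2 * x^2"
    by (simp_all add: a b algebra_simps power2_eq_square power3_eq_cube)
  then show ?thesis
    unfolding reduction_def \<beta>_def[symmetric] c[symmetric]
    by (intro conjI 1 2) (simp_all only: \<alpha> \<beta> \<kappa>)
qed

text \<open>On the diagonal the Bezoutian is the Wronskian a'b - ab', here taken at -x. The minus
  sign comes from the chain rule, since \<open>alpha\<close> and \<open>beta\<close> are a and b
  composed with u \<mapsto> -u.\<close>

lemma kappa_pderiv: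
  assumes "degree a \<le> 3" "degree b \<le> 3"
  shows "poly (pderiv (alpha a)) x * poly (beta b) x - poly (alpha a) x * poly (pderiv (beta b)) x = - poly (kappa a b) x"
  unfolding kappa_def alpha_def beta_def
  by (simp add: poly_c_poly[OF assms, unfolded One_nat_def] pderiv_pCons algebra_simps power2_eq_square)

lemma reduction_coeffs:
  assumes "reduction a b x \<alpha> \<beta> \<kappa> [:c0, c1, c2:] [:d0, d1, d2:]" "degree a \<le> 3" "degree b \<le> 3"
  shows "\<beta> * coeff a 0 = \<alpha> * coeff b 0 + x * c0" "\<beta> * coeff a 1 = \<alpha> * coeff b 1 + (c0 + x * c1)"
    "\<beta> * coeff a 2 = \<alpha> * coeff b 2 + (c1 + x * c2)" "\<beta> * coeff a 3 = \<alpha> * coeff b 3 + c2"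
    "\<beta> = coeff b 0 - coeff b 1 * x + coeff b 2 * x^2 - coeff b 3 * x^3"
    "\<kappa> = c0 - c1 * x + c2 * x^2"
    "\<beta> * \<kappa> * coeff b 0 = \<beta>^2 * c0 + x * d0" "\<beta> * \<kappa> * coeff b 1 = \<beta>^2 * c1 + (d0 + x * d1)"
    "\<beta> * \<kappa> * coeff b 2 = \<beta>^2 * c2 + (d1 + x * d2)" "\<beta> * \<kappa> * coeff b 3 = d2"
proof -
  obtain a0 a1 a2 a3 where a: "a = [:a0, a1, a2, a3:]" using poly_deg3[OF assms(2)] by blast
  obtain b0 b1 b2 b3 where b: "b = [:b0, b1, b2, b3:]" using poly_deg3[OF assms(3)] by blast
  have ab: "coeff a 0 = a0" "coeff a 1 = a1" "coeff a 2 = a2" "coeff a 3 = a3"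
    "coeff b 0 = b0" "coeff b 1 = b1" "coeff b 2 = b2" "coeff b 3 = b3"
    by (simp_all add: a b eval_nat_numeral)
  have 1: "smult \<beta> a = smult \<alpha> b + [:x, 1:] * [:c0, c1, c2:]"
    and 2: "smult (\<beta> * \<kappa>) b = smult (\<beta>^2) [:c0, c1, c2:] + [:x, 1:] * [:d0, d1, d2:]"
    and 3: "\<beta> = poly b (- x)" "\<kappa> = poly [:c0, c1, c2:] (- x)"
    using assms(1) unfolding reduction_def by blast+
  show "\<beta> * coeff a 0 = \<alpha> * coeff b 0 + x * c0" "\<beta> * coeff a 1 = \<alpha> * coeff b 1 + (c0 + x * c1)"
    "\<beta> * coeff a 2 = \<alpha> * coeff b 2 + (c1 + x * c2)" "\<beta> * coeff a 3 = \<alpha> * coeff b 3 + c2"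
    unfolding ab using 1 unfolding a b by (simp_all add: algebra_simps)
  show "\<beta> * \<kappa> * coeff b 0 = \<beta>^2 * c0 + x * d0" "\<beta> * \<kappa> * coeff b 1 = \<beta>^2 * c1 + (d0 + x * d1)"
    "\<beta> * \<kappa> * coeff b 2 = \<beta>^2 * c2 + (d1 + x * d2)" "\<beta> * \<kappa> * coeff b 3 = d2"
    unfolding ab using 2 unfolding b by (simp_all add: algebra_simps)
  show "\<beta> = coeff b 0 - coeff b 1 * x + coeff b 2 * x^2 - coeff b 3 * x^3"
    "\<kappa> = c0 - c1 * x + c2 * x^2"
    unfolding ab using 3 unfolding b by (simp_all add: algebra_simps power2_eq_square power3_eq_cube)
qed

lemma F0_eq:
  "F0 a b = - bez_det (coeff a 0) (coeff a 1) (coeff a 2) (coeff a 3)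
    (coeff b 0) (coeff b 1) (coeff b 2) (coeff b 3)"
  unfolding F0_def Let_def by (rule det_sylvester)

lemma reduction_resultant:
  assumes "reduction a b x \<alpha> \<beta> \<kappa> [:c0, c1, c2:] [:d0, d1, d2:]" "degree a \<le> 3" "degree b \<le> 3" "\<beta> \<noteq> 0"
  shows "\<beta>^2 * F0 a b = res32 (coeff b 0) (coeff b 1) (coeff b 2) (coeff b 3) c0 c1 c2"
    "\<kappa> \<noteq> 0 \<Longrightarrow> \<beta>^4 * \<kappa> * F0 a b = res22 c0 c1 c2 d0 d1 d2"
  using resultant_chain[OF assms(4) reduction_coeffs[OF assms(1-3)]] by (simp_all add: F0_eq)

text \<open>If \<beta> = 0, coprimality gives \<alpha> \<noteq> 0, and \<alpha> b + (s + x) c = 0 is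
  a sum of terms of one sign, so b = 0. If \<kappa> = 0, then \<beta>^2 c + (s + x) d = 0 forces c =
  0 likewise, and the resultant identity yields F0 = 0.\<close>

lemma reduction_nonzero:
  assumes red: "reduction a b x \<alpha> \<beta> \<kappa> [:c0, c1, c2:] [:d0, d1, d2:]" and deg: "degree a \<le> 3" "degree b \<le> 3"
    and "coprime a b" "b \<noteq> 0" "\<forall>i\<in>{0..3}. coeff b i \<ge> 0" "F0 a b \<noteq> 0"
    and sign: "same_sign {\<alpha>, \<beta>, c0, c1, c2, d0, d1, d2}" and "x \<ge> 0" "\<kappa> \<ge> 0"
  shows "\<beta> \<noteq> 0" "\<kappa> > 0"
proof -
  note rel = reduction_coeffs[OF red deg]
  note ss = same_sign_iff[THEN iffD1, OF _ _ sign]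
  have b: "coeff b 0 \<ge> 0" "coeff b 1 \<ge> 0" "coeff b 2 \<ge> 0" "coeff b 3 \<ge> 0"
    using assms(6) by auto
  show \<beta>: "\<beta> \<noteq> 0"
  proof
    assume \<beta>: "\<beta> = 0"
    have "\<alpha> \<noteq> 0"
    proof
      assume "\<alpha> = 0"
      then have "[:x, 1:] dvd a" "[:x, 1:] dvd b"
        using \<beta> red poly_eq_0_iff_dvd[of _ "- x"] unfolding reduction_def by auto
      then show False
        using \<open>coprime a b\<close> coprime_common_divisor[of a b "[:x, 1:]"] by (simp add: is_unit_pCons_iff)
    qed
    then have nn: "\<alpha> * c0 \<ge> 0" "\<alpha> * c1 \<ge> 0" "\<alpha> * c2 \<ge> 0"
      using ss[of \<alpha>] by simp_all
    have zero: "v = 0" if "v \<ge> 0" "0 = \<alpha> * v + w" "\<alpha> * w \<ge> 0" for v w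
    proof -
      have "\<alpha>^2 * v + \<alpha> * w = \<alpha> * (\<alpha> * v + w)" by (simp add: algebra_simps power2_eq_square)
      then have "\<alpha>^2 * v + \<alpha> * w = 0" using that by simp
      moreover have "\<alpha>^2 * v \<ge> 0" using that by simp
      ultimately have "\<alpha>^2 * v = 0" using that by linarith
      then show "v = 0" using \<open>\<alpha> \<noteq> 0\<close> by simp
    qed
    have "coeff b 0 = 0" "coeff b 1 = 0" "coeff b 2 = 0" "coeff b 3 = 0"
      by (rule zero[OF _ rel(1)[unfolded \<beta> mult_zero_left]]
          zero[OF _ rel(2)[unfolded \<beta> mult_zero_left]]
          zero[OF _ rel(3)[unfolded \<beta> mult_zero_left]]
          zero[OF _ rel(4)[unfolded \<beta> mult_zero_left]];
        use b nn \<open>x \<ge> 0\<close> in \<open>simp add: distrib_left mult.left_commute[of \<alpha> x]\<close>)+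
    then have "b = 0" by (subst poly_deg3[OF deg(2)]) simp
    then show False using \<open>b \<noteq> 0\<close> by simp
  qed
  then have nn: "\<beta> * c0 \<ge> 0" "\<beta> * c1 \<ge> 0" "\<beta> * c2 \<ge> 0" "\<beta> * d0 \<ge> 0" "\<beta> * d1 \<ge> 0" "\<beta> * d2 \<ge> 0"
    using ss[of \<beta>] by simp_all
  have "\<kappa> \<noteq> 0"
  proof
    assume \<kappa>: "\<kappa> = 0"
    have zero: "v = 0" if "\<beta> * v \<ge> 0" "0 = \<beta>^2 * v + w" "\<beta> * w \<ge> 0" for v w
    proof -
      have "\<beta>^2 * (\<beta> * v) + \<beta> * w = \<beta> * (\<beta>^2 * v + w)" by (simp add: algebra_simps)
      then have "\<beta>^2 * (\<beta> * v) + \<beta> * w = 0" using that by simp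
      moreover have "\<beta>^2 * (\<beta> * v) \<ge> 0" using that by simp
      ultimately have "\<beta>^2 * (\<beta> * v) = 0" using that by linarith
      then show "v = 0" using \<open>\<beta> \<noteq> 0\<close> by simp
    qed
    have "c0 = 0" "c1 = 0" "c2 = 0"
      by (rule zero[OF _ rel(7)[unfolded \<kappa> mult_zero_left mult_zero_right]]
          zero[OF _ rel(8)[unfolded \<kappa> mult_zero_left mult_zero_right]]
          zero[OF _ rel(9)[unfolded \<kappa> mult_zero_left mult_zero_right]];
        use nn \<open>x \<ge> 0\<close> in \<open>simp add: distrib_left mult.left_commute[of \<beta> x]\<close>)+
    then have "\<beta>^2 * F0 a b = 0"
      using reduction_resultant(1)[OF red deg \<beta>] by (simp add: res32_def)
    then show False using \<beta> \<open>F0 a b \<noteq> 0\<close> by simp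
  qed
  then show "\<kappa> > 0" using \<open>\<kappa> \<ge> 0\<close> by simp
qed

lemma reduction_nondegenerate:
  assumes red: "reduction a b x \<alpha> \<beta> \<kappa> [:c0, c1, c2:] [:d0, d1, d2:]" and deg: "degree a \<le> 3" "degree b \<le> 3"
    and "coprime a b" "b \<noteq> 0" "\<forall>i\<in>{0..3}. coeff b i \<ge> 0" "F0 a b > 0"
    and sign: "same_sign {\<alpha>, \<beta>, c0, c1, c2, d0, d1, d2}" and "x \<ge> 0" "\<kappa> \<ge> 0"
  shows "\<beta> \<noteq> 0" "\<kappa> > 0" "res22 c0 c1 c2 d0 d1 d2 > 0"
proof -
  show "\<beta> \<noteq> 0" "\<kappa> > 0"
    using reduction_nonzero[OF red deg assms(4-6) _ sign \<open>x \<ge> 0\<close> \<open>\<kappa> \<ge> 0\<close>] \<open>F0 a b > 0\<close> by simp_all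
  then have "\<beta>^4 * \<kappa> * F0 a b > 0"
    using \<open>F0 a b > 0\<close> by simp
  then show "res22 c0 c1 c2 d0 d1 d2 > 0"
    using reduction_resultant(2)[OF red deg] \<open>\<beta> \<noteq> 0\<close> \<open>\<kappa> > 0\<close> by simp
qed

section \<open>Impedances as fractions\<close>

text \<open>A zero denominator stands for infinite impedance. Inversion is then an exchange of
  numerator and denominator, and short and open circuits need no separate treatment.\<close>

definition imp_frac :: "real poly \<Rightarrow> real poly \<Rightarrow> impedance" where
  "imp_frac p q = (if q = 0 then None else Some (Fract p q))"

lemma imp_inverse_frac: "p \<noteq> 0 \<or> q \<noteq> 0 \<Longrightarrow> imp_inverse (imp_frac p q) = imp_frac q p"
  by (cases "p = 0"; cases "q = 0") (simp_all add: imp_frac_def Zero_fract_def eq_fract)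

lemma imp_add_frac: "imp_add (imp_frac p q) (imp_frac p' q') = imp_frac (p * q' + p' * q) (q * q')"
  by (auto simp: imp_frac_def)

lemma imp_poly_frac: "imp_poly p = imp_frac p 1"
  by (simp add: imp_poly_def imp_frac_def)

lemma impedance_leaf:
  "impedance (Resistor R) = imp_frac [:R:] 1"
  "impedance (Conductor G) = imp_frac 1 [:G:]"
  "impedance (Inductor L) = imp_frac [:0, L:] 1"
  "impedance (Capacitor C) = imp_frac 1 [:0, C:]"
  by (simp_all add: imp_poly_frac imp_inverse_frac)

lemma impedance_series:
  assumes "impedance M = imp_frac p q" "impedance N = imp_frac p' q'"
  shows "impedance (M \<oplus>\<^sub>s N) = imp_frac (p * q' + p' * q) (q * q')"
  using assms by (simp add: imp_add_frac)

text \<open>The side conditions exclude the meaningless pair 0/0, for which exchanging numerator and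
  denominator is not inversion.\<close>

lemma impedance_parallel:
  assumes "impedance M = imp_frac p q" "impedance N = imp_frac p' q'"
    and "p \<noteq> 0 \<or> q \<noteq> 0" "p' \<noteq> 0 \<or> q' \<noteq> 0" "p * p' \<noteq> 0 \<or> p * q' + p' * q \<noteq> 0"
  shows "impedance (M \<parallel>\<^sub>p N) = imp_frac (p * p') (p * q' + p' * q)"
proof -
  have "impedance (M \<parallel>\<^sub>p N) = imp_inverse (imp_frac (p * q' + p' * q) (p * p'))"
    using assms by (simp add: imp_inverse_frac imp_add_frac ac_simps)
  also have "\<dots> = imp_frac (p * p') (p * q' + p' * q)"
    using assms(5) by (intro imp_inverse_frac) blast
  finally show ?thesis .
qed

section \<open>Impedances of the concrete networks, as unreduced quotients\<close>

abbreviation (input) outer :: "real \<Rightarrow> real \<Rightarrow> real \<Rightarrow> network \<Rightarrow> network" where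
  "outer R4 R5 L2 N \<equiv> Resistor R4 \<oplus>\<^sub>s ((Resistor R5 \<oplus>\<^sub>s Inductor L2) \<parallel>\<^sub>p N)"

lemma impedance_outer:
  assumes N: "impedance N = imp_frac p q" and "p \<noteq> 0" "L2 \<noteq> 0"
  shows "impedance (outer R4 R5 L2 N) =
    imp_frac (smult R4 ([:R5, L2:] * q + p) + [:R5, L2:] * p) ([:R5, L2:] * q + p)"
proof -
  have "impedance (Resistor R5 \<oplus>\<^sub>s Inductor L2) = imp_frac [:R5, L2:] 1"
    using impedance_series[OF impedance_leaf(1,3), of R5 L2] by simp
  moreover have "[:R5, L2:] * p \<noteq> 0"
    unfolding mult_eq_0_iff using assms by simp
  ultimately have
    "impedance ((Resistor R5 \<oplus>\<^sub>s Inductor L2) \<parallel>\<^sub>p N) = imp_frac ([:R5, L2:] * p) ([:R5, L2:] * q + p)"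
    using impedance_parallel[OF _ N, of _ "[:R5, L2:]" 1] assms by (simp del: impedance.simps mult_pCons_left)
  moreover have "[:R4:] * ([:R5, L2:] * q + p) = smult R4 ([:R5, L2:] * q + p)"
    by simp
  ultimately show ?thesis
    by (simp only: impedance_series[OF impedance_leaf(1)] mult_1_left mult_1_right)
qed

abbreviation (input) inner10 :: "real \<Rightarrow> real \<Rightarrow> real \<Rightarrow> real \<Rightarrow> real \<Rightarrow> network" where
  "inner10 R1 R2 G3 C1 L1 \<equiv>
    Resistor R1 \<oplus>\<^sub>s (Inductor L1 \<parallel>\<^sub>p (Resistor R2 \<oplus>\<^sub>s (Conductor G3 \<parallel>\<^sub>p Capacitor C1)))"

abbreviation (input) inner11 :: "real \<Rightarrow> real \<Rightarrow> real \<Rightarrow> real \<Rightarrow> real \<Rightarrow> network" where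
  "inner11 R1 R2 G3 C1 L1 \<equiv>
    Resistor R1 \<oplus>\<^sub>s (Capacitor C1 \<parallel>\<^sub>p (Resistor R2 \<oplus>\<^sub>s (Conductor G3 \<parallel>\<^sub>p Inductor L1)))"

abbreviation (input) inner12 :: "real \<Rightarrow> real \<Rightarrow> real \<Rightarrow> real \<Rightarrow> real \<Rightarrow> network" where
  "inner12 G1 G2 R3 C1 L1 \<equiv>
    Conductor G1 \<parallel>\<^sub>p (Capacitor C1 \<oplus>\<^sub>s (Conductor G2 \<parallel>\<^sub>p (Resistor R3 \<oplus>\<^sub>s Inductor L1)))"

abbreviation (input) inner13 :: "real \<Rightarrow> real \<Rightarrow> real \<Rightarrow> real \<Rightarrow> real \<Rightarrow> network" where
  "inner13 G1 G2 R3 C1 L1 \<equiv>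
    Conductor G1 \<parallel>\<^sub>p (Inductor L1 \<oplus>\<^sub>s (Conductor G2 \<parallel>\<^sub>p (Resistor R3 \<oplus>\<^sub>s Capacitor C1)))"

lemma impedance_inner10:
  assumes "R2 \<ge> 0" "G3 \<ge> 0" "C1 > 0" "L1 > 0"
  shows "impedance (inner10 R1 R2 G3 C1 L1) = imp_frac
    [:R1 * (R2 * G3 + 1), R1 * (R2 * C1 + L1 * G3) + L1 * (R2 * G3 + 1), R1 * (L1 * C1) + L1 * R2 * C1:]
    [:R2 * G3 + 1, R2 * C1 + L1 * G3, L1 * C1:]"
proof -
  have "R2 * G3 + 1 > 0" using assms by (simp add: add_nonneg_pos)
  have "impedance (Conductor G3 \<parallel>\<^sub>p Capacitor C1) = imp_frac 1 [:G3, C1:]"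
    using impedance_parallel[OF impedance_leaf(2,4), of G3 C1] by (simp add: add.commute)
  from impedance_series[OF impedance_leaf(1) this]
  have "impedance (Resistor R2 \<oplus>\<^sub>s (Conductor G3 \<parallel>\<^sub>p Capacitor C1)) =
      imp_frac [:R2 * G3 + 1, R2 * C1:] [:G3, C1:]"
    by (simp add: one_pCons mult.commute)
  from impedance_parallel[OF impedance_leaf(3) this, of L1]
  have "impedance (Inductor L1 \<parallel>\<^sub>p (Resistor R2 \<oplus>\<^sub>s (Conductor G3 \<parallel>\<^sub>p Capacitor C1))) =
      imp_frac [:0, L1 * (R2 * G3 + 1), L1 * R2 * C1:] [:R2 * G3 + 1, R2 * C1 + L1 * G3, L1 * C1:]"
    using assms \<open>R2 * G3 + 1 > 0\<close> by (simp add: one_pCons algebra_simps)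
  from impedance_series[OF impedance_leaf(1) this, of R1] show ?thesis
    by (simp add: algebra_simps)
qed

lemma impedance_inner11:
  assumes "R2 \<ge> 0" "G3 \<ge> 0" "C1 > 0" "L1 > 0"
  shows "impedance (inner11 R1 R2 G3 C1 L1) = imp_frac
    [:R1 + R2, R1 * (R2 * C1 + L1 * G3) + L1 * (R2 * G3 + 1), R1 * (L1 * C1 * (R2 * G3 + 1)):]
    [:1, R2 * C1 + L1 * G3, L1 * C1 * (R2 * G3 + 1):]"
proof -
  have "R2 * G3 + 1 > 0" using assms by (simp add: add_nonneg_pos)
  have "impedance (Conductor G3 \<parallel>\<^sub>p Inductor L1) = imp_frac [:0, L1:] [:1, G3 * L1:]"
    using impedance_parallel[OF impedance_leaf(2,3), of G3 L1] assms by (simp add: one_pCons)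
  from impedance_series[OF impedance_leaf(1) this]
  have "impedance (Resistor R2 \<oplus>\<^sub>s (Conductor G3 \<parallel>\<^sub>p Inductor L1)) =
      imp_frac [:R2, L1 * (R2 * G3 + 1):] [:1, G3 * L1:]"
    by (simp add: algebra_simps)
  from impedance_parallel[OF impedance_leaf(4) this, of C1]
  have "impedance (Capacitor C1 \<parallel>\<^sub>p (Resistor R2 \<oplus>\<^sub>s (Conductor G3 \<parallel>\<^sub>p Inductor L1))) =
      imp_frac [:R2, L1 * (R2 * G3 + 1):] [:1, R2 * C1 + L1 * G3, L1 * C1 * (R2 * G3 + 1):]"
    using assms \<open>R2 * G3 + 1 > 0\<close> by (simp add: one_pCons algebra_simps)
  from impedance_series[OF impedance_leaf(1) this, of R1] show ?thesis
    by (simp add: algebra_simps)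
qed

text \<open>Dual to \<open>inner10\<close>: numerator and denominator are exchanged, resistances
  become conductances and conversely, and C1 and L1 trade places.\<close>

lemma impedance_inner12:
  assumes "G2 \<ge> 0" "R3 \<ge> 0" "C1 > 0" "L1 > 0"
  shows "impedance (inner12 G1 G2 R3 C1 L1) = imp_frac
    [:G2 * R3 + 1, G2 * L1 + C1 * R3, C1 * L1:]
    [:G1 * (G2 * R3 + 1), G1 * (G2 * L1 + C1 * R3) + C1 * (G2 * R3 + 1), G1 * (C1 * L1) + C1 * G2 * L1:]"
proof -
  have pos: "G2 * R3 + 1 > 0" using assms by (simp add: add_nonneg_pos)
  have "impedance (Resistor R3 \<oplus>\<^sub>s Inductor L1) = imp_frac [:R3, L1:] 1"
    using impedance_series[OF impedance_leaf(1,3), of R3 L1] by simp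
  from impedance_parallel[OF impedance_leaf(2) this]
  have "impedance (Conductor G2 \<parallel>\<^sub>p (Resistor R3 \<oplus>\<^sub>s Inductor L1)) =
      imp_frac [:R3, L1:] [:G2 * R3 + 1, G2 * L1:]"
    using assms by (simp add: one_pCons algebra_simps)
  from impedance_series[OF impedance_leaf(4) this]
  have "impedance (Capacitor C1 \<oplus>\<^sub>s (Conductor G2 \<parallel>\<^sub>p (Resistor R3 \<oplus>\<^sub>s Inductor L1))) =
      imp_frac [:G2 * R3 + 1, G2 * L1 + C1 * R3, C1 * L1:] [:0, C1 * (G2 * R3 + 1), C1 * G2 * L1:]"
    by (simp add: algebra_simps)
  from impedance_parallel[OF impedance_leaf(2) this, of G1] show ?thesis
    using assms pos by (simp add: one_pCons algebra_simps)
qed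

lemma impedance_inner13:
  assumes "G2 \<ge> 0" "R3 \<ge> 0" "C1 > 0" "L1 > 0"
  shows "impedance (inner13 G1 G2 R3 C1 L1) = imp_frac
    [:1, G2 * L1 + C1 * R3, C1 * L1 * (G2 * R3 + 1):]
    [:G1 + G2, G1 * (G2 * L1 + C1 * R3) + C1 * (G2 * R3 + 1), G1 * (C1 * L1 * (G2 * R3 + 1)):]"
proof -
  have pos: "G2 * R3 + 1 > 0" using assms by (simp add: add_nonneg_pos)
  have "impedance (Resistor R3 \<oplus>\<^sub>s Capacitor C1) = imp_frac [:1, C1 * R3:] [:0, C1:]"
    using impedance_series[OF impedance_leaf(1,4), of R3 C1] by (simp add: one_pCons algebra_simps)
  from impedance_parallel[OF impedance_leaf(2) this]
  have "impedance (Conductor G2 \<parallel>\<^sub>p (Resistor R3 \<oplus>\<^sub>s Capacitor C1)) =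
      imp_frac [:1, C1 * R3:] [:G2, C1 * (G2 * R3 + 1):]"
    using assms by (simp add: one_pCons algebra_simps)
  from impedance_series[OF impedance_leaf(3) this]
  have "impedance (Inductor L1 \<oplus>\<^sub>s (Conductor G2 \<parallel>\<^sub>p (Resistor R3 \<oplus>\<^sub>s Capacitor C1))) =
      imp_frac [:1, G2 * L1 + C1 * R3, C1 * L1 * (G2 * R3 + 1):] [:G2, C1 * (G2 * R3 + 1):]"
    by (simp add: algebra_simps)
  from impedance_parallel[OF impedance_leaf(2) this, of G1] show ?thesis
    using assms pos by (simp add: one_pCons algebra_simps)
qed

text \<open>Undoes the reduction: the branch R5 + L2 s is (\<kappa>/\<beta>^2)(s + x), so the two
  identities of \<open>reduction\<close> reassemble b as the denominator and then a as the
  numerator.\<close>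

lemma outer_realization:
  assumes red: "reduction a b x \<alpha> \<beta> \<kappa> c d" and "\<beta> \<noteq> 0" "\<kappa> \<noteq> 0" "b \<noteq> 0" "m \<noteq> 0" "c \<noteq> 0"
    and N: "impedance N = imp_frac (smult (m * \<kappa>) c) (smult m d)"
  shows "impedance (outer (\<alpha> / \<beta>) (\<kappa> * x / \<beta>^2) (\<kappa> / \<beta>^2) N) = Some (Fract a b)"
proof -
  \<comment> \<open>The common factor by which the computed numerator and denominator exceed a and
    b, namely m L2 \<beta> \<kappa>.\<close>
  define k where "k = m * \<kappa>^2 / \<beta>"
  define R5 where "R5 = \<kappa> * x / \<beta>^2"
  define L2 where "L2 = \<kappa> / \<beta>^2"
  have k: "k \<noteq> 0" "L2 \<noteq> 0" using assms by (simp_all add: k_def L2_def)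
  have L: "[:R5, L2:] = smult L2 [:x, 1:]"
    by (simp add: R5_def L2_def)
  have eqs: "smult \<beta> a = smult \<alpha> b + [:x, 1:] * c" "smult (\<beta> * \<kappa>) b = smult (\<beta>^2) c + [:x, 1:] * d"
    using red unfolding reduction_def by blast+
  have "[:R5, L2:] * smult m d + smult (m * \<kappa>) c = smult (m * L2) ([:x, 1:] * d + smult (\<beta>^2) c)"
    using \<open>\<beta> \<noteq> 0\<close> unfolding L by (simp add: smult_add_right L2_def ac_simps)
  also have "[:x, 1:] * d + smult (\<beta>^2) c = smult (\<beta> * \<kappa>) b"
    using eqs by (simp add: add.commute)
  also have "smult (m * L2) (smult (\<beta> * \<kappa>) b) = smult k b"
    using \<open>\<beta> \<noteq> 0\<close> by (simp add: L2_def k_def power2_eq_square)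
  finally have B: "[:R5, L2:] * smult m d + smult (m * \<kappa>) c = smult k b" .
  have "smult (\<alpha> / \<beta>) (smult k b) + [:R5, L2:] * smult (m * \<kappa>) c = smult (k / \<beta>) (smult \<alpha> b + [:x, 1:] * c)"
    using \<open>\<beta> \<noteq> 0\<close> unfolding L by (simp add: smult_add_right L2_def k_def power2_eq_square ac_simps)
  also have "smult \<alpha> b + [:x, 1:] * c = smult \<beta> a"
    using eqs by simp
  also have "smult (k / \<beta>) (smult \<beta> a) = smult k a"
    using \<open>\<beta> \<noteq> 0\<close> by simp
  finally have A: "smult (\<alpha> / \<beta>) (smult k b) + [:R5, L2:] * smult (m * \<kappa>) c = smult k a" .
  have "impedance (outer (\<alpha> / \<beta>) R5 L2 N) = imp_frac (smult k a) (smult k b)"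
    using impedance_outer[OF N, of L2 "\<alpha> / \<beta>" R5] assms k unfolding A B by simp
  also have "\<dots> = Some (Fract a b)"
    using k \<open>b \<noteq> 0\<close> by (simp add: imp_frac_def eq_fract)
  finally show ?thesis unfolding R5_def L2_def .
qed

section \<open>Minimal solutions of the sign conditions\<close>

text \<open>The polynomials are arbitrary apart from the derivative identity and positivity at x, so
  the lemma also serves after reversing or exchanging c and d.\<close>

lemma pencil_descent:
  fixes \<alpha> \<beta> \<kappa> c0 c1 c2 d0 d1 d2 :: "real poly"
  defines "cond_at \<equiv> \<lambda>x. pencil_cond (poly \<alpha> x) (poly \<beta> x) (poly \<kappa> x)
      (poly c0 x) (poly c1 x) (poly c2 x) (poly d0 x) (poly d1 x) (poly d2 x)"
    and "cond_rev_at \<equiv> \<lambda>x. pencil_cond (poly \<alpha> x) (poly \<beta> x) (poly \<kappa> x)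
      (poly c2 x) (poly c1 x) (poly c0 x) (poly d2 x) (poly d1 x) (poly d0 x)"
  assumes deriv: "poly (pderiv \<alpha>) x * poly \<beta> x - poly \<alpha> x * poly (pderiv \<beta>) x = - poly \<kappa> x"
    and x: "x > 0" "cond_at x" and \<beta>: "poly \<beta> x \<noteq> 0" and \<kappa>: "poly \<kappa> x > 0"
    and res: "res22 (poly c0 x) (poly c1 x) (poly c2 x) (poly d0 x) (poly d1 x) (poly d2 x) > 0"
    and nz: "poly c0 x \<noteq> 0"
      "lam (poly c0 x) (poly c1 x) (poly c2 x) (poly d0 x) (poly d1 x) (poly d2 x) \<noteq> 0"
  shows "\<exists>y. 0 \<le> y \<and> y < x \<and> (cond_at y \<or> cond_rev_at y)"
proof -
  define l where "l = (\<lambda>y. lam (poly c0 y) (poly c1 y) (poly c2 y) (poly d0 y) (poly d1 y) (poly d2 y))"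
  define l' where "l' = (\<lambda>y. lam (poly c2 y) (poly c1 y) (poly c0 y) (poly d2 y) (poly d1 y) (poly d0 y))"
  define g1 where "g1 = (\<lambda>y. poly c1 y * poly d0 y - poly c0 y * poly d1 y)"
  define g2 where "g2 = (\<lambda>y. poly c2 y * poly d0 y - poly c0 y * poly d2 y)"
  have ss: "same_sign {poly \<alpha> x, poly \<beta> x, poly c0 x, poly c1 x, poly c2 x, poly d0 x, poly d1 x, poly d2 x, l x}"
    and g2: "g2 x \<ge> 0"
    using x(2) unfolding cond_at_def pencil_cond_def l_def g2_def by simp_all
  have strict: "poly d0 x \<noteq> 0" "poly d2 x \<noteq> 0" "g1 x > 0"
    using pencil_cond_strict[OF same_sign_subset[OF ss] _ res] g2 unfolding l_def g1_def g2_def by auto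
  have sign: "poly \<beta> x * poly \<alpha> x \<ge> 0" "poly \<beta> x * poly c0 x > 0" "poly \<beta> x * poly c1 x \<ge> 0" "poly \<beta> x * poly c2 x \<ge> 0"
    "poly \<beta> x * poly d0 x > 0" "poly \<beta> x * poly d1 x \<ge> 0" "poly \<beta> x * poly d2 x > 0" "poly \<beta> x * l x > 0"
    using same_sign_iff[THEN iffD1, OF _ \<beta> ss] nz strict \<beta> unfolding l_def
    by (simp_all add: less_le)
  have mult_nonneg: "u * v \<ge> 0" if "poly \<beta> x * u \<ge> 0" "poly \<beta> x * v \<ge> 0" for u v
  proof -
    have "(poly \<beta> x * u) * (poly \<beta> x * v) \<ge> 0" using that by simp
    then have "(poly \<beta> x)^2 * (u * v) \<ge> 0" by (simp add: power2_eq_square algebra_simps)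
    then show ?thesis using \<beta> by (simp add: zero_le_mult_iff)
  qed
  \<comment> \<open>The remaining strict signs are inherited: c1 from gamma1 > 0, c2 from gamma2
    \<ge> 0 with c0 d2 \<noteq> 0, and d1 from \<open>l x\<close> having the strict sign of
    \<beta>.\<close>
  have c1: "poly \<beta> x * poly c1 x > 0"
  proof -
    have "poly c1 x \<noteq> 0"
    proof
      assume "poly c1 x = 0"
      then have "poly c0 x * poly d1 x < 0" using strict(3) by (simp add: g1_def)
      then show False using mult_nonneg[of "poly c0 x" "poly d1 x"] sign by simp
    qed
    then show ?thesis using sign \<beta> by (simp add: less_le)
  qed
  have c2: "poly \<beta> x * poly c2 x > 0"
  proof -
    have "poly c2 x \<noteq> 0"
    proof
      assume "poly c2 x = 0"
      then have "poly c0 x * poly d2 x \<le> 0" using g2 by (simp add: g2_def)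
      moreover have "poly c0 x * poly d2 x \<ge> 0" using mult_nonneg[of "poly c0 x" "poly d2 x"] sign by simp
      ultimately show False using nz(1) strict(2) by simp
    qed
    then show ?thesis using sign \<beta> by (simp add: less_le)
  qed
  have d1: "poly \<beta> x * poly d1 x > 0"
  proof -
    have "poly d1 x \<noteq> 0"
    proof
      assume "poly d1 x = 0"
      then have "l x = - (poly d0 x * g2 x)" by (simp add: l_def lam_def g2_def)
      then have "poly \<beta> x * l x = - ((poly \<beta> x * poly d0 x) * g2 x)" by simp
      moreover have "(poly \<beta> x * poly d0 x) * g2 x \<ge> 0" using sign g2 by simp
      ultimately show False using sign(8) by linarith
    qed
    then show ?thesis using sign \<beta> by (simp add: less_le)
  qed
  \<comment> \<open>When gamma2 vanishes, c0 l' = d1 c2 gamma1. So the lambda of the reversed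
    condition has the strict sign of \<beta> at x, and hence nearby, whichever sign gamma2 takes
    there.\<close>
  have l': "poly \<beta> x * l' x > 0" if g2_0: "g2 x = 0"
  proof -
    have "poly c0 x * l' x = poly d1 x * poly c2 x * g1 x + (poly c1 x * poly d1 x - poly c0 x * poly d2 x) * - g2 x"
      unfolding l'_def lam_def g1_def g2_def by (simp add: algebra_simps)
    then have "poly \<beta> x ^ 3 * (poly c0 x * l' x) = (poly \<beta> x * poly d1 x) * (poly \<beta> x * poly c2 x) * (poly \<beta> x * g1 x)"
      using g2_0 by (simp add: power3_eq_cube)
    then have "(poly \<beta> x * poly c0 x) * (poly \<beta> x * (poly \<beta> x * l' x)) =
        (poly \<beta> x * poly d1 x) * (poly \<beta> x * poly c2 x) * (poly \<beta> x * g1 x)"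
      by (simp add: power3_eq_cube algebra_simps)
    then have "(poly \<beta> x * poly c0 x) * (poly \<beta> x * l' x) =
        (poly \<beta> x * poly d1 x) * (poly \<beta> x * poly c2 x) * g1 x"
      using \<beta> by simp
    moreover have "\<dots> > 0" using d1 c2 strict by simp
    ultimately have "(poly \<beta> x * poly c0 x) * (poly \<beta> x * l' x) > 0"
      by (simp only:)
    then show ?thesis by (rule zero_less_mult_pos) (rule sign(2))
  qed
  have ev: "eventually (\<lambda>y. f y > 0) (at_left x)" if "isCont f x" "f x > 0" for f :: "real \<Rightarrow> real"
    using order_tendstoD(1)[of f "f x" "at x" 0] that
    by (auto simp: isCont_def eventually_at_split)
  have ev_\<alpha>: "eventually (\<lambda>y. poly \<beta> y * poly \<alpha> y \<ge> 0) (at_left x)"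
  proof (cases "poly \<alpha> x = 0")
    case False
    then have "poly \<beta> x * poly \<alpha> x > 0" using sign(1) \<beta> by (simp add: less_le)
    then have "eventually (\<lambda>y. poly \<beta> y * poly \<alpha> y > 0) (at_left x)"
      by (intro ev continuous_intros)
    then show ?thesis by (rule eventually_mono) simp
  next
    \<comment> \<open>Where \<alpha> vanishes, the product \<beta>\<alpha> has derivative -\<kappa>
      < 0, so it is positive just to the left of x.\<close>
    case True
    have "((\<lambda>y. poly (\<beta> * \<alpha>) y) has_real_derivative poly (pderiv (\<beta> * \<alpha>)) x) (at x)"
      by (rule poly_DERIV)
    moreover have "poly (pderiv (\<beta> * \<alpha>)) x < 0"
      using deriv True \<kappa> by (simp add: pderiv_mult mult.commute)
    ultimately obtain e where e: "e > 0" "\<forall>h>0. h < e \<longrightarrow> poly (\<beta> * \<alpha>) x < poly (\<beta> * \<alpha>) (x - h)"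
      using DERIV_neg_dec_left by blast
    have "poly \<beta> y * poly \<alpha> y \<ge> 0" if "x - e < y" "y < x" for y
      using e(2)[rule_format, of "x - y"] that True by simp
    then show ?thesis
      using e(1) unfolding eventually_at_left_field by (intro exI[of _ "x - e"]) auto
  qed
  have cont: "isCont l x" "isCont l' x" "isCont g2 x"
    unfolding l_def l'_def lam_def g2_def by (intro continuous_intros)+
  have "eventually (\<lambda>y. y > 0 \<and> y < x \<and> poly \<kappa> y > 0 \<and> poly \<beta> y * poly \<beta> y > 0 \<and> poly \<beta> y * poly \<alpha> y \<ge> 0 \<and>
      poly \<beta> y * poly c0 y > 0 \<and> poly \<beta> y * poly c1 y > 0 \<and> poly \<beta> y * poly c2 y > 0 \<and>
      poly \<beta> y * poly d0 y > 0 \<and> poly \<beta> y * poly d1 y > 0 \<and> poly \<beta> y * poly d2 y > 0 \<and>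
      poly \<beta> y * l y > 0 \<and> (g2 y \<ge> 0 \<or> poly \<beta> y * l' y > 0)) (at_left x)" (is "eventually ?P _")
  proof -
    have "eventually (\<lambda>y. y > 0 \<and> y < x) (at_left x)"
      using x(1) unfolding eventually_at_left_field by blast
    moreover have "eventually (\<lambda>y. poly \<beta> y * poly \<beta> y > 0) (at_left x)"
      using \<beta> by (intro ev continuous_intros) (simp add: zero_less_mult_iff linorder_neq_iff disj_commute)
    moreover have "eventually (\<lambda>y. g2 y \<ge> 0 \<or> poly \<beta> y * l' y > 0) (at_left x)"
    proof (cases "g2 x = 0")
      case True
      have "eventually (\<lambda>y. poly \<beta> y * l' y > 0) (at_left x)"
        by (intro ev continuous_intros cont l' True)
      then show ?thesis by (rule eventually_mono) simp
    next
      case False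
      then have "g2 x > 0" using g2 by simp
      from ev[OF cont(3) this] show ?thesis by (rule eventually_mono) simp
    qed
    moreover have "eventually (\<lambda>y. poly \<kappa> y > 0) (at_left x)" "eventually (\<lambda>y. poly \<beta> y * poly c0 y > 0) (at_left x)"
      "eventually (\<lambda>y. poly \<beta> y * poly c1 y > 0) (at_left x)" "eventually (\<lambda>y. poly \<beta> y * poly c2 y > 0) (at_left x)"
      "eventually (\<lambda>y. poly \<beta> y * poly d0 y > 0) (at_left x)" "eventually (\<lambda>y. poly \<beta> y * poly d1 y > 0) (at_left x)"
      "eventually (\<lambda>y. poly \<beta> y * poly d2 y > 0) (at_left x)" "eventually (\<lambda>y. poly \<beta> y * l y > 0) (at_left x)"
      by (intro ev continuous_intros cont sign c1 c2 d1 \<kappa>)+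
    ultimately show ?thesis using ev_\<alpha> by eventually_elim blast
  qed
  then obtain y where y: "?P y"
    using eventually_happens'[OF trivial_limit_at_left_real] by blast
  have "cond_at y \<or> cond_rev_at y"
  proof (cases "g2 y \<ge> 0")
    case True
    then have "cond_at y"
      unfolding cond_at_def pencil_cond_def using y
      by (subst same_sign_iff[of "poly \<beta> y"]) (auto simp: g2_def l_def)
    then show ?thesis ..
  next
    case False
    then have "cond_rev_at y"
      unfolding cond_rev_at_def pencil_cond_def using y
      by (subst same_sign_iff[of "poly \<beta> y"]) (auto simp: g2_def l'_def)
    then show ?thesis ..
  qed
  with y show ?thesis by (intro exI[of _ y]) simp
qed

text \<open>Only weak inequalities between polynomials occur, joined by finitely many conjunctions
  and disjunctions once \<open>same_sign\<close> is spelled out for the explicit set.\<close>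

lemma closed_pencil_cond:
  fixes \<alpha> \<beta> \<kappa> c0 c1 c2 d0 d1 d2 :: "real poly"
  shows "closed {x. pencil_cond (poly \<alpha> x) (poly \<beta> x) (poly \<kappa> x)
      (poly c0 x) (poly c1 x) (poly c2 x) (poly d0 x) (poly d1 x) (poly d2 x)}"
  unfolding pencil_cond_def same_sign_def lam_def
  by (simp only: ball_simps simp_thms) (intro closed_Collect_conj closed_Collect_disj closed_Collect_le continuous_intros)

text \<open>Closedness makes the infimum of the union of both solution sets a solution. The union is
  essential, because the descent may end in either set.\<close>

lemma pencil_minimal:
  fixes \<alpha> \<beta> \<kappa> c0 c1 c2 d0 d1 d2 :: "real poly"
  defines "cond_at \<equiv> \<lambda>x. pencil_cond (poly \<alpha> x) (poly \<beta> x) (poly \<kappa> x)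
      (poly c0 x) (poly c1 x) (poly c2 x) (poly d0 x) (poly d1 x) (poly d2 x)"
    and "cond_rev_at \<equiv> \<lambda>x. pencil_cond (poly \<alpha> x) (poly \<beta> x) (poly \<kappa> x)
      (poly c2 x) (poly c1 x) (poly c0 x) (poly d2 x) (poly d1 x) (poly d0 x)"
  assumes deriv: "\<And>x. poly (pderiv \<alpha>) x * poly \<beta> x - poly \<alpha> x * poly (pderiv \<beta>) x = - poly \<kappa> x"
    and nondegenerate: "\<And>x. x \<ge> 0 \<Longrightarrow> cond_at x \<or> cond_rev_at x \<Longrightarrow> poly \<beta> x \<noteq> 0 \<and> poly \<kappa> x > 0 \<and>
      res22 (poly c0 x) (poly c1 x) (poly c2 x) (poly d0 x) (poly d1 x) (poly d2 x) > 0"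
    and ex: "x0 \<ge> 0" "cond_at x0 \<or> cond_rev_at x0"
  shows "\<exists>x\<ge>0.
    cond_at x \<and> (x = 0 \<or> lam (poly c0 x) (poly c1 x) (poly c2 x) (poly d0 x) (poly d1 x) (poly d2 x) = 0 \<or> poly c0 x = 0) \<or>
    cond_rev_at x \<and> (x = 0 \<or> lam (poly c2 x) (poly c1 x) (poly c0 x) (poly d2 x) (poly d1 x) (poly d0 x) = 0 \<or> poly c2 x = 0)"
proof -
  define S where "S = {x. x \<ge> 0 \<and> (cond_at x \<or> cond_rev_at x)}"
  have "closed S"
    unfolding S_def cond_at_def cond_rev_at_def
    by (intro closed_Collect_conj closed_Collect_disj closed_pencil_cond closed_Collect_le continuous_intros)
  moreover have "S \<noteq> {}" "bdd_below S"
    using ex unfolding S_def by (auto intro: bdd_belowI[of _ 0])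
  ultimately have "Inf S \<in> S"
    using closed_contains_Inf by blast
  define x where "x = Inf S"
  have x: "x \<ge> 0" "cond_at x \<or> cond_rev_at x"
    using \<open>Inf S \<in> S\<close> unfolding S_def x_def by auto
  have min: "\<not> (\<exists>y. 0 \<le> y \<and> y < x \<and> (cond_at y \<or> cond_rev_at y))"
    using cInf_lower[OF _ \<open>bdd_below S\<close>] unfolding x_def S_def by fastforce
  note nd = nondegenerate[OF x]
  have res: "res22 (poly c2 x) (poly c1 x) (poly c0 x) (poly d2 x) (poly d1 x) (poly d0 x) > 0"
    using nd by (subst res22_rev) simp
  have "cond_at x \<and> (x = 0 \<or> lam (poly c0 x) (poly c1 x) (poly c2 x) (poly d0 x) (poly d1 x) (poly d2 x) = 0 \<or> poly c0 x = 0) \<or>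
    cond_rev_at x \<and> (x = 0 \<or> lam (poly c2 x) (poly c1 x) (poly c0 x) (poly d2 x) (poly d1 x) (poly d0 x) = 0 \<or> poly c2 x = 0)"
  proof (rule ccontr)
    assume "\<not> ?thesis"
    then consider
        "cond_at x" "x > 0" "lam (poly c0 x) (poly c1 x) (poly c2 x) (poly d0 x) (poly d1 x) (poly d2 x) \<noteq> 0" "poly c0 x \<noteq> 0"
      | "cond_rev_at x" "x > 0" "lam (poly c2 x) (poly c1 x) (poly c0 x) (poly d2 x) (poly d1 x) (poly d0 x) \<noteq> 0" "poly c2 x \<noteq> 0"
      using x by auto
    then have "\<exists>y. 0 \<le> y \<and> y < x \<and> (cond_at y \<or> cond_rev_at y)"
    proof cases
      case 1
      then show ?thesis
        using pencil_descent[OF deriv, of x] nd unfolding cond_at_def cond_rev_at_def by blast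
    next
      case 2
      then show ?thesis
        \<comment> \<open>The descent is applied to the reversed coefficients, whose own reversal is
          the original condition.\<close>
        using pencil_descent[OF deriv, of x c2 c1 c0 d2 d1 d0] nd res unfolding cond_at_def cond_rev_at_def by blast
    qed
    with min show False by blast
  qed
  with x(1) show ?thesis by blast
qed

section \<open>From networks to the conditions\<close>

text \<open>Reversal sends gamma1 to -gamma3 and gamma2 to -gamma2, while exchanging c and d negates
  all three gammas; the four lambdas are the images of one form under these symmetries.\<close>

lemma poly_lambda_eq_lam:
  "poly (lambda1 a b) x = lam (poly (c_poly a b 0) x) (poly (c_poly a b 1) x) (poly (c_poly a b 2) x)
      (poly (d_poly a b 0) x) (poly (d_poly a b 1) x) (poly (d_poly a b 2) x)"
  "poly (lambda3 a b) x = lam (poly (c_poly a b 2) x) (poly (c_poly a b 1) x) (poly (c_poly a b 0) x)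
      (poly (d_poly a b 2) x) (poly (d_poly a b 1) x) (poly (d_poly a b 0) x)"
  "poly (lambda4 a b) x = lam (poly (d_poly a b 0) x) (poly (d_poly a b 1) x) (poly (d_poly a b 2) x)
      (poly (c_poly a b 0) x) (poly (c_poly a b 1) x) (poly (c_poly a b 2) x)"
  "poly (lambda2 a b) x = lam (poly (d_poly a b 2) x) (poly (d_poly a b 1) x) (poly (d_poly a b 0) x)
      (poly (c_poly a b 2) x) (poly (c_poly a b 1) x) (poly (c_poly a b 0) x)"
  unfolding lambda1_def lambda2_def lambda3_def lambda4_def gamma1_def gamma2_def gamma3_def lam_def
  by (simp_all add: algebra_simps)

text \<open>Reversal and exchange each negate gamma2, and together they preserve it. This explains
  the sign of gamma2 in (C2) and (C3) against (C1) and (C4).\<close>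

lemma cond_iff_pencil_cond:
  "cond_C1 a b x \<longleftrightarrow> (\<forall>i\<in>{0..3}. coeff a i \<ge> 0 \<and> coeff b i \<ge> 0) \<and> F0 a b > 0 \<and>
    pencil_cond (poly (alpha a) x) (poly (beta b) x) (poly (kappa a b) x)
      (poly (c_poly a b 0) x) (poly (c_poly a b 1) x) (poly (c_poly a b 2) x)
      (poly (d_poly a b 0) x) (poly (d_poly a b 1) x) (poly (d_poly a b 2) x)"
  "cond_C2 a b x \<longleftrightarrow> (\<forall>i\<in>{0..3}. coeff a i \<ge> 0 \<and> coeff b i \<ge> 0) \<and> F0 a b > 0 \<and>
    pencil_cond (poly (alpha a) x) (poly (beta b) x) (poly (kappa a b) x)
      (poly (c_poly a b 2) x) (poly (c_poly a b 1) x) (poly (c_poly a b 0) x)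
      (poly (d_poly a b 2) x) (poly (d_poly a b 1) x) (poly (d_poly a b 0) x)"
  "cond_C3 a b x \<longleftrightarrow> (\<forall>i\<in>{0..3}. coeff a i \<ge> 0 \<and> coeff b i \<ge> 0) \<and> F0 a b > 0 \<and>
    pencil_cond (poly (alpha a) x) (poly (beta b) x) (poly (kappa a b) x)
      (poly (d_poly a b 0) x) (poly (d_poly a b 1) x) (poly (d_poly a b 2) x)
      (poly (c_poly a b 0) x) (poly (c_poly a b 1) x) (poly (c_poly a b 2) x)"
  "cond_C4 a b x \<longleftrightarrow> (\<forall>i\<in>{0..3}. coeff a i \<ge> 0 \<and> coeff b i \<ge> 0) \<and> F0 a b > 0 \<and>
    pencil_cond (poly (alpha a) x) (poly (beta b) x) (poly (kappa a b) x)
      (poly (d_poly a b 2) x) (poly (d_poly a b 1) x) (poly (d_poly a b 0) x)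
      (poly (c_poly a b 2) x) (poly (c_poly a b 1) x) (poly (c_poly a b 0) x)"
  unfolding cond_C1_def cond_C2_def cond_C3_def cond_C4_def cond_common_def poly_lambda_eq_lam pencil_cond_def gamma2_def
  by (auto simp: insert_commute mult.commute)

text \<open>Coprimality and the degree bound leave only a constant factor k between a/b and the
  computed quotient A/B. With w = P(-x), this gives k\<beta> = w, k^2 c = w L2 P and k^4 d = w^3
  L2^2 Q: c and d are multiples of P and Q by odd powers of w, so the factors share the sign of
  \<beta>.\<close>

lemma outer_reduction:
  fixes a b :: "real poly"
  assumes deg: "degree a \<le> 3" "degree b \<le> 3" and "coprime a b" and a3: "\<not> (coeff a 3 = 0 \<and> coeff b 3 = 0)"
    and b_pos: "\<exists>i\<in>{0..3}. coeff b i > 0"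
    and N: "impedance N = imp_frac [:p0, p1, p2:] [:q0, q1, q2:]"
    and p: "p0 \<ge> 0" "p1 \<ge> 0" "p2 \<ge> 0" and q: "q0 \<ge> 0" "q1 \<ge> 0" "q2 \<ge> 0"
    and pq: "res22 p0 p1 p2 q0 q1 q2 > 0"
    and R: "R4 \<ge> 0" "R5 \<ge> 0" "L2 > 0" and imp: "impedance (outer R4 R5 L2 N) = Some (Fract a b)"
  shows "ladder_cond p0 p1 p2 q0 q1 q2 \<Longrightarrow> cond_C1 a b (R5 / L2)"
    "ladder_cond p2 p1 p0 q2 q1 q0 \<Longrightarrow> cond_C2 a b (R5 / L2)"
    "ladder_cond q0 q1 q2 p0 p1 p2 \<Longrightarrow> cond_C3 a b (R5 / L2)"
    "ladder_cond q2 q1 q0 p2 p1 p0 \<Longrightarrow> cond_C4 a b (R5 / L2)"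
proof -
  define x where "x = R5 / L2"
  define P where "P = [:p0, p1, p2:]"
  define Q where "Q = [:q0, q1, q2:]"
  define B where "B = smult L2 ([:x, 1:] * Q) + P"
  define A where "A = smult R4 B + smult L2 ([:x, 1:] * P)"
  have x: "x \<ge> 0" using R by (simp add: x_def)
  have "P \<noteq> 0"
  proof
    assume "P = 0"
    then show False using pq by (simp add: P_def res22_def)
  qed
  have "[:R5, L2:] = smult L2 [:x, 1:]" using R by (simp add: x_def)
  then have "imp_frac A B = Some (Fract a b)"
    using imp impedance_outer[OF N[folded P_def Q_def] \<open>P \<noteq> 0\<close>, of L2 R4 R5] R unfolding A_def B_def
    by (simp only: mult_smult_left)
  moreover have "b \<noteq> 0" using b_pos by auto
  ultimately have AB: "A * b = a * B" "B \<noteq> 0"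
    unfolding imp_frac_def by (auto simp: eq_fract split: if_splits)
  obtain K where K: "B = b * K"
  proof -
    have "b dvd a * B" using AB(1) by (metis dvd_triv_right)
    then have "b dvd B" using \<open>coprime a b\<close> coprime_dvd_mult_right_iff[of b a B] by (simp add: coprime_commute)
    then show thesis using that by (auto elim: dvdE)
  qed
  have KA: "A = a * K"
    using AB(1) \<open>b \<noteq> 0\<close> unfolding K by (simp add: mult.assoc mult.left_commute)
  have A_coeffs: "A = [:R4 * (L2 * x * q0 + p0) + L2 * x * p0, R4 * (L2 * (x * q1 + q0) + p1) + L2 * (x * p1 + p0),
      R4 * (L2 * (x * q2 + q1) + p2) + L2 * (x * p2 + p1), R4 * (L2 * q2) + L2 * p2:]"
    unfolding A_def B_def P_def Q_def by (simp add: algebra_simps)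
  have B_coeffs: "B = [:L2 * x * q0 + p0, L2 * (x * q1 + q0) + p1, L2 * (x * q2 + q1) + p2, L2 * q2:]"
    unfolding B_def P_def Q_def by (simp add: algebra_simps)
  have deg_AB: "degree A \<le> 3" "degree B \<le> 3"
    unfolding A_coeffs B_coeffs by simp_all
  \<comment> \<open>A or B would otherwise have degree above 3, because a or b has exact degree
    3.\<close>
  have "degree K = 0"
  proof -
    have K0: "K \<noteq> 0" using AB(2) K by auto
    have "coeff a 3 \<noteq> 0 \<or> coeff b 3 \<noteq> 0" using a3 by blast
    then show ?thesis
    proof
      assume "coeff a 3 \<noteq> 0"
      then have "degree a \<ge> 3" "a \<noteq> 0" by (auto intro: le_degree)
      then show ?thesis using deg_AB(1) K0 unfolding KA by (simp add: degree_mult_eq)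
    next
      assume "coeff b 3 \<noteq> 0"
      then have "degree b \<ge> 3" by (auto intro: le_degree)
      then show ?thesis using deg_AB(2) K0 \<open>b \<noteq> 0\<close> unfolding K by (simp add: degree_mult_eq)
    qed
  qed
  then obtain k where "K = [:k:]" by (rule degree_eq_zeroE)
  then have kA: "smult k a = A" and kB: "smult k b = B"
    using K KA by simp_all
  have nonneg_AB: "coeff A i \<ge> 0 \<and> coeff B i \<ge> 0" if "i \<in> {0..3}" for i
  proof -
    have "i = 0 \<or> i = 1 \<or> i = 2 \<or> i = 3" using that by auto
    then show ?thesis
      unfolding A_coeffs B_coeffs using p q R x by (auto simp: eval_nat_numeral)
  qed
  have "k > 0"
  proof -
    obtain i where "i \<in> {0..3}" "coeff b i > 0" using b_pos by blast
    then have "k * coeff b i \<ge> 0" using nonneg_AB[of i] unfolding kB[symmetric] by simp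
    then have "k \<ge> 0" using \<open>coeff b i > 0\<close> by (simp add: zero_le_mult_iff)
    moreover have "k \<noteq> 0" using AB(2) kB by auto
    ultimately show ?thesis by simp
  qed
  have nonneg: "\<forall>i\<in>{0..3}. coeff a i \<ge> 0 \<and> coeff b i \<ge> 0"
  proof
    fix i :: nat assume "i \<in> {0..3}"
    then show "coeff a i \<ge> 0 \<and> coeff b i \<ge> 0"
      using nonneg_AB[of i] \<open>k > 0\<close> unfolding kA[symmetric] kB[symmetric] by (simp add: zero_le_mult_iff)
  qed
  define \<alpha> \<beta> \<kappa> where "\<alpha> = poly (alpha a) x" and "\<beta> = poly (beta b) x" and "\<kappa> = poly (kappa a b) x"
  define c where "c = [:poly (c_poly a b 0) x, poly (c_poly a b 1) x, poly (c_poly a b 2) x:]"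
  define d where "d = [:poly (d_poly a b 0) x, poly (d_poly a b 1) x, poly (d_poly a b 2) x:]"
  have red: "reduction a b x \<alpha> \<beta> \<kappa> c d"
    unfolding \<alpha>_def \<beta>_def \<kappa>_def c_def d_def by (rule reduction_poly[OF deg])
  then have \<alpha>: "\<alpha> = poly a (- x)" and \<beta>: "\<beta> = poly b (- x)" and \<kappa>: "\<kappa> = poly c (- x)"
    and c: "smult \<beta> a = smult \<alpha> b + [:x, 1:] * c" and d: "smult (\<beta> * \<kappa>) b = smult (\<beta>^2) c + [:x, 1:] * d"
    unfolding reduction_def by blast+
  \<comment> \<open>At s = -x the branch R5 + L2 s is a short circuit, so B(-x) = P(-x) and A(-x) =
    R4 P(-x). This is why x = R5/L2 and \<alpha>/\<beta> = R4.\<close>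
  define w where "w = poly P (- x)"
  have w: "k * \<beta> = w" "k * \<alpha> = R4 * w"
  proof -
    have "k * \<beta> = poly (smult k b) (- x)" "k * \<alpha> = poly (smult k a) (- x)"
      by (simp_all add: \<alpha> \<beta>)
    then show "k * \<beta> = w" "k * \<alpha> = R4 * w"
      unfolding kA kB by (simp_all add: A_def B_def w_def)
  qed
  have X: "[:x, 1:] \<noteq> 0" by simp
  have "\<beta> \<noteq> 0"
  proof
    assume "\<beta> = 0"
    then have "\<alpha> = 0" using w \<open>k > 0\<close> by auto
    have "[:x, 1:] dvd a" "[:x, 1:] dvd b"
      using \<open>\<alpha> = 0\<close> \<open>\<beta> = 0\<close> poly_eq_0_iff_dvd[of _ "- x"] unfolding \<alpha> \<beta> by auto
    then show False
      using \<open>coprime a b\<close> coprime_common_divisor[of a b "[:x, 1:]"] by (simp add: is_unit_pCons_iff)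
  qed
  then have "w \<noteq> 0" using w \<open>k > 0\<close> by auto
  have c_P: "smult (k^2) c = smult (w * L2) P"
  proof -
    have "[:x, 1:] * smult (k^2) c = smult (k * \<beta>) (smult k a) - smult (k * \<alpha>) (smult k b)"
      using arg_cong[OF c, of "smult (k^2)"]
      by (simp add: smult_add_right power2_eq_square ac_simps del: mult_pCons_left)
    also have "\<dots> = [:x, 1:] * smult (w * L2) P"
      unfolding w kA kB unfolding A_def
      by (simp add: smult_add_right ac_simps del: mult_pCons_left)
    finally show ?thesis by (rule mult_left_cancel[OF X, THEN iffD1])
  qed
  have \<kappa>': "k^2 * \<kappa> = w^2 * L2"
  proof -
    have "k^2 * \<kappa> = poly (smult (k^2) c) (- x)" by (simp add: \<kappa>)
    then show ?thesis unfolding c_P by (simp add: w_def power2_eq_square)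
  qed
  have d_Q: "smult (k^4) d = smult (w^3 * L2^2) Q"
  proof -
    have "[:x, 1:] * smult (k^4) d = smult ((k * \<beta>) * (k^2 * \<kappa>)) (smult k b) - smult ((k * \<beta>)^2) (smult (k^2) c)"
      using arg_cong[OF d, of "smult (k^4)"]
      by (simp add: smult_add_right power2_eq_square power4_eq_xxxx ac_simps del: mult_pCons_left)
    also have "\<dots> = [:x, 1:] * smult (w^3 * L2^2) Q"
      unfolding w \<kappa>' c_P kB unfolding B_def
      by (simp add: smult_add_right power2_eq_square power3_eq_cube ac_simps del: mult_pCons_left)
    finally show ?thesis by (rule mult_left_cancel[OF X, THEN iffD1])
  qed
  define s t where "s = w * L2 / k^2" and "t = w^3 * L2^2 / k^4"
  have cs: "c = smult s P" and dt: "d = smult t Q"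
  proof -
    have "c = smult (1 / k^2) (smult (k^2) c)" using \<open>k > 0\<close> by simp
    then show "c = smult s P" unfolding c_P by (simp add: s_def)
    have "d = smult (1 / k^4) (smult (k^4) d)" using \<open>k > 0\<close> by simp
    then show "d = smult t Q" unfolding d_Q by (simp add: t_def)
  qed
  have \<beta>w: "\<beta> = w / k" using w \<open>k > 0\<close> by (simp add: field_simps)
  have "\<beta> * \<alpha> = R4 * (w / k)^2"
    using w \<open>k > 0\<close> by (simp add: \<beta>w field_simps power2_eq_square)
  then have 1: "\<beta> * \<alpha> \<ge> 0" using R by simp
  have "\<beta> * s = w^2 * L2 / k^3"
    by (simp add: \<beta>w s_def power2_eq_square power3_eq_cube)
  then have 2: "\<beta> * s > 0" using R \<open>k > 0\<close> \<open>w \<noteq> 0\<close> by simp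
  have "\<beta> * t = (w^2)^2 * L2^2 / k^5"
    by (simp add: \<beta>w t_def eval_nat_numeral)
  then have 3: "\<beta> * t > 0" using R \<open>k > 0\<close> \<open>w \<noteq> 0\<close> by simp
  have "k^2 * \<kappa> > 0" unfolding \<kappa>' using R \<open>w \<noteq> 0\<close> by simp
  then have 4: "\<kappa> > 0" by (simp add: zero_less_mult_iff)
  have cd: "poly (c_poly a b 0) x = s * p0" "poly (c_poly a b 1) x = s * p1" "poly (c_poly a b 2) x = s * p2"
    "poly (d_poly a b 0) x = t * q0" "poly (d_poly a b 1) x = t * q1" "poly (d_poly a b 2) x = t * q2"
    using cs dt unfolding c_def d_def P_def Q_def by simp_all
  have "F0 a b > 0"
  proof -
    have "res22 (s * p0) (s * p1) (s * p2) (t * q0) (t * q1) (t * q2) = s^2 * t^2 * res22 p0 p1 p2 q0 q1 q2"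
      unfolding res22_def by (simp add: algebra_simps power2_eq_square)
    moreover have "s \<noteq> 0" "t \<noteq> 0" using 2 3 by auto
    ultimately have "\<beta>^4 * \<kappa> * F0 a b > 0"
      using reduction_resultant(2)[OF red[unfolded c_def d_def] deg \<open>\<beta> \<noteq> 0\<close>] 4 pq unfolding cd by simp
    then have "(\<beta>^4 * \<kappa>) * F0 a b > 0" by simp
    then show ?thesis by (rule zero_less_mult_pos) (use 4 \<open>\<beta> \<noteq> 0\<close> in simp)
  qed
  note pc = pencil_cond_scale[OF \<open>\<beta> \<noteq> 0\<close> 1 2 3 less_imp_le[OF 4]] pencil_cond_scale[OF \<open>\<beta> \<noteq> 0\<close> 1 3 2 less_imp_le[OF 4]]
  show "cond_C1 a b (R5 / L2)" if "ladder_cond p0 p1 p2 q0 q1 q2"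
    unfolding cond_iff_pencil_cond x_def[symmetric] cd \<alpha>_def[symmetric] \<beta>_def[symmetric] \<kappa>_def[symmetric]
    using nonneg \<open>F0 a b > 0\<close> pc(1)[OF that] by blast
  show "cond_C2 a b (R5 / L2)" if "ladder_cond p2 p1 p0 q2 q1 q0"
    unfolding cond_iff_pencil_cond x_def[symmetric] cd \<alpha>_def[symmetric] \<beta>_def[symmetric] \<kappa>_def[symmetric]
    using nonneg \<open>F0 a b > 0\<close> pc(1)[OF that] by blast
  show "cond_C3 a b (R5 / L2)" if "ladder_cond q0 q1 q2 p0 p1 p2"
    unfolding cond_iff_pencil_cond x_def[symmetric] cd \<alpha>_def[symmetric] \<beta>_def[symmetric] \<kappa>_def[symmetric]
    using nonneg \<open>F0 a b > 0\<close> pc(2)[OF that] by blast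
  show "cond_C4 a b (R5 / L2)" if "ladder_cond q2 q1 q0 p2 p1 p0"
    unfolding cond_iff_pencil_cond x_def[symmetric] cd \<alpha>_def[symmetric] \<beta>_def[symmetric] \<kappa>_def[symmetric]
    using nonneg \<open>F0 a b > 0\<close> pc(2)[OF that] by blast
qed

text \<open>Counterpart of \<open>ladder_cond_ladder\<close> for the polynomials of
  \<open>inner11\<close> read backwards: \<open>lam\<close> again carries G3, gamma2 is R2 q2, and
  the resultant is L1^3 C1 k^2.\<close>

lemma ladder_cond_ladder_rev:
  assumes "R1 \<ge> 0" "R2 \<ge> 0" "G3 \<ge> 0" "C1 > 0" "L1 > 0"
  defines "k \<equiv> R2 * G3 + 1" and "q1 \<equiv> R2 * C1 + L1 * G3" and "q2 \<equiv> L1 * C1 * (R2 * G3 + 1)"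
  shows "ladder_cond (R1 * q2) (R1 * q1 + L1 * k) (R1 + R2) q2 q1 1"
proof -
  have "lam (R1 * q2) (R1 * q1 + L1 * k) (R1 + R2) q2 q1 1 = L1^3 * C1 * k^2 * G3"
    unfolding lam_def k_def q1_def q2_def by (simp add: algebra_simps power2_eq_square power3_eq_cube)
  moreover have "res22 (R1 * q2) (R1 * q1 + L1 * k) (R1 + R2) q2 q1 1 = L1^3 * C1 * k^2"
    unfolding res22_def k_def q1_def q2_def by (simp add: algebra_simps power2_eq_square power3_eq_cube)
  moreover have "(R1 + R2) * q2 - R1 * q2 * 1 = R2 * q2"
    by (simp add: algebra_simps)
  moreover have "k > 0" "q1 \<ge> 0" "q2 > 0"
    using assms by (simp_all add: add_nonneg_pos)
  ultimately show ?thesis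
    using assms(1-5) unfolding ladder_cond_def by simp
qed

section \<open>Each network class yields its condition at x = R5/L2\<close>

lemma class10_cond:
  fixes a b :: "real poly"
  assumes deg: "degree a \<le> 3" "degree b \<le> 3" and ab: "coprime a b" "\<not> (coeff a 3 = 0 \<and> coeff b 3 = 0)"
    "\<exists>i\<in>{0..3}. coeff b i > 0"
    and N: "N \<in> class10" "impedance N = Some (Fract a b)"
  shows "\<exists>x\<ge>0. cond_C1 a b x"
proof -
  obtain R1 R2 G3 R4 R5 C1 L1 L2 where pos: "R1 \<ge> 0" "R2 \<ge> 0" "G3 \<ge> 0" "C1 > 0" "L1 > 0"
    and R: "R4 \<ge> 0" "R5 \<ge> 0" "L2 > 0" and N_eq: "N = net10 R1 R2 G3 R4 R5 C1 L1 L2"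
    using N(1) unfolding class10_def by blast
  note lad = ladder_cond_ladder[OF pos]
  have nn: "R1 * (R2 * G3 + 1) \<ge> 0" "R1 * (R2 * C1 + L1 * G3) + L1 * (R2 * G3 + 1) \<ge> 0" "R1 * (L1 * C1) + L1 * R2 * C1 \<ge> 0"
    "R2 * G3 + 1 \<ge> 0" "R2 * C1 + L1 * G3 \<ge> 0" "L1 * C1 \<ge> 0"
    "res22 (R1 * (R2 * G3 + 1)) (R1 * (R2 * C1 + L1 * G3) + L1 * (R2 * G3 + 1)) (R1 * (L1 * C1) + L1 * R2 * C1)
      (R2 * G3 + 1) (R2 * C1 + L1 * G3) (L1 * C1) > 0"
    using lad unfolding ladder_cond_def by blast+
  have "cond_C1 a b (R5 / L2)"
    by (rule outer_reduction(1)[OF deg ab impedance_inner10[OF pos(2-5)] nn R N(2)[unfolded N_eq net10_def] lad])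
  then show ?thesis using R by (intro exI[of _ "R5 / L2"]) simp
qed

lemma class12_cond:
  fixes a b :: "real poly"
  assumes deg: "degree a \<le> 3" "degree b \<le> 3" and ab: "coprime a b" "\<not> (coeff a 3 = 0 \<and> coeff b 3 = 0)"
    "\<exists>i\<in>{0..3}. coeff b i > 0"
    and N: "N \<in> class12" "impedance N = Some (Fract a b)"
  shows "\<exists>x\<ge>0. cond_C3 a b x"
proof -
  obtain G1 G2 R3 R4 R5 C1 L1 L2 where pos: "G1 \<ge> 0" "G2 \<ge> 0" "R3 \<ge> 0" "L1 > 0" "C1 > 0"
    and R: "R4 \<ge> 0" "R5 \<ge> 0" "L2 > 0" and N_eq: "N = net12 G1 G2 R3 R4 R5 C1 L1 L2"
    using N(1) unfolding class12_def by blast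
  \<comment> \<open>By duality the conductances G1, G2 take the places of R1, R2, and R3 that of G3;
    the order of \<open>pos\<close> exchanges L1 and C1.\<close>
  note lad = ladder_cond_ladder[OF pos]
  have nn: "G2 * R3 + 1 \<ge> 0" "G2 * L1 + C1 * R3 \<ge> 0" "C1 * L1 \<ge> 0"
    "G1 * (G2 * R3 + 1) \<ge> 0" "G1 * (G2 * L1 + C1 * R3) + C1 * (G2 * R3 + 1) \<ge> 0" "G1 * (C1 * L1) + C1 * G2 * L1 \<ge> 0"
    "res22 (G2 * R3 + 1) (G2 * L1 + C1 * R3) (C1 * L1)
      (G1 * (G2 * R3 + 1)) (G1 * (G2 * L1 + C1 * R3) + C1 * (G2 * R3 + 1)) (G1 * (C1 * L1) + C1 * G2 * L1) > 0"
    using lad unfolding ladder_cond_def res22_swap[of "G2 * R3 + 1"] by blast+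
  have "cond_C3 a b (R5 / L2)"
    by (rule outer_reduction(3)[OF deg ab impedance_inner12[OF pos(2,3,5,4)] nn R N(2)[unfolded N_eq net12_def] lad])
  then show ?thesis using R by (intro exI[of _ "R5 / L2"]) simp
qed

lemma class11_cond:
  fixes a b :: "real poly"
  assumes deg: "degree a \<le> 3" "degree b \<le> 3" and ab: "coprime a b" "\<not> (coeff a 3 = 0 \<and> coeff b 3 = 0)"
    "\<exists>i\<in>{0..3}. coeff b i > 0"
    and N: "N \<in> class11" "impedance N = Some (Fract a b)"
  shows "\<exists>x\<ge>0. cond_C2 a b x"
proof -
  obtain R1 R2 G3 R4 R5 C1 L1 L2 where pos: "R1 \<ge> 0" "R2 \<ge> 0" "G3 \<ge> 0" "C1 > 0" "L1 > 0"
    and R: "R4 \<ge> 0" "R5 \<ge> 0" "L2 > 0" and N_eq: "N = net11 R1 R2 G3 R4 R5 C1 L1 L2"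
    using N(1) unfolding class11_def by blast
  note lad = ladder_cond_ladder_rev[OF pos]
  have nn: "R1 + R2 \<ge> 0" "R1 * (R2 * C1 + L1 * G3) + L1 * (R2 * G3 + 1) \<ge> 0" "R1 * (L1 * C1 * (R2 * G3 + 1)) \<ge> 0"
    "1 \<ge> (0::real)" "R2 * C1 + L1 * G3 \<ge> 0" "L1 * C1 * (R2 * G3 + 1) \<ge> 0"
    "res22 (R1 + R2) (R1 * (R2 * C1 + L1 * G3) + L1 * (R2 * G3 + 1)) (R1 * (L1 * C1 * (R2 * G3 + 1)))
      1 (R2 * C1 + L1 * G3) (L1 * C1 * (R2 * G3 + 1)) > 0"
    using lad unfolding ladder_cond_def res22_rev[of "R1 + R2"] by blast+
  have "cond_C2 a b (R5 / L2)"
    by (rule outer_reduction(2)[OF deg ab impedance_inner11[OF pos(2-5)] nn R N(2)[unfolded N_eq net11_def] lad])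
  then show ?thesis using R by (intro exI[of _ "R5 / L2"]) simp
qed

lemma class13_cond:
  fixes a b :: "real poly"
  assumes deg: "degree a \<le> 3" "degree b \<le> 3" and ab: "coprime a b" "\<not> (coeff a 3 = 0 \<and> coeff b 3 = 0)"
    "\<exists>i\<in>{0..3}. coeff b i > 0"
    and N: "N \<in> class13" "impedance N = Some (Fract a b)"
  shows "\<exists>x\<ge>0. cond_C4 a b x"
proof -
  obtain G1 G2 R3 R4 R5 C1 L1 L2 where pos: "G1 \<ge> 0" "G2 \<ge> 0" "R3 \<ge> 0" "L1 > 0" "C1 > 0"
    and R: "R4 \<ge> 0" "R5 \<ge> 0" "L2 > 0" and N_eq: "N = net13 G1 G2 R3 R4 R5 C1 L1 L2"
    using N(1) unfolding class13_def by blast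
  note lad = ladder_cond_ladder_rev[OF pos]
  have nn: "1 \<ge> (0::real)" "G2 * L1 + C1 * R3 \<ge> 0" "C1 * L1 * (G2 * R3 + 1) \<ge> 0"
    "G1 + G2 \<ge> 0" "G1 * (G2 * L1 + C1 * R3) + C1 * (G2 * R3 + 1) \<ge> 0" "G1 * (C1 * L1 * (G2 * R3 + 1)) \<ge> 0"
    "res22 1 (G2 * L1 + C1 * R3) (C1 * L1 * (G2 * R3 + 1))
      (G1 + G2) (G1 * (G2 * L1 + C1 * R3) + C1 * (G2 * R3 + 1)) (G1 * (C1 * L1 * (G2 * R3 + 1))) > 0"
    using lad unfolding ladder_cond_def res22_swap[of 1] res22_rev[of "G1 + G2"] by blast+
  have "cond_C4 a b (R5 / L2)"
    by (rule outer_reduction(4)[OF deg ab impedance_inner13[OF pos(2,3,5,4)] nn R N(2)[unfolded N_eq net13_def] lad])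
  then show ?thesis using R by (intro exI[of _ "R5 / L2"]) simp
qed

section \<open>From the conditions to networks\<close>

lemma same_sign_mult_nonneg:
  assumes "same_sign S" "u \<in> S" "v \<in> S"
  shows "u * v \<ge> 0" "u / v \<ge> 0"
  using assms unfolding same_sign_def by (auto simp: zero_le_mult_iff zero_le_divide_iff)

lemma ladder_params:
  fixes c0 c1 c2 d0 d1 d2 \<kappa> :: real
  assumes ss: "same_sign {c0, c1, c2, d0, d1, d2, lam c0 c1 c2 d0 d1 d2}"
    and g2: "c2 * d0 - c0 * d2 \<ge> 0" and r: "res22 c0 c1 c2 d0 d1 d2 > 0" and \<kappa>: "\<kappa> > 0"
  shows "d0 \<noteq> 0" "d2 \<noteq> 0" "c1 * d0 - c0 * d1 > 0"
    "\<kappa> * c0 / d0 \<ge> 0" "\<kappa> * (c2 * d0 - c0 * d2) / (d0 * d2) \<ge> 0"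
    "d2 * lam c0 c1 c2 d0 d1 d2 / (\<kappa> * res22 c0 c1 c2 d0 d1 d2) \<ge> 0"
    "d2^2 * (c1 * d0 - c0 * d1) / (\<kappa> * res22 c0 c1 c2 d0 d1 d2) > 0"
    "\<kappa> * (c1 * d0 - c0 * d1) / d0^2 > 0"
proof -
  show strict: "d0 \<noteq> 0" "d2 \<noteq> 0" "c1 * d0 - c0 * d1 > 0"
    using pencil_cond_strict[OF ss g2 r] by blast+
  have "c0 / d0 \<ge> 0" "d0 * d2 \<ge> 0" "d2 * lam c0 c1 c2 d0 d1 d2 \<ge> 0"
    by (rule same_sign_mult_nonneg[OF ss]; simp)+
  moreover have "\<kappa> * c0 / d0 = \<kappa> * (c0 / d0)" by simp
  ultimately show "\<kappa> * c0 / d0 \<ge> 0" "\<kappa> * (c2 * d0 - c0 * d2) / (d0 * d2) \<ge> 0"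
    "d2 * lam c0 c1 c2 d0 d1 d2 / (\<kappa> * res22 c0 c1 c2 d0 d1 d2) \<ge> 0"
    using g2 r \<kappa> by (simp_all only: divide_nonneg_nonneg mult_nonneg_nonneg less_imp_le)
  show "d2^2 * (c1 * d0 - c0 * d1) / (\<kappa> * res22 c0 c1 c2 d0 d1 d2) > 0"
    "\<kappa> * (c1 * d0 - c0 * d1) / d0^2 > 0"
    by (intro divide_pos_pos mult_pos_pos strict r \<kappa>; simp add: strict)+
qed

text \<open>The positive factor \<kappa> is left arbitrary because the dual networks need the
  admittance (1/\<kappa>) d/c, that is, the lemma with c and d exchanged and 1/\<kappa> in place of
  \<kappa>.\<close>

lemma ladder_pencil:
  fixes c0 c1 c2 d0 d1 d2 \<kappa> :: real
  assumes ss: "same_sign {c0, c1, c2, d0, d1, d2, lam c0 c1 c2 d0 d1 d2}"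
    and g2: "c2 * d0 - c0 * d2 \<ge> 0" and r: "res22 c0 c1 c2 d0 d1 d2 > 0" and \<kappa>: "\<kappa> > 0"
    and R1: "R1 = \<kappa> * c0 / d0" and R2: "R2 = \<kappa> * (c2 * d0 - c0 * d2) / (d0 * d2)"
    and G3: "G3 = d2 * lam c0 c1 c2 d0 d1 d2 / (\<kappa> * res22 c0 c1 c2 d0 d1 d2)"
    and C1: "C1 = d2^2 * (c1 * d0 - c0 * d1) / (\<kappa> * res22 c0 c1 c2 d0 d1 d2)"
    and L1: "L1 = \<kappa> * (c1 * d0 - c0 * d1) / d0^2"
  obtains m where "m \<noteq> 0" "R1 \<ge> 0" "R2 \<ge> 0" "G3 \<ge> 0" "C1 > 0" "L1 > 0"
    "[:R1 * (R2 * G3 + 1), R1 * (R2 * C1 + L1 * G3) + L1 * (R2 * G3 + 1), R1 * (L1 * C1) + L1 * R2 * C1:] =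
      smult (m * \<kappa>) [:c0, c1, c2:]"
    "[:R2 * G3 + 1, R2 * C1 + L1 * G3, L1 * C1:] = smult m [:d0, d1, d2:]"
proof -
  note par = ladder_params[OF ss g2 r \<kappa>]
  have "\<kappa> \<noteq> 0" "c1 * d0 - c0 * d1 \<noteq> 0" "res22 c0 c1 c2 d0 d1 d2 \<noteq> 0" using par \<kappa> r by simp_all
  note lad = ladder_realization[OF par(1,2) this, folded R1 R2 G3 C1 L1]
  show thesis
  proof (rule that[OF lad(1)])
    show "R1 \<ge> 0" "R2 \<ge> 0" "G3 \<ge> 0" "C1 > 0" "L1 > 0"
      unfolding R1 R2 G3 C1 L1 by (rule par)+
  qed (simp_all only: lad(2-7) smult_pCons smult_0_right mult.assoc[of _ \<kappa>])
qed

text \<open>The substitution \<open>s \<mapsto> 1/s\<close> reverses the coefficients and turns inductances into inverse capacitances.\<close>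

lemma ladder_pencil_rev:
  fixes c0 c1 c2 d0 d1 d2 \<kappa> :: real
  assumes ss: "same_sign {c2, c1, c0, d2, d1, d0, lam c2 c1 c0 d2 d1 d0}"
    and g2: "c0 * d2 - c2 * d0 \<ge> 0" and r: "res22 c0 c1 c2 d0 d1 d2 > 0" and \<kappa>: "\<kappa> > 0"
    and R1: "R1 = \<kappa> * c2 / d2" and R2: "R2 = \<kappa> * (c0 * d2 - c2 * d0) / (d2 * d0)"
    and G3: "G3 = d0 * lam c2 c1 c0 d2 d1 d0 / (\<kappa> * res22 c0 c1 c2 d0 d1 d2)"
    and L1: "L1 = \<kappa> * res22 c0 c1 c2 d0 d1 d2 / (d0^2 * (c1 * d2 - c2 * d1))"
    and C1: "C1 = d2^2 / (\<kappa> * (c1 * d2 - c2 * d1))"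
  obtains m where "m \<noteq> 0" "R1 \<ge> 0" "R2 \<ge> 0" "G3 \<ge> 0" "C1 > 0" "L1 > 0"
    "[:R1 + R2, R1 * (R2 * C1 + L1 * G3) + L1 * (R2 * G3 + 1), R1 * (L1 * C1 * (R2 * G3 + 1)):] =
      smult (m * \<kappa>) [:c0, c1, c2:]"
    "[:1, R2 * C1 + L1 * G3, L1 * C1 * (R2 * G3 + 1):] = smult m [:d0, d1, d2:]"
proof -
  have r': "res22 c2 c1 c0 d2 d1 d0 > 0" using r by (simp add: res22_rev[of c2])
  define C L where "C = d0^2 * (c1 * d2 - c2 * d1) / (\<kappa> * res22 c0 c1 c2 d0 d1 d2)"
    and "L = \<kappa> * (c1 * d2 - c2 * d1) / d2^2"
  have d: "d0 \<noteq> 0" using ladder_params[OF ss g2 r' \<kappa>] by blast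
  obtain m where m: "m \<noteq> 0" and nn: "R1 \<ge> 0" "R2 \<ge> 0" "G3 \<ge> 0" "C > 0" "L > 0"
    and P: "[:R1 * (R2 * G3 + 1), R1 * (R2 * C + L * G3) + L * (R2 * G3 + 1), R1 * (L * C) + L * R2 * C:] =
      smult (m * \<kappa>) [:c2, c1, c0:]"
    and Q: "[:R2 * G3 + 1, R2 * C + L * G3, L * C:] = smult m [:d2, d1, d0:]"
    by (rule ladder_pencil[OF ss g2 r' \<kappa> R1 R2 _ _ L_def, unfolded res22_rev[of c2], OF G3 C_def])
  have CL: "C1 = 1 / L" "L1 = 1 / C"
    by (simp_all add: C1 L1 C_def L_def)
  \<comment> \<open>Passing to 1/s and dividing by \<open>L * C\<close> makes the constant
    coefficient of the denominator 1, which rescales the common factor.\<close>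
  have "m / (L * C) \<noteq> 0" "C1 > 0" "L1 > 0" using m nn by (simp_all add: CL)
  moreover have "[:R1 + R2, R1 * (R2 * C1 + L1 * G3) + L1 * (R2 * G3 + 1), R1 * (L1 * C1 * (R2 * G3 + 1)):] =
      smult (m / (L * C) * \<kappa>) [:c0, c1, c2:]"
  proof -
    have "R1 + R2 = (R1 * (L * C) + L * R2 * C) / (L * C)"
      "R1 * (R2 * C1 + L1 * G3) + L1 * (R2 * G3 + 1) = (R1 * (R2 * C + L * G3) + L * (R2 * G3 + 1)) / (L * C)"
      "R1 * (L1 * C1 * (R2 * G3 + 1)) = (R1 * (R2 * G3 + 1)) / (L * C)"
      using nn by (simp_all add: CL add_divide_distrib distrib_left mult.commute)
    moreover have "R1 * (L * C) + L * R2 * C = m * \<kappa> * c0"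
      "R1 * (R2 * C + L * G3) + L * (R2 * G3 + 1) = m * \<kappa> * c1" "R1 * (R2 * G3 + 1) = m * \<kappa> * c2"
      using P by (simp_all only: smult_pCons pCons_eq_iff)
    ultimately show ?thesis by (simp only: smult_pCons smult_0_right times_divide_eq_left)
  qed
  moreover have "[:1, R2 * C1 + L1 * G3, L1 * C1 * (R2 * G3 + 1):] = smult (m / (L * C)) [:d0, d1, d2:]"
  proof -
    have "1 = (L * C) / (L * C)" "R2 * C1 + L1 * G3 = (R2 * C + L * G3) / (L * C)"
      "L1 * C1 * (R2 * G3 + 1) = (R2 * G3 + 1) / (L * C)"
      using nn by (simp_all add: CL add_divide_distrib distrib_left mult.commute)
    moreover have "L * C = m * d0" "R2 * C + L * G3 = m * d1" "R2 * G3 + 1 = m * d2"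
      using Q by (simp_all only: smult_pCons pCons_eq_iff)
    ultimately show ?thesis by (simp only: smult_pCons smult_0_right times_divide_eq_left)
  qed
  ultimately show thesis using nn(1-3) that by blast
qed

text \<open>The superset \<open>S\<close> absorbs the lambda and the order of the coefficients, the
  two respects in which the sign sets of the four conditions differ.\<close>

lemma pencil_nondegenerate:
  assumes deg: "degree a \<le> 3" "degree b \<le> 3" and "coprime a b" "\<exists>i\<in>{0..3}. coeff b i > 0"
    and "\<forall>i\<in>{0..3}. coeff a i \<ge> 0 \<and> coeff b i \<ge> 0" "F0 a b > 0" "x \<ge> 0" "poly (kappa a b) x \<ge> 0"
    and ss: "same_sign S" "{poly (alpha a) x, poly (beta b) x,
      poly (c_poly a b 0) x, poly (c_poly a b 1) x, poly (c_poly a b 2) x,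
      poly (d_poly a b 0) x, poly (d_poly a b 1) x, poly (d_poly a b 2) x} \<subseteq> S"
  shows "poly (beta b) x \<noteq> 0" "poly (kappa a b) x > 0"
    "res22 (poly (c_poly a b 0) x) (poly (c_poly a b 1) x) (poly (c_poly a b 2) x)
      (poly (d_poly a b 0) x) (poly (d_poly a b 1) x) (poly (d_poly a b 2) x) > 0"
    "poly (beta b) x ^ 4 * poly (kappa a b) x * F0 a b =
      res22 (poly (c_poly a b 0) x) (poly (c_poly a b 1) x) (poly (c_poly a b 2) x)
        (poly (d_poly a b 0) x) (poly (d_poly a b 1) x) (poly (d_poly a b 2) x)"
    "poly (alpha a) x / poly (beta b) x \<ge> 0"
proof -
  have b: "b \<noteq> 0" "\<forall>i\<in>{0..3}. coeff b i \<ge> 0" using assms by auto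
  note red = reduction_poly[OF deg, of x]
  note c = reduction_nondegenerate[OF red deg \<open>coprime a b\<close> b \<open>F0 a b > 0\<close> same_sign_subset[OF ss] assms(7,8)]
  show "poly (beta b) x \<noteq> 0" "poly (kappa a b) x > 0"
    "res22 (poly (c_poly a b 0) x) (poly (c_poly a b 1) x) (poly (c_poly a b 2) x)
      (poly (d_poly a b 0) x) (poly (d_poly a b 1) x) (poly (d_poly a b 2) x) > 0"
    by (rule c)+
  then show "poly (beta b) x ^ 4 * poly (kappa a b) x * F0 a b =
      res22 (poly (c_poly a b 0) x) (poly (c_poly a b 1) x) (poly (c_poly a b 2) x)
        (poly (d_poly a b 0) x) (poly (d_poly a b 1) x) (poly (d_poly a b 2) x)"
    by (intro reduction_resultant(2)[OF red deg]) simp_all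
  show "poly (alpha a) x / poly (beta b) x \<ge> 0"
    using ss(2) by (intro same_sign_mult_nonneg(2)[OF ss(1)]) auto
qed

lemma outer_realization_poly:
  assumes deg: "degree a \<le> 3" "degree b \<le> 3" and "b \<noteq> 0"
    and "poly (beta b) x \<noteq> 0" "poly (kappa a b) x > 0"
    and "res22 (poly (c_poly a b 0) x) (poly (c_poly a b 1) x) (poly (c_poly a b 2) x)
      (poly (d_poly a b 0) x) (poly (d_poly a b 1) x) (poly (d_poly a b 2) x) > 0"
    and "m \<noteq> 0" "impedance N = imp_frac
      (smult (m * poly (kappa a b) x) [:poly (c_poly a b 0) x, poly (c_poly a b 1) x, poly (c_poly a b 2) x:])
      (smult m [:poly (d_poly a b 0) x, poly (d_poly a b 1) x, poly (d_poly a b 2) x:])"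
  shows "impedance (outer (poly (alpha a) x / poly (beta b) x) (poly (kappa a b) x * x / poly (beta b) x ^ 2)
    (poly (kappa a b) x / poly (beta b) x ^ 2) N) = Some (Fract a b)"
proof (rule outer_realization[OF reduction_poly[OF deg, of x] assms(4) _ assms(3,7) _ assms(8)])
  show "poly (kappa a b) x \<noteq> 0" using assms(5) by simp
  show "[:poly (c_poly a b 0) x, poly (c_poly a b 1) x, poly (c_poly a b 2) x:] \<noteq> 0"
    using assms(6) by (auto simp: res22_def)
qed

section \<open>Element values under each of the four conditions\<close>

lemma C1_realization:
  assumes deg: "degree a \<le> 3" "degree b \<le> 3" and cop: "coprime a b" and b: "\<exists>i\<in>{0..3}. coeff b i > 0"
    and x: "x \<ge> 0" "cond_C1 a b x"
  shows "let \<alpha> = poly (alpha a) x; \<beta> = poly (beta b) x; \<kappa> = poly (kappa a b) x;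
         c0 = poly (c_poly a b 0) x; c2 = poly (c_poly a b 2) x;
         d0 = poly (d_poly a b 0) x; d2 = poly (d_poly a b 2) x;
         \<gamma>1 = poly (gamma1 a b) x; \<gamma>2 = poly (gamma2 a b) x;
         l1 = poly (lambda1 a b) x;
         R1 = \<kappa> * c0 / d0;
         R2 = \<kappa> * \<gamma>2 / (d0 * d2);
         G3 = d2 * l1 / (\<beta>^4 * \<kappa>^2 * F0 a b);
         R4 = \<alpha> / \<beta>;
         R5 = \<kappa> * x / \<beta>^2;
         C1 = d2^2 * \<gamma>1 / (\<beta>^4 * \<kappa>^2 * F0 a b);
         L1 = \<kappa> * \<gamma>1 / d0^2;
         L2 = \<kappa> / \<beta>^2;
         N = net10 R1 R2 G3 R4 R5 C1 L1 L2
       in \<beta> \<noteq> 0 \<and> d0 \<noteq> 0 \<and> d2 \<noteq> 0 \<and> \<kappa> > 0 \<and> \<gamma>1 > 0 \<and>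
          N \<in> class10 \<and> impedance N = Some (Fract a b) \<and>
          (x = 0 \<longrightarrow> R5 = 0 \<and> N \<in> class18) \<and>
          (l1 = 0 \<longrightarrow> G3 = 0 \<and> N \<in> class17) \<and>
          (c0 = 0 \<longrightarrow> R1 = 0 \<and> N \<in> class16)"
proof -
  define \<alpha> \<beta> \<kappa> c0 c1 c2 d0 d1 d2 \<gamma>1 \<gamma>2 l1
    where defs: "\<alpha> = poly (alpha a) x" "\<beta> = poly (beta b) x" "\<kappa> = poly (kappa a b) x"
      "c0 = poly (c_poly a b 0) x" "c1 = poly (c_poly a b 1) x" "c2 = poly (c_poly a b 2) x"
      "d0 = poly (d_poly a b 0) x" "d1 = poly (d_poly a b 1) x" "d2 = poly (d_poly a b 2) x"
      "\<gamma>1 = poly (gamma1 a b) x" "\<gamma>2 = poly (gamma2 a b) x" "l1 = poly (lambda1 a b) x"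
  have b0: "b \<noteq> 0" using b by auto
  have nn: "\<forall>i\<in>{0..3}. coeff a i \<ge> 0 \<and> coeff b i \<ge> 0" "F0 a b > 0"
    and "pencil_cond \<alpha> \<beta> \<kappa> c0 c1 c2 d0 d1 d2"
    using x(2) unfolding cond_iff_pencil_cond defs by blast+
  then have ss: "same_sign {\<alpha>, \<beta>, c0, c1, c2, d0, d1, d2, lam c0 c1 c2 d0 d1 d2}"
    and \<kappa>: "\<kappa> \<ge> 0" and g2: "c2 * d0 - c0 * d2 \<ge> 0"
    unfolding pencil_cond_def by blast+
  note nd = pencil_nondegenerate[OF deg cop b nn x(1), folded defs, OF \<kappa> ss]
  have res: "\<beta>^4 * \<kappa> * F0 a b = res22 c0 c1 c2 d0 d1 d2" by (rule nd) blast
  have nd: "\<beta> \<noteq> 0" "\<kappa> > 0" "res22 c0 c1 c2 d0 d1 d2 > 0" "\<alpha> / \<beta> \<ge> 0" by (rule nd; blast)+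
  have \<gamma>: "\<gamma>1 = c1 * d0 - c0 * d1" "\<gamma>2 = c2 * d0 - c0 * d2" "l1 = lam c0 c1 c2 d0 d1 d2"
    unfolding defs by (simp_all add: gamma1_def gamma2_def poly_lambda_eq_lam)
  have ss': "same_sign {c0, c1, c2, d0, d1, d2, lam c0 c1 c2 d0 d1 d2}"
    by (rule same_sign_subset[OF ss]) blast
  note strict = pencil_cond_strict[OF ss' g2 nd(3)]
  \<comment> \<open>Converts the denominators with \<open>F0\<close> into the resultant of c and d,
    in which the ladder formulas are expressed.\<close>
  have den: "\<beta>^4 * \<kappa>^2 * F0 a b = \<kappa> * res22 c0 c1 c2 d0 d1 d2"
    unfolding res[symmetric] by (simp add: power2_eq_square)
  define R1 R2 G3 C1 L1 R4 R5 L2 where R: "R1 = \<kappa> * c0 / d0" "R2 = \<kappa> * \<gamma>2 / (d0 * d2)"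
    "G3 = d2 * l1 / (\<beta>^4 * \<kappa>^2 * F0 a b)" "C1 = d2^2 * \<gamma>1 / (\<beta>^4 * \<kappa>^2 * F0 a b)"
    "L1 = \<kappa> * \<gamma>1 / d0^2" "R4 = \<alpha> / \<beta>" "R5 = \<kappa> * x / \<beta>^2" "L2 = \<kappa> / \<beta>^2"
  note Rs = R(1-5)[unfolded den \<gamma>]
  obtain m where m: "m \<noteq> 0" and pos: "R1 \<ge> 0" "R2 \<ge> 0" "G3 \<ge> 0" "C1 > 0" "L1 > 0"
    and PQ: "[:R1 * (R2 * G3 + 1), R1 * (R2 * C1 + L1 * G3) + L1 * (R2 * G3 + 1), R1 * (L1 * C1) + L1 * R2 * C1:] =
      smult (m * \<kappa>) [:c0, c1, c2:]"
    "[:R2 * G3 + 1, R2 * C1 + L1 * G3, L1 * C1:] = smult m [:d0, d1, d2:]"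
    by (rule ladder_pencil[OF ss' g2 nd(3,2) Rs])
  have inner: "impedance (inner10 R1 R2 G3 C1 L1) = imp_frac (smult (m * \<kappa>) [:c0, c1, c2:]) (smult m [:d0, d1, d2:])"
    using impedance_inner10[of R2 G3 C1 L1 R1] pos unfolding PQ by blast
  have imp: "impedance (net10 R1 R2 G3 R4 R5 C1 L1 L2) = Some (Fract a b)"
    unfolding net10_def R(6-8) using outer_realization_poly[OF deg b0, of x m, folded defs, OF nd(1-3) m inner] .
  have "R4 \<ge> 0" "R5 \<ge> 0" "L2 > 0"
    using nd x(1) by (simp_all add: R)
  with pos have N: "net10 R1 R2 G3 R4 R5 C1 L1 L2 \<in> class10"
    unfolding class10_def by blast
  have "x = 0 \<Longrightarrow> R5 = 0" "l1 = 0 \<Longrightarrow> G3 = 0" "c0 = 0 \<Longrightarrow> R1 = 0"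
    by (simp_all add: R)
  moreover have "R5 = 0 \<Longrightarrow> net10 R1 R2 G3 R4 R5 C1 L1 L2 \<in> class18"
    "G3 = 0 \<Longrightarrow> net10 R1 R2 G3 R4 R5 C1 L1 L2 \<in> class17"
    "R1 = 0 \<Longrightarrow> net10 R1 R2 G3 R4 R5 C1 L1 L2 \<in> class16"
    using N unfolding class16_def class17_def class18_def by blast+
  ultimately show ?thesis
    unfolding Let_def unfolding defs[symmetric] R[symmetric]
    using nd strict imp N unfolding \<gamma>(1) by blast
qed

lemma C2_realization:
  assumes deg: "degree a \<le> 3" "degree b \<le> 3" and cop: "coprime a b" and b: "\<exists>i\<in>{0..3}. coeff b i > 0"
    and x: "x \<ge> 0" "cond_C2 a b x"
  shows "let \<alpha> = poly (alpha a) x; \<beta> = poly (beta b) x; \<kappa> = poly (kappa a b) x;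
         c0 = poly (c_poly a b 0) x; c2 = poly (c_poly a b 2) x;
         d0 = poly (d_poly a b 0) x; d2 = poly (d_poly a b 2) x;
         \<gamma>3 = poly (gamma3 a b) x; \<gamma>2 = poly (gamma2 a b) x;
         l3 = poly (lambda3 a b) x;
         R1 = \<kappa> * c2 / d2;
         R2 = - (\<kappa> * \<gamma>2) / (d0 * d2);
         G3 = d0 * l3 / (\<beta>^4 * \<kappa>^2 * F0 a b);
         R4 = \<alpha> / \<beta>;
         R5 = \<kappa> * x / \<beta>^2;
         C1 = - (d2^2) / (\<kappa> * \<gamma>3);
         L1 = - (\<beta>^4 * \<kappa>^2 * F0 a b) / (d0^2 * \<gamma>3);
         L2 = \<kappa> / \<beta>^2;
         N = net11 R1 R2 G3 R4 R5 C1 L1 L2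
       in \<beta> \<noteq> 0 \<and> d0 \<noteq> 0 \<and> d2 \<noteq> 0 \<and> \<kappa> > 0 \<and> - \<gamma>3 > 0 \<and>
          N \<in> class11 \<and> impedance N = Some (Fract a b) \<and>
          (x = 0 \<longrightarrow> R5 = 0 \<and> N \<in> class21) \<and>
          (l3 = 0 \<longrightarrow> G3 = 0 \<and> N \<in> class20) \<and>
          (c2 = 0 \<longrightarrow> R1 = 0 \<and> N \<in> class19)"
proof -
  define \<alpha> \<beta> \<kappa> c0 c1 c2 d0 d1 d2 \<gamma>3 \<gamma>2 l3
    where defs: "\<alpha> = poly (alpha a) x" "\<beta> = poly (beta b) x" "\<kappa> = poly (kappa a b) x"
      "c0 = poly (c_poly a b 0) x" "c1 = poly (c_poly a b 1) x" "c2 = poly (c_poly a b 2) x"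
      "d0 = poly (d_poly a b 0) x" "d1 = poly (d_poly a b 1) x" "d2 = poly (d_poly a b 2) x"
      "\<gamma>3 = poly (gamma3 a b) x" "\<gamma>2 = poly (gamma2 a b) x" "l3 = poly (lambda3 a b) x"
  have b0: "b \<noteq> 0" using b by auto
  have nn: "\<forall>i\<in>{0..3}. coeff a i \<ge> 0 \<and> coeff b i \<ge> 0" "F0 a b > 0"
    and "pencil_cond \<alpha> \<beta> \<kappa> c2 c1 c0 d2 d1 d0"
    using x(2) unfolding cond_iff_pencil_cond defs by blast+
  then have ss: "same_sign {\<alpha>, \<beta>, c2, c1, c0, d2, d1, d0, lam c2 c1 c0 d2 d1 d0}"
    and \<kappa>: "\<kappa> \<ge> 0" and g2: "c0 * d2 - c2 * d0 \<ge> 0"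
    unfolding pencil_cond_def by blast+
  note nd = pencil_nondegenerate[OF deg cop b nn x(1), folded defs, OF \<kappa> ss]
  have res: "\<beta>^4 * \<kappa> * F0 a b = res22 c0 c1 c2 d0 d1 d2" by (rule nd) blast
  have nd: "\<beta> \<noteq> 0" "\<kappa> > 0" "res22 c0 c1 c2 d0 d1 d2 > 0" "\<alpha> / \<beta> \<ge> 0" by (rule nd; blast)+
  have \<gamma>: "\<gamma>3 = - (c1 * d2 - c2 * d1)" "\<gamma>2 = - (c0 * d2 - c2 * d0)" "l3 = lam c2 c1 c0 d2 d1 d0"
    unfolding defs by (simp_all add: gamma3_def gamma2_def poly_lambda_eq_lam)
  have ss': "same_sign {c2, c1, c0, d2, d1, d0, lam c2 c1 c0 d2 d1 d0}"
    by (rule same_sign_subset[OF ss]) blast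
  have res_pos: "res22 c2 c1 c0 d2 d1 d0 > 0"
    using nd(3) by (simp add: res22_rev[of c2])
  note strict = pencil_cond_strict[OF ss' g2 res_pos]
  have den: "\<beta>^4 * \<kappa>^2 * F0 a b = \<kappa> * res22 c0 c1 c2 d0 d1 d2"
    unfolding res[symmetric] by (simp add: power2_eq_square)
  define R1 R2 G3 C1 L1 R4 R5 L2 where R: "R1 = \<kappa> * c2 / d2" "R2 = - (\<kappa> * \<gamma>2) / (d0 * d2)"
    "G3 = d0 * l3 / (\<beta>^4 * \<kappa>^2 * F0 a b)" "C1 = - (d2^2) / (\<kappa> * \<gamma>3)"
    "L1 = - (\<beta>^4 * \<kappa>^2 * F0 a b) / (d0^2 * \<gamma>3)" "R4 = \<alpha> / \<beta>" "R5 = \<kappa> * x / \<beta>^2" "L2 = \<kappa> / \<beta>^2"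
  have Rs: "R1 = \<kappa> * c2 / d2" "R2 = \<kappa> * (c0 * d2 - c2 * d0) / (d2 * d0)"
    "G3 = d0 * lam c2 c1 c0 d2 d1 d0 / (\<kappa> * res22 c0 c1 c2 d0 d1 d2)"
    "L1 = \<kappa> * res22 c0 c1 c2 d0 d1 d2 / (d0^2 * (c1 * d2 - c2 * d1))"
    "C1 = d2^2 / (\<kappa> * (c1 * d2 - c2 * d1))"
    unfolding R(1-5) den \<gamma> mult_minus_right minus_minus minus_divide_divide
    by (simp_all only: mult.commute)
  obtain m where m: "m \<noteq> 0" and pos: "R1 \<ge> 0" "R2 \<ge> 0" "G3 \<ge> 0" "C1 > 0" "L1 > 0"
    and PQ: "[:R1 + R2, R1 * (R2 * C1 + L1 * G3) + L1 * (R2 * G3 + 1), R1 * (L1 * C1 * (R2 * G3 + 1)):] =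
      smult (m * \<kappa>) [:c0, c1, c2:]"
    "[:1, R2 * C1 + L1 * G3, L1 * C1 * (R2 * G3 + 1):] = smult m [:d0, d1, d2:]"
    by (rule ladder_pencil_rev[OF ss' g2 nd(3,2) Rs])
  have inner: "impedance (inner11 R1 R2 G3 C1 L1) = imp_frac (smult (m * \<kappa>) [:c0, c1, c2:]) (smult m [:d0, d1, d2:])"
    using impedance_inner11[of R2 G3 C1 L1 R1] pos unfolding PQ by blast
  have imp: "impedance (net11 R1 R2 G3 R4 R5 C1 L1 L2) = Some (Fract a b)"
    unfolding net11_def R(6-8) using outer_realization_poly[OF deg b0, of x m, folded defs, OF nd(1-3) m inner] .
  have "R4 \<ge> 0" "R5 \<ge> 0" "L2 > 0"
    using nd x(1) by (simp_all add: R)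
  with pos have N: "net11 R1 R2 G3 R4 R5 C1 L1 L2 \<in> class11"
    unfolding class11_def by blast
  have "x = 0 \<Longrightarrow> R5 = 0" "l3 = 0 \<Longrightarrow> G3 = 0" "c2 = 0 \<Longrightarrow> R1 = 0"
    by (simp_all add: R)
  moreover have "R5 = 0 \<Longrightarrow> net11 R1 R2 G3 R4 R5 C1 L1 L2 \<in> class21"
    "G3 = 0 \<Longrightarrow> net11 R1 R2 G3 R4 R5 C1 L1 L2 \<in> class20"
    "R1 = 0 \<Longrightarrow> net11 R1 R2 G3 R4 R5 C1 L1 L2 \<in> class19"
    using N unfolding class19_def class20_def class21_def by blast+
  moreover have "- \<gamma>3 > 0" using strict by (simp add: \<gamma>)
  ultimately show ?thesis
    unfolding Let_def unfolding defs[symmetric] R[symmetric]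
    using nd strict imp N by blast
qed

text \<open>The ladder expansion is applied to the admittance (1/\<kappa>) d/c. Its denominator
  (1/\<kappa>) Res(c,d) is \<beta>^4 \<open>F0\<close>, which is why no power of \<kappa> appears in
  R3 and L1.\<close>

lemma C3_realization:
  assumes deg: "degree a \<le> 3" "degree b \<le> 3" and cop: "coprime a b" and b: "\<exists>i\<in>{0..3}. coeff b i > 0"
    and x: "x \<ge> 0" "cond_C3 a b x"
  shows "let \<alpha> = poly (alpha a) x; \<beta> = poly (beta b) x; \<kappa> = poly (kappa a b) x;
         c0 = poly (c_poly a b 0) x; c2 = poly (c_poly a b 2) x;
         d0 = poly (d_poly a b 0) x; d2 = poly (d_poly a b 2) x;
         \<gamma>1 = poly (gamma1 a b) x; \<gamma>2 = poly (gamma2 a b) x;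
         l4 = poly (lambda4 a b) x;
         G1 = d0 / (\<kappa> * c0);
         G2 = - \<gamma>2 / (\<kappa> * c0 * c2);
         R3 = c2 * l4 / (\<beta>^4 * F0 a b);
         R4 = \<alpha> / \<beta>;
         R5 = \<kappa> * x / \<beta>^2;
         C1 = - \<gamma>1 / (\<kappa> * c0^2);
         L1 = - (c2^2 * \<gamma>1) / (\<beta>^4 * F0 a b);
         L2 = \<kappa> / \<beta>^2;
         N = net12 G1 G2 R3 R4 R5 C1 L1 L2
       in \<beta> \<noteq> 0 \<and> c0 \<noteq> 0 \<and> c2 \<noteq> 0 \<and> \<kappa> > 0 \<and> - \<gamma>1 > 0 \<and>
          N \<in> class12 \<and> impedance N = Some (Fract a b) \<and>
          (x = 0 \<longrightarrow> R5 = 0 \<and> N \<in> class24) \<and>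
          (l4 = 0 \<longrightarrow> R3 = 0 \<and> N \<in> class23) \<and>
          (d0 = 0 \<longrightarrow> G1 = 0 \<and> N \<in> class22)"
proof -
  define \<alpha> \<beta> \<kappa> c0 c1 c2 d0 d1 d2 \<gamma>1 \<gamma>2 l4
    where defs: "\<alpha> = poly (alpha a) x" "\<beta> = poly (beta b) x" "\<kappa> = poly (kappa a b) x"
      "c0 = poly (c_poly a b 0) x" "c1 = poly (c_poly a b 1) x" "c2 = poly (c_poly a b 2) x"
      "d0 = poly (d_poly a b 0) x" "d1 = poly (d_poly a b 1) x" "d2 = poly (d_poly a b 2) x"
      "\<gamma>1 = poly (gamma1 a b) x" "\<gamma>2 = poly (gamma2 a b) x" "l4 = poly (lambda4 a b) x"
  have b0: "b \<noteq> 0" using b by auto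
  have nn: "\<forall>i\<in>{0..3}. coeff a i \<ge> 0 \<and> coeff b i \<ge> 0" "F0 a b > 0"
    and "pencil_cond \<alpha> \<beta> \<kappa> d0 d1 d2 c0 c1 c2"
    using x(2) unfolding cond_iff_pencil_cond defs by blast+
  then have ss: "same_sign {\<alpha>, \<beta>, d0, d1, d2, c0, c1, c2, lam d0 d1 d2 c0 c1 c2}"
    and \<kappa>: "\<kappa> \<ge> 0" and g2: "d2 * c0 - d0 * c2 \<ge> 0"
    unfolding pencil_cond_def by blast+
  note nd = pencil_nondegenerate[OF deg cop b nn x(1), folded defs, OF \<kappa> ss]
  have res: "\<beta>^4 * \<kappa> * F0 a b = res22 c0 c1 c2 d0 d1 d2" by (rule nd) blast
  have nd: "\<beta> \<noteq> 0" "\<kappa> > 0" "res22 c0 c1 c2 d0 d1 d2 > 0" "\<alpha> / \<beta> \<ge> 0" by (rule nd; blast)+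
  have \<gamma>: "\<gamma>1 = - (d1 * c0 - d0 * c1)" "\<gamma>2 = - (d2 * c0 - d0 * c2)" "l4 = lam d0 d1 d2 c0 c1 c2"
    unfolding defs by (simp_all add: gamma1_def gamma2_def poly_lambda_eq_lam)
  have ss': "same_sign {d0, d1, d2, c0, c1, c2, lam d0 d1 d2 c0 c1 c2}"
    by (rule same_sign_subset[OF ss]) blast
  have res_pos: "res22 d0 d1 d2 c0 c1 c2 > 0"
    using nd(3) by (simp add: res22_swap[of d0])
  note strict = pencil_cond_strict[OF ss' g2 res_pos]
  have den: "\<beta>^4 * F0 a b = 1 / \<kappa> * res22 d0 d1 d2 c0 c1 c2"
    unfolding res22_swap[of d0] res[symmetric] using nd by simp
  define G1 G2 R3 L1 C1 R4 R5 L2 where R: "G1 = d0 / (\<kappa> * c0)" "G2 = - \<gamma>2 / (\<kappa> * c0 * c2)"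
    "R3 = c2 * l4 / (\<beta>^4 * F0 a b)" "L1 = - (c2^2 * \<gamma>1) / (\<beta>^4 * F0 a b)"
    "C1 = - \<gamma>1 / (\<kappa> * c0^2)" "R4 = \<alpha> / \<beta>" "R5 = \<kappa> * x / \<beta>^2" "L2 = \<kappa> / \<beta>^2"
  have Rs: "G1 = 1 / \<kappa> * d0 / c0" "G2 = 1 / \<kappa> * (d2 * c0 - d0 * c2) / (c0 * c2)"
    "R3 = c2 * lam d0 d1 d2 c0 c1 c2 / (1 / \<kappa> * res22 d0 d1 d2 c0 c1 c2)"
    "L1 = c2^2 * (d1 * c0 - d0 * c1) / (1 / \<kappa> * res22 d0 d1 d2 c0 c1 c2)"
    "C1 = 1 / \<kappa> * (d1 * c0 - d0 * c1) / c0^2"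
    unfolding R(1-5) den \<gamma> by (simp_all only: minus_minus mult_minus_right) (simp_all add: mult.assoc)
  have "1 / \<kappa> > 0" using nd by simp
  obtain m where m: "m \<noteq> 0" and pos: "G1 \<ge> 0" "G2 \<ge> 0" "R3 \<ge> 0" "L1 > 0" "C1 > 0"
    and PQ: "[:G1 * (G2 * R3 + 1), G1 * (G2 * L1 + C1 * R3) + C1 * (G2 * R3 + 1), G1 * (C1 * L1) + C1 * G2 * L1:] =
      smult (m * (1 / \<kappa>)) [:d0, d1, d2:]"
    "[:G2 * R3 + 1, G2 * L1 + C1 * R3, C1 * L1:] = smult m [:c0, c1, c2:]"
    by (rule ladder_pencil[OF ss' g2 res_pos \<open>1 / \<kappa> > 0\<close> Rs])
  \<comment> \<open>The admittance has numerator (m/\<kappa>) d and denominator m c; taking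
    m/\<kappa> as common factor puts its inverse into the form \<kappa>c/d.\<close>
  have m': "m / \<kappa> \<noteq> 0" "m = m / \<kappa> * \<kappa>" "m * (1 / \<kappa>) = m / \<kappa>" using m nd by simp_all
  have inner: "impedance (inner12 G1 G2 R3 C1 L1) =
      imp_frac (smult (m / \<kappa> * \<kappa>) [:c0, c1, c2:]) (smult (m / \<kappa>) [:d0, d1, d2:])"
    using impedance_inner12[of G2 R3 C1 L1 G1] pos unfolding PQ m'(3) m'(2)[symmetric] by blast
  have imp: "impedance (net12 G1 G2 R3 R4 R5 C1 L1 L2) = Some (Fract a b)"
    unfolding net12_def R(6-8) using outer_realization_poly[OF deg b0, of x "m / \<kappa>", folded defs, OF nd(1-3) m'(1) inner] .
  have "R4 \<ge> 0" "R5 \<ge> 0" "L2 > 0"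
    using nd x(1) by (simp_all add: R)
  with pos have N: "net12 G1 G2 R3 R4 R5 C1 L1 L2 \<in> class12"
    unfolding class12_def by blast
  have "x = 0 \<Longrightarrow> R5 = 0" "l4 = 0 \<Longrightarrow> R3 = 0" "d0 = 0 \<Longrightarrow> G1 = 0"
    by (simp_all add: R)
  moreover have "R5 = 0 \<Longrightarrow> net12 G1 G2 R3 R4 R5 C1 L1 L2 \<in> class24"
    "R3 = 0 \<Longrightarrow> net12 G1 G2 R3 R4 R5 C1 L1 L2 \<in> class23"
    "G1 = 0 \<Longrightarrow> net12 G1 G2 R3 R4 R5 C1 L1 L2 \<in> class22"
    using N unfolding class22_def class23_def class24_def by blast+
  moreover have "- \<gamma>1 > 0" using strict by (simp add: \<gamma>)
  ultimately show ?thesis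
    unfolding Let_def unfolding defs[symmetric] R[symmetric]
    using nd strict imp N by blast
qed

lemma C4_realization:
  assumes deg: "degree a \<le> 3" "degree b \<le> 3" and cop: "coprime a b" and b: "\<exists>i\<in>{0..3}. coeff b i > 0"
    and x: "x \<ge> 0" "cond_C4 a b x"
  shows "let \<alpha> = poly (alpha a) x; \<beta> = poly (beta b) x; \<kappa> = poly (kappa a b) x;
         c0 = poly (c_poly a b 0) x; c2 = poly (c_poly a b 2) x;
         d0 = poly (d_poly a b 0) x; d2 = poly (d_poly a b 2) x;
         \<gamma>3 = poly (gamma3 a b) x; \<gamma>2 = poly (gamma2 a b) x;
         l2 = poly (lambda2 a b) x;
         G1 = d2 / (\<kappa> * c2);
         G2 = \<gamma>2 / (\<kappa> * c0 * c2);
         R3 = c0 * l2 / (\<beta>^4 * F0 a b);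
         R4 = \<alpha> / \<beta>;
         R5 = \<kappa> * x / \<beta>^2;
         C1 = (\<beta>^4 * F0 a b) / (c0^2 * \<gamma>3);
         L1 = \<kappa> * c2^2 / \<gamma>3;
         L2 = \<kappa> / \<beta>^2;
         N = net13 G1 G2 R3 R4 R5 C1 L1 L2
       in \<beta> \<noteq> 0 \<and> c0 \<noteq> 0 \<and> c2 \<noteq> 0 \<and> \<kappa> > 0 \<and> \<gamma>3 > 0 \<and>
          N \<in> class13 \<and> impedance N = Some (Fract a b) \<and>
          (x = 0 \<longrightarrow> R5 = 0 \<and> N \<in> class27) \<and>
          (l2 = 0 \<longrightarrow> R3 = 0 \<and> N \<in> class26) \<and>
          (d2 = 0 \<longrightarrow> G1 = 0 \<and> N \<in> class25)"
proof -
  define \<alpha> \<beta> \<kappa> c0 c1 c2 d0 d1 d2 \<gamma>3 \<gamma>2 l2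
    where defs: "\<alpha> = poly (alpha a) x" "\<beta> = poly (beta b) x" "\<kappa> = poly (kappa a b) x"
      "c0 = poly (c_poly a b 0) x" "c1 = poly (c_poly a b 1) x" "c2 = poly (c_poly a b 2) x"
      "d0 = poly (d_poly a b 0) x" "d1 = poly (d_poly a b 1) x" "d2 = poly (d_poly a b 2) x"
      "\<gamma>3 = poly (gamma3 a b) x" "\<gamma>2 = poly (gamma2 a b) x" "l2 = poly (lambda2 a b) x"
  have b0: "b \<noteq> 0" using b by auto
  have nn: "\<forall>i\<in>{0..3}. coeff a i \<ge> 0 \<and> coeff b i \<ge> 0" "F0 a b > 0"
    and "pencil_cond \<alpha> \<beta> \<kappa> d2 d1 d0 c2 c1 c0"
    using x(2) unfolding cond_iff_pencil_cond defs by blast+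
  then have ss: "same_sign {\<alpha>, \<beta>, d2, d1, d0, c2, c1, c0, lam d2 d1 d0 c2 c1 c0}"
    and \<kappa>: "\<kappa> \<ge> 0" and g2: "d0 * c2 - d2 * c0 \<ge> 0"
    unfolding pencil_cond_def by blast+
  note nd = pencil_nondegenerate[OF deg cop b nn x(1), folded defs, OF \<kappa> ss]
  have res: "\<beta>^4 * \<kappa> * F0 a b = res22 c0 c1 c2 d0 d1 d2" by (rule nd) blast
  have nd: "\<beta> \<noteq> 0" "\<kappa> > 0" "res22 c0 c1 c2 d0 d1 d2 > 0" "\<alpha> / \<beta> \<ge> 0" by (rule nd; blast)+
  have \<gamma>: "\<gamma>3 = d1 * c2 - d2 * c1" "\<gamma>2 = d0 * c2 - d2 * c0" "l2 = lam d2 d1 d0 c2 c1 c0"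
    unfolding defs by (simp_all add: gamma3_def gamma2_def poly_lambda_eq_lam)
  have ss': "same_sign {d2, d1, d0, c2, c1, c0, lam d2 d1 d0 c2 c1 c0}"
    by (rule same_sign_subset[OF ss]) blast
  have swap: "res22 d0 d1 d2 c0 c1 c2 = res22 c0 c1 c2 d0 d1 d2" by (rule res22_swap)
  have res_pos: "res22 d0 d1 d2 c0 c1 c2 > 0" "res22 d2 d1 d0 c2 c1 c0 > 0"
    using nd(3) by (simp_all add: swap res22_rev[of d2])
  note strict = pencil_cond_strict[OF ss' g2 res_pos(2)]
  have den: "\<beta>^4 * F0 a b = 1 / \<kappa> * res22 d0 d1 d2 c0 c1 c2"
    unfolding swap res[symmetric] using nd by simp
  define G1 G2 R3 L1 C1 R4 R5 L2 where R: "G1 = d2 / (\<kappa> * c2)" "G2 = \<gamma>2 / (\<kappa> * c0 * c2)"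
    "R3 = c0 * l2 / (\<beta>^4 * F0 a b)" "L1 = \<kappa> * c2^2 / \<gamma>3"
    "C1 = (\<beta>^4 * F0 a b) / (c0^2 * \<gamma>3)" "R4 = \<alpha> / \<beta>" "R5 = \<kappa> * x / \<beta>^2" "L2 = \<kappa> / \<beta>^2"
  have Rs: "G1 = 1 / \<kappa> * d2 / c2" "G2 = 1 / \<kappa> * (d0 * c2 - d2 * c0) / (c2 * c0)"
    "R3 = c0 * lam d2 d1 d0 c2 c1 c0 / (1 / \<kappa> * res22 d0 d1 d2 c0 c1 c2)"
    "C1 = 1 / \<kappa> * res22 d0 d1 d2 c0 c1 c2 / (c0^2 * (d1 * c2 - d2 * c1))"
    "L1 = c2^2 / (1 / \<kappa> * (d1 * c2 - d2 * c1))"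
    unfolding R(1-5) den \<gamma> by (simp_all add: ac_simps)
  have "1 / \<kappa> > 0" using nd by simp
  obtain m where m: "m \<noteq> 0" and pos: "G1 \<ge> 0" "G2 \<ge> 0" "R3 \<ge> 0" "L1 > 0" "C1 > 0"
    and PQ: "[:G1 + G2, G1 * (G2 * L1 + C1 * R3) + C1 * (G2 * R3 + 1), G1 * (C1 * L1 * (G2 * R3 + 1)):] =
      smult (m * (1 / \<kappa>)) [:d0, d1, d2:]"
    "[:1, G2 * L1 + C1 * R3, C1 * L1 * (G2 * R3 + 1):] = smult m [:c0, c1, c2:]"
    by (rule ladder_pencil_rev[OF ss' g2 res_pos(1) \<open>1 / \<kappa> > 0\<close> Rs])
  have m': "m / \<kappa> \<noteq> 0" "m = m / \<kappa> * \<kappa>" "m * (1 / \<kappa>) = m / \<kappa>" using m nd by simp_all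
  have inner: "impedance (inner13 G1 G2 R3 C1 L1) =
      imp_frac (smult (m / \<kappa> * \<kappa>) [:c0, c1, c2:]) (smult (m / \<kappa>) [:d0, d1, d2:])"
    using impedance_inner13[of G2 R3 C1 L1 G1] pos unfolding PQ m'(3) m'(2)[symmetric] by blast
  have imp: "impedance (net13 G1 G2 R3 R4 R5 C1 L1 L2) = Some (Fract a b)"
    unfolding net13_def R(6-8) using outer_realization_poly[OF deg b0, of x "m / \<kappa>", folded defs, OF nd(1-3) m'(1) inner] .
  have "R4 \<ge> 0" "R5 \<ge> 0" "L2 > 0"
    using nd x(1) by (simp_all add: R)
  with pos have N: "net13 G1 G2 R3 R4 R5 C1 L1 L2 \<in> class13"
    unfolding class13_def by blast
  have "x = 0 \<Longrightarrow> R5 = 0" "l2 = 0 \<Longrightarrow> R3 = 0" "d2 = 0 \<Longrightarrow> G1 = 0"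
    by (simp_all add: R)
  moreover have "R5 = 0 \<Longrightarrow> net13 G1 G2 R3 R4 R5 C1 L1 L2 \<in> class27"
    "R3 = 0 \<Longrightarrow> net13 G1 G2 R3 R4 R5 C1 L1 L2 \<in> class26"
    "G1 = 0 \<Longrightarrow> net13 G1 G2 R3 R4 R5 C1 L1 L2 \<in> class25"
    using N unfolding class25_def class26_def class27_def by blast+
  moreover have "\<gamma>3 > 0" using strict by (simp add: \<gamma>)
  ultimately show ?thesis
    unfolding Let_def unfolding defs[symmetric] R[symmetric]
    using nd strict imp N by blast
qed

section \<open>The theorem\<close>

text \<open>(C1) is paired with (C2), and (C3) with (C4), since each pair is related by coefficient
  reversal.\<close>

lemma cond_minimal:
  fixes a b :: "real poly"
  assumes deg: "degree a \<le> 3" "degree b \<le> 3" and ab: "coprime a b" "\<exists>i\<in>{0..3}. coeff b i > 0"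
    and x: "x \<ge> 0"
  shows "cond_C1 a b x \<or> cond_C2 a b x \<Longrightarrow> \<exists>x\<ge>0. cond_C1 a b x \<and> cond_E1 a b x \<or> cond_C2 a b x \<and> cond_E2 a b x"
    and "cond_C3 a b x \<or> cond_C4 a b x \<Longrightarrow> \<exists>x\<ge>0. cond_C3 a b x \<and> cond_E3 a b x \<or> cond_C4 a b x \<and> cond_E4 a b x"
proof -
  assume C: "cond_C1 a b x \<or> cond_C2 a b x"
  then have nn: "\<forall>i\<in>{0..3}. coeff a i \<ge> 0 \<and> coeff b i \<ge> 0" "F0 a b > 0"
    unfolding cond_iff_pencil_cond by blast+
  have "\<exists>x\<ge>0. pencil_cond (poly (alpha a) x) (poly (beta b) x) (poly (kappa a b) x)
      (poly (c_poly a b 0) x) (poly (c_poly a b 1) x) (poly (c_poly a b 2) x)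
      (poly (d_poly a b 0) x) (poly (d_poly a b 1) x) (poly (d_poly a b 2) x) \<and>
      (x = 0 \<or> poly (lambda1 a b) x = 0 \<or> poly (c_poly a b 0) x = 0) \<or>
    pencil_cond (poly (alpha a) x) (poly (beta b) x) (poly (kappa a b) x)
      (poly (c_poly a b 2) x) (poly (c_poly a b 1) x) (poly (c_poly a b 0) x)
      (poly (d_poly a b 2) x) (poly (d_poly a b 1) x) (poly (d_poly a b 0) x) \<and>
      (x = 0 \<or> poly (lambda3 a b) x = 0 \<or> poly (c_poly a b 2) x = 0)"
    unfolding poly_lambda_eq_lam
  proof (rule pencil_minimal[OF kappa_pderiv[OF deg] _ x], goal_cases)
    case (1 y)
    \<comment> \<open>Hiding the lambda behind an existential and reordering the set treats the
      condition and its reversal at once.\<close>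
    then have "\<exists>l. same_sign {poly (alpha a) y, poly (beta b) y,
      poly (c_poly a b 0) y, poly (c_poly a b 1) y, poly (c_poly a b 2) y,
      poly (d_poly a b 0) y, poly (d_poly a b 1) y, poly (d_poly a b 2) y, l} \<and> poly (kappa a b) y \<ge> 0"
      unfolding pencil_cond_def by (metis insert_commute)
    then obtain l where "same_sign {poly (alpha a) y, poly (beta b) y,
      poly (c_poly a b 0) y, poly (c_poly a b 1) y, poly (c_poly a b 2) y,
      poly (d_poly a b 0) y, poly (d_poly a b 1) y, poly (d_poly a b 2) y, l}" "poly (kappa a b) y \<ge> 0" by blast
    note pencil_nondegenerate[OF deg ab nn 1(1) this(2,1)]
    then show ?case by blast
  next
    case 2
    then show ?case using C unfolding cond_iff_pencil_cond by blast
  qed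
  then show "\<exists>x\<ge>0. cond_C1 a b x \<and> cond_E1 a b x \<or> cond_C2 a b x \<and> cond_E2 a b x"
    using nn unfolding cond_iff_pencil_cond cond_E1_def cond_E2_def by blast
next
  assume C: "cond_C3 a b x \<or> cond_C4 a b x"
  then have nn: "\<forall>i\<in>{0..3}. coeff a i \<ge> 0 \<and> coeff b i \<ge> 0" "F0 a b > 0"
    unfolding cond_iff_pencil_cond by blast+
  have "\<exists>x\<ge>0. pencil_cond (poly (alpha a) x) (poly (beta b) x) (poly (kappa a b) x)
      (poly (d_poly a b 0) x) (poly (d_poly a b 1) x) (poly (d_poly a b 2) x)
      (poly (c_poly a b 0) x) (poly (c_poly a b 1) x) (poly (c_poly a b 2) x) \<and>
      (x = 0 \<or> poly (lambda4 a b) x = 0 \<or> poly (d_poly a b 0) x = 0) \<or>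
    pencil_cond (poly (alpha a) x) (poly (beta b) x) (poly (kappa a b) x)
      (poly (d_poly a b 2) x) (poly (d_poly a b 1) x) (poly (d_poly a b 0) x)
      (poly (c_poly a b 2) x) (poly (c_poly a b 1) x) (poly (c_poly a b 0) x) \<and>
      (x = 0 \<or> poly (lambda2 a b) x = 0 \<or> poly (d_poly a b 2) x = 0)"
    unfolding poly_lambda_eq_lam
  proof (rule pencil_minimal[OF kappa_pderiv[OF deg] _ x], goal_cases)
    case (1 y)
    then have "\<exists>l. same_sign {poly (alpha a) y, poly (beta b) y,
      poly (c_poly a b 0) y, poly (c_poly a b 1) y, poly (c_poly a b 2) y,
      poly (d_poly a b 0) y, poly (d_poly a b 1) y, poly (d_poly a b 2) y, l} \<and> poly (kappa a b) y \<ge> 0"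
      unfolding pencil_cond_def by (metis insert_commute)
    then obtain l where "same_sign {poly (alpha a) y, poly (beta b) y,
      poly (c_poly a b 0) y, poly (c_poly a b 1) y, poly (c_poly a b 2) y,
      poly (d_poly a b 0) y, poly (d_poly a b 1) y, poly (d_poly a b 2) y, l}" "poly (kappa a b) y \<ge> 0" by blast
    note pencil_nondegenerate[OF deg ab nn 1(1) this(2,1)]
    then show ?case unfolding res22_swap[of "poly (d_poly a b 0) y"] by blast
  next
    case 2
    then show ?case using C unfolding cond_iff_pencil_cond by blast
  qed
  then show "\<exists>x\<ge>0. cond_C3 a b x \<and> cond_E3 a b x \<or> cond_C4 a b x \<and> cond_E4 a b x"
    using nn unfolding cond_iff_pencil_cond cond_E3_def cond_E4_def by blast
qed

theorem theorem24:
  fixes a b :: "real poly"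
  assumes "degree a \<le> 3" and "degree b \<le> 3"
    and "coprime a b"
    and "\<not> (coeff a 3 = 0 \<and> coeff b 3 = 0)"
    and "\<exists>i\<in>{0..3}. coeff b i > 0"
  shows "((\<exists>N \<in> class10 \<union> class11 \<union> class12 \<union> class13. impedance N = Some (Fract a b)) \<longrightarrow>
      (\<exists>x\<ge>0. (cond_C1 a b x \<and> cond_E1 a b x) \<or> (cond_C2 a b x \<and> cond_E2 a b x) \<or>
              (cond_C3 a b x \<and> cond_E3 a b x) \<or> (cond_C4 a b x \<and> cond_E4 a b x))) \<and>
    (\<forall>x\<ge>0. cond_C1 a b x \<longrightarrow>
      (let \<alpha> = poly (alpha a) x; \<beta> = poly (beta b) x; \<kappa> = poly (kappa a b) x;
         c0 = poly (c_poly a b 0) x; c2 = poly (c_poly a b 2) x;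
         d0 = poly (d_poly a b 0) x; d2 = poly (d_poly a b 2) x;
         \<gamma>1 = poly (gamma1 a b) x; \<gamma>2 = poly (gamma2 a b) x;
         l1 = poly (lambda1 a b) x;
         R1 = \<kappa> * c0 / d0;
         R2 = \<kappa> * \<gamma>2 / (d0 * d2);
         G3 = d2 * l1 / (\<beta>^4 * \<kappa>^2 * F0 a b);
         R4 = \<alpha> / \<beta>;
         R5 = \<kappa> * x / \<beta>^2;
         C1 = d2^2 * \<gamma>1 / (\<beta>^4 * \<kappa>^2 * F0 a b);
         L1 = \<kappa> * \<gamma>1 / d0^2;
         L2 = \<kappa> / \<beta>^2;
         N = net10 R1 R2 G3 R4 R5 C1 L1 L2
       in \<beta> \<noteq> 0 \<and> d0 \<noteq> 0 \<and> d2 \<noteq> 0 \<and> \<kappa> > 0 \<and> \<gamma>1 > 0 \<and>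
          N \<in> class10 \<and> impedance N = Some (Fract a b) \<and>
          (x = 0 \<longrightarrow> R5 = 0 \<and> N \<in> class18) \<and>
          (l1 = 0 \<longrightarrow> G3 = 0 \<and> N \<in> class17) \<and>
          (c0 = 0 \<longrightarrow> R1 = 0 \<and> N \<in> class16))) \<and>
    (\<forall>x\<ge>0. cond_C2 a b x \<longrightarrow>
      (let \<alpha> = poly (alpha a) x; \<beta> = poly (beta b) x; \<kappa> = poly (kappa a b) x;
         c0 = poly (c_poly a b 0) x; c2 = poly (c_poly a b 2) x;
         d0 = poly (d_poly a b 0) x; d2 = poly (d_poly a b 2) x;
         \<gamma>3 = poly (gamma3 a b) x; \<gamma>2 = poly (gamma2 a b) x;
         l3 = poly (lambda3 a b) x;
         R1 = \<kappa> * c2 / d2;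
         R2 = - (\<kappa> * \<gamma>2) / (d0 * d2);
         G3 = d0 * l3 / (\<beta>^4 * \<kappa>^2 * F0 a b);
         R4 = \<alpha> / \<beta>;
         R5 = \<kappa> * x / \<beta>^2;
         C1 = - (d2^2) / (\<kappa> * \<gamma>3);
         L1 = - (\<beta>^4 * \<kappa>^2 * F0 a b) / (d0^2 * \<gamma>3);
         L2 = \<kappa> / \<beta>^2;
         N = net11 R1 R2 G3 R4 R5 C1 L1 L2
       in \<beta> \<noteq> 0 \<and> d0 \<noteq> 0 \<and> d2 \<noteq> 0 \<and> \<kappa> > 0 \<and> - \<gamma>3 > 0 \<and>
          N \<in> class11 \<and> impedance N = Some (Fract a b) \<and>
          (x = 0 \<longrightarrow> R5 = 0 \<and> N \<in> class21) \<and>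
          (l3 = 0 \<longrightarrow> G3 = 0 \<and> N \<in> class20) \<and>
          (c2 = 0 \<longrightarrow> R1 = 0 \<and> N \<in> class19))) \<and>
    (\<forall>x\<ge>0. cond_C3 a b x \<longrightarrow>
      (let \<alpha> = poly (alpha a) x; \<beta> = poly (beta b) x; \<kappa> = poly (kappa a b) x;
         c0 = poly (c_poly a b 0) x; c2 = poly (c_poly a b 2) x;
         d0 = poly (d_poly a b 0) x; d2 = poly (d_poly a b 2) x;
         \<gamma>1 = poly (gamma1 a b) x; \<gamma>2 = poly (gamma2 a b) x;
         l4 = poly (lambda4 a b) x;
         G1 = d0 / (\<kappa> * c0);
         G2 = - \<gamma>2 / (\<kappa> * c0 * c2);
         R3 = c2 * l4 / (\<beta>^4 * F0 a b);
         R4 = \<alpha> / \<beta>;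
         R5 = \<kappa> * x / \<beta>^2;
         C1 = - \<gamma>1 / (\<kappa> * c0^2);
         L1 = - (c2^2 * \<gamma>1) / (\<beta>^4 * F0 a b);
         L2 = \<kappa> / \<beta>^2;
         N = net12 G1 G2 R3 R4 R5 C1 L1 L2
       in \<beta> \<noteq> 0 \<and> c0 \<noteq> 0 \<and> c2 \<noteq> 0 \<and> \<kappa> > 0 \<and> - \<gamma>1 > 0 \<and>
          N \<in> class12 \<and> impedance N = Some (Fract a b) \<and>
          (x = 0 \<longrightarrow> R5 = 0 \<and> N \<in> class24) \<and>
          (l4 = 0 \<longrightarrow> R3 = 0 \<and> N \<in> class23) \<and>
          (d0 = 0 \<longrightarrow> G1 = 0 \<and> N \<in> class22))) \<and>
    (\<forall>x\<ge>0. cond_C4 a b x \<longrightarrow>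
      (let \<alpha> = poly (alpha a) x; \<beta> = poly (beta b) x; \<kappa> = poly (kappa a b) x;
         c0 = poly (c_poly a b 0) x; c2 = poly (c_poly a b 2) x;
         d0 = poly (d_poly a b 0) x; d2 = poly (d_poly a b 2) x;
         \<gamma>3 = poly (gamma3 a b) x; \<gamma>2 = poly (gamma2 a b) x;
         l2 = poly (lambda2 a b) x;
         G1 = d2 / (\<kappa> * c2);
         G2 = \<gamma>2 / (\<kappa> * c0 * c2);
         R3 = c0 * l2 / (\<beta>^4 * F0 a b);
         R4 = \<alpha> / \<beta>;
         R5 = \<kappa> * x / \<beta>^2;
         C1 = (\<beta>^4 * F0 a b) / (c0^2 * \<gamma>3);
         L1 = \<kappa> * c2^2 / \<gamma>3;
         L2 = \<kappa> / \<beta>^2;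
         N = net13 G1 G2 R3 R4 R5 C1 L1 L2
       in \<beta> \<noteq> 0 \<and> c0 \<noteq> 0 \<and> c2 \<noteq> 0 \<and> \<kappa> > 0 \<and> \<gamma>3 > 0 \<and>
          N \<in> class13 \<and> impedance N = Some (Fract a b) \<and>
          (x = 0 \<longrightarrow> R5 = 0 \<and> N \<in> class27) \<and>
          (l2 = 0 \<longrightarrow> R3 = 0 \<and> N \<in> class26) \<and>
          (d2 = 0 \<longrightarrow> G1 = 0 \<and> N \<in> class25)))"
proof (intro conjI impI allI)
  note deg = assms(1,2)
  note ab = assms(3-5)
  assume "\<exists>N \<in> class10 \<union> class11 \<union> class12 \<union> class13. impedance N = Some (Fract a b)"
  then have "(\<exists>x\<ge>0. cond_C1 a b x \<or> cond_C2 a b x) \<or> (\<exists>x\<ge>0. cond_C3 a b x \<or> cond_C4 a b x)"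
    using class10_cond[OF deg ab] class11_cond[OF deg ab] class12_cond[OF deg ab] class13_cond[OF deg ab]
    by blast
  then show "\<exists>x\<ge>0. (cond_C1 a b x \<and> cond_E1 a b x) \<or> (cond_C2 a b x \<and> cond_E2 a b x) \<or>
      (cond_C3 a b x \<and> cond_E3 a b x) \<or> (cond_C4 a b x \<and> cond_E4 a b x)"
    using cond_minimal[OF deg assms(3,5)] by blast
qed (fact C1_realization[OF assms(1-3,5)] C2_realization[OF assms(1-3,5)]
  C3_realization[OF assms(1-3,5)] C4_realization[OF assms(1-3,5)])+

end
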